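(* Let $n\in\mathbb{N}$, $m\in\mathbb{N}_0$ and $-1<a\le m$. (i) If $a<m$, then for every $f\in B^{m-a,1}(\mathbb{R}^n)$ there exists $F\in W^{m+1,1}_a(\mathbb{R}^{n+1}_+)$ such that $\operatorname{Tr}(F)=f$ and $$\|F\|_{W^{m+1,1}_a(\mathbb{R}^{n+1}_+)}\le C\,\|f\|_{B^{m-a,1}(\mathbb{R}^n)}.$$ (ii) If $a=m$, then for every $f\in L^1(\mathbb{R}^n)$ there exists $F\in W^{m+1,1}_m(\mathbb{R}^{n+1}_+)$ such that $\operatorname{Tr}(F)=f$ and $$\|F\|_{W^{m+1,1}_m(\mathbb{R}^{n+1}_+)}\le C\,\|f\|_{L^1(\mathbb{R}^n)}.$$ Here $C>0$ is a constant depending only on $n,m,a$ (not on $f$).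
   Context: $\mathbb{N}_0=\{0,1,2,\dots\}$, $\mathbb{N}=\{1,2,\dots\}$, $\mathbb{R}^{n+1}_+=\mathbb{R}^n\times(0,\infty)$ with points $(x,t)$. $\nabla^{k}u$ is the tensor of all (weak) partial derivatives of order $k$ of $u$ jointly in $(x,t)$. Weighted Sobolev space: $W^{m+1,1}_a(\mathbb{R}^{n+1}_+)$ is the space of all $u\in W^{m+1,1}_{\mathrm{loc}}(\mathbb{R}^{n+1}_+)$ with $$\|u\|_{W^{m+1,1}_a(\mathbb{R}^{n+1}_+)}:=\int_{\mathbb{R}^{n+1}_+}t^a|u(x,t)|\,dx\,dt+\sum_{j=1}^{m+1}\int_{\mathbb{R}^{n+1}_+}t^a|\nabla^ju(x,t)|\,dx\,dt<\infty.$$ Trace: $\operatorname{Tr}$ is the usual trace on $\{t=0\}\cong\mathbb{R}^n$, i.e. $\operatorname{Tr}(v)=g$ means that $v(\cdot,t)\to g$ in $L^1_{\mathrm{loc}}(\mathbb{R}^n)$ as $t\to0^+$ (for functions continuous up to $t=0$ it is the restriction to $t=0$). Differences: $\Delta_hf(x)=f(x+h)-f(x)$, $\Delta_h^{k+1}f=\Delta_h^k(\Delta_hf)$. Besov spaces. For $0<s\le1$ put $|f|_{B^{s,1}(\mathbb{R}^n)}:=\int_{\mathbb{R}^n}\|\Delta_h^{\lfloor s\rfloor+1}f\|_{L^1(\mathbb{R}^n)}\frac{dh}{|h|^{n+s}}$ (first differences if $s<1$, second differences if $s=1$); $B^{s,1}(\mathbb{R}^n)$ is the set of $f\in L^1(\mathbb{R}^n)$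 with $|f|_{B^{s,1}}<\infty$, with norm $\|f\|_{B^{s,1}}:=\|f\|_{L^1}+|f|_{B^{s,1}}$. For $s>1$ let $\ell=\max\{j\in\mathbb{N}:j<s\}$; $B^{s,1}(\mathbb{R}^n)$ is the set of $f\in W^{\ell,1}(\mathbb{R}^n)$ with $|f|_{B^{s,1}}:=\sum_{|\alpha|=\ell}\big|\frac{\partial^\alpha f}{\partial x^\alpha}\big|_{B^{s-\ell,1}}<\infty$, with norm $\|f\|_{B^{s,1}}:=\|f\|_{W^{\ell,1}}+|f|_{B^{s,1}}$. *)

theory Defs
  imports "HOL-Analysis.Analysis" "HOL-Library.Multiset"
begin

section \<open>Classical derivatives and test functions\<close>

definition partial_deriv :: "'a::euclidean_space \<Rightarrow> ('a \<Rightarrow> real) \<Rightarrow> 'a \<Rightarrow> real" where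
  "partial_deriv b f x = frechet_derivative f (at x) b"

text \<open>A word \<open>w = [b\<^sub>1, \<dots>, b\<^sub>k]\<close> of basis vectors indexes the entry
  \<open>\<partial>\<^bsub>b\<^sub>1\<^esub> \<dots> \<partial>\<^bsub>b\<^sub>k\<^esub> f\<close> of the tensor of derivatives of order \<open>k\<close>.\<close>

definition iter_partial :: "'a::euclidean_space list \<Rightarrow> ('a \<Rightarrow> real) \<Rightarrow> 'a \<Rightarrow> real" where
  "iter_partial w f = foldr partial_deriv w f"

definition words :: "nat \<Rightarrow> 'a::euclidean_space list set" where
  "words k = {w. set w \<subseteq> Basis \<and> length w = k}"

text \<open>Multi-indices \<open>\<alpha>\<close> with \<open>|\<alpha>| = k\<close> are multisets of basis vectors of size \<open>k\<close>:
  \<open>count \<alpha> b\<close> is the order of differentiation in the direction \<open>b\<close>.\<close>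

definition multi_indices :: "nat \<Rightarrow> 'a::euclidean_space multiset set" where
  "multi_indices k = {\<alpha>. set_mset \<alpha> \<subseteq> Basis \<and> size \<alpha> = k}"

definition smooth :: "('a::euclidean_space \<Rightarrow> real) \<Rightarrow> bool" where
  "smooth f \<longleftrightarrow> (\<forall>k. \<forall>w\<in>words k. iter_partial w f differentiable_on UNIV)"

definition test_functions :: "'a::euclidean_space set \<Rightarrow> ('a \<Rightarrow> real) set" where
  "test_functions \<Omega> = {\<phi>. smooth \<phi> \<and>
     compact (closure (support_on UNIV \<phi>)) \<and> closure (support_on UNIV \<phi>) \<subseteq> \<Omega>}"


section \<open>Weak derivatives and weighted Sobolev spaces\<close>

definition locally_integrable :: "'a::euclidean_space set \<Rightarrow> ('a \<Rightarrow> real) \<Rightarrow> bool" where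
  "locally_integrable \<Omega> u \<longleftrightarrow> (\<forall>K. compact K \<and> K \<subseteq> \<Omega> \<longrightarrow> set_integrable lebesgue K u)"

text \<open>The order of differentiation of a test function is irrelevant, so quantifying over all
  words that enumerate \<open>\<alpha>\<close> only avoids the choice of an ordering.\<close>

definition has_weak_deriv ::
  "'a::euclidean_space set \<Rightarrow> 'a multiset \<Rightarrow> ('a \<Rightarrow> real) \<Rightarrow> ('a \<Rightarrow> real) \<Rightarrow> bool" where
  "has_weak_deriv \<Omega> \<alpha> u g \<longleftrightarrow>
     locally_integrable \<Omega> u \<and> locally_integrable \<Omega> g \<and>
     (\<forall>\<phi>\<in>test_functions \<Omega>. \<forall>w. mset w = \<alpha> \<longrightarrow>
        (LINT x:\<Omega>|lebesgue. u x * iter_partial w \<phi> x)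
          = (-1) ^ size \<alpha> * (LINT x:\<Omega>|lebesgue. g x * \<phi> x))"

text \<open>Weak derivatives are unique up to null sets on open \<open>\<Omega>\<close>; we pick a representative.\<close>

definition weak_deriv ::
  "'a::euclidean_space set \<Rightarrow> 'a multiset \<Rightarrow> ('a \<Rightarrow> real) \<Rightarrow> 'a \<Rightarrow> real" where
  "weak_deriv \<Omega> \<alpha> u = (SOME g. has_weak_deriv \<Omega> \<alpha> u g)"

definition grad_norm :: "'a::euclidean_space set \<Rightarrow> nat \<Rightarrow> ('a \<Rightarrow> real) \<Rightarrow> 'a \<Rightarrow> real" where
  "grad_norm \<Omega> j u x = sqrt (\<Sum>w\<in>words j. (weak_deriv \<Omega> (mset w) u x)\<^sup>2)"

definition sobolev_loc :: "'a::euclidean_space set \<Rightarrow> nat \<Rightarrow> ('a \<Rightarrow> real) set" where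
  "sobolev_loc \<Omega> k = {u. \<forall>j\<le>k. \<forall>\<alpha>\<in>multi_indices j. \<exists>g. has_weak_deriv \<Omega> \<alpha> u g}"

text \<open>\<open>\<omega>\<close> is a weight on \<open>\<Omega>\<close>. The integrals take values in \<open>[0, \<infinity>]\<close>.\<close>

definition sobolev_norm ::
  "'a::euclidean_space set \<Rightarrow> ('a \<Rightarrow> real) \<Rightarrow> nat \<Rightarrow> ('a \<Rightarrow> real) \<Rightarrow> ennreal" where
  "sobolev_norm \<Omega> \<omega> k u =
     (\<integral>\<^sup>+x\<in>\<Omega>. ennreal (\<omega> x * \<bar>u x\<bar>) \<partial>lebesgue)
     + (\<Sum>j=1..k. \<integral>\<^sup>+x\<in>\<Omega>. ennreal (\<omega> x * grad_norm \<Omega> j u x) \<partial>lebesgue)"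

definition sobolev_space ::
  "'a::euclidean_space set \<Rightarrow> ('a \<Rightarrow> real) \<Rightarrow> nat \<Rightarrow> ('a \<Rightarrow> real) set" where
  "sobolev_space \<Omega> \<omega> k = {u \<in> sobolev_loc \<Omega> k. sobolev_norm \<Omega> \<omega> k u < \<infinity>}"

definition upper_half_space :: "('a::euclidean_space \<times> real) set" where
  "upper_half_space = {p. snd p > 0}"

abbreviation half_sobolev_norm ::
  "nat \<Rightarrow> real \<Rightarrow> ('a::euclidean_space \<times> real \<Rightarrow> real) \<Rightarrow> ennreal" where
  "half_sobolev_norm k a \<equiv> sobolev_norm upper_half_space (\<lambda>p. snd p powr a) k"

abbreviation half_sobolev_space ::
  "nat \<Rightarrow> real \<Rightarrow> ('a::euclidean_space \<times> real \<Rightarrow> real) set" where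
  "half_sobolev_space k a \<equiv> sobolev_space upper_half_space (\<lambda>p. snd p powr a) k"


section \<open>Trace\<close>

text \<open>Functions are not identified up to null sets, so \<open>has_trace v g\<close> is a statement about the
  given representative \<open>v\<close>, whose slices \<open>v(\<cdot>, t)\<close> are required to converge for all \<open>t \<rightarrow> 0\<^sup>+\<close>.\<close>

definition has_trace ::
  "('a::euclidean_space \<times> real \<Rightarrow> real) \<Rightarrow> ('a \<Rightarrow> real) \<Rightarrow> bool" where
  "has_trace v g \<longleftrightarrow> locally_integrable UNIV g \<and>
     (\<forall>K. compact K \<longrightarrow>
        (\<forall>\<^sub>F t in at_right 0. set_integrable lebesgue K (\<lambda>x. v (x, t))) \<and>
        ((\<lambda>t. \<integral>\<^sup>+x\<in>K. ennreal \<bar>v (x, t) - g x\<bar> \<partial>lebesgue) \<longlongrightarrow> 0) (at_right 0))"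


section \<open>Besov spaces\<close>

definition L1_space :: "('a::euclidean_space \<Rightarrow> real) set" where
  "L1_space = {f. integrable lebesgue f}"

definition L1_norm :: "('a::euclidean_space \<Rightarrow> real) \<Rightarrow> ennreal" where
  "L1_norm f = (\<integral>\<^sup>+x. ennreal \<bar>f x\<bar> \<partial>lebesgue)"

definition fdiff :: "'a::euclidean_space \<Rightarrow> ('a \<Rightarrow> real) \<Rightarrow> 'a \<Rightarrow> real" where
  "fdiff h f x = f (x + h) - f x"

text \<open>The seminorm for \<open>0 < s \<le> 1\<close>. At \<open>h = 0\<close> the integrand is \<open>0 / 0 = 0\<close>.\<close>

definition besov_seminorm_low :: "real \<Rightarrow> ('a::euclidean_space \<Rightarrow> real) \<Rightarrow> ennreal" where
  "besov_seminorm_low s f =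
     (\<integral>\<^sup>+h. L1_norm ((fdiff h ^^ (nat \<lfloor>s\<rfloor> + 1)) f)
             / ennreal (norm h powr (real DIM('a) + s)) \<partial>lebesgue)"

definition besov_order :: "real \<Rightarrow> nat" where
  "besov_order s = Max {j. 1 \<le> j \<and> real j < s}"

definition besov_seminorm :: "real \<Rightarrow> ('a::euclidean_space \<Rightarrow> real) \<Rightarrow> ennreal" where
  "besov_seminorm s f =
     (if s \<le> 1 then besov_seminorm_low s f
      else \<Sum>\<alpha>\<in>multi_indices (besov_order s).
             besov_seminorm_low (s - real (besov_order s)) (weak_deriv UNIV \<alpha> f))"

definition besov_base :: "real \<Rightarrow> ('a::euclidean_space \<Rightarrow> real) set" where
  "besov_base s = (if s \<le> 1 then L1_space else sobolev_space UNIV (\<lambda>x. 1) (besov_order s))"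

definition besov_base_norm :: "real \<Rightarrow> ('a::euclidean_space \<Rightarrow> real) \<Rightarrow> ennreal" where
  "besov_base_norm s f =
     (if s \<le> 1 then L1_norm f else sobolev_norm UNIV (\<lambda>x. 1) (besov_order s) f)"

definition besov_space :: "real \<Rightarrow> ('a::euclidean_space \<Rightarrow> real) set" where
  "besov_space s = {f \<in> besov_base s. besov_seminorm s f < \<infinity>}"

definition besov_norm :: "real \<Rightarrow> ('a::euclidean_space \<Rightarrow> real) \<Rightarrow> ennreal" where
  "besov_norm s f = besov_base_norm s f + besov_seminorm s f"

end

theory Submission
  imports Defs
begin

text \<open>The extension is a superposition of smooth atoms. If \<open>f\<close> is decomposed as
  \<open>f = (\<Sum>i. \<phi>\<^bsub>r\<^sub>i\<^esub> * h\<^sub>i)\<close> with a compactly supported mollifier \<open>\<phi>\<close> and scales \<open>r\<^sub>i\<close>, put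
  \<open>F(x, t) = (\<Sum>i. (\<phi>\<^bsub>r\<^sub>i\<^esub> * h\<^sub>i)(x) \<theta>(t / r\<^sub>i))\<close> for a cutoff \<open>\<theta>\<close> equal to \<open>1\<close> near \<open>0\<close>. Every
  derivative costs a factor \<open>1 / r\<^sub>i\<close>, and the weight over \<open>0 < t < r\<^sub>i\<close> gains \<open>r\<^sub>i powr (a + 1)\<close>, so
  the weighted Sobolev norm is at most a multiple of \<open>(\<Sum>i. r\<^sub>i powr (a - m) * \<parallel>h\<^sub>i\<parallel>)\<close> in \<open>L\<^sup>1\<close>.

  For \<open>a = m\<close> the scales do not enter this bound, and a decomposition with
  \<open>(\<Sum>i. \<parallel>h\<^sub>i\<parallel>) \<le> 2 \<parallel>f\<parallel>\<close> is obtained greedily: mollify the current remainder at a scale so small that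
  at least half of its norm is removed. For \<open>a < m\<close> the operators \<open>T\<^sub>k\<close>, which average
  \<open>f - (-1)\<^sup>q \<Delta>\<^sub>h\<^sup>q f\<close> over \<open>|h| \<approx> 2\<^sup>-\<^sup>k\<close>, are combinations of mollifications; since they commute, the
  products \<open>T\<^sub>k T\<^sub>k\<^sub>+\<^sub>1 f\<close> telescope into the terms \<open>T\<^sub>k (T\<^sub>k\<^sub>+\<^sub>1 - T\<^sub>k\<^sub>-\<^sub>1) f\<close>, and
  \<open>\<parallel>f - T\<^sub>k f\<parallel>\<close> is controlled by the differences \<open>\<Delta>\<^sub>h\<^sup>q f\<close>, hence by the Besov norm.\<close>

section \<open>Smooth functions of one variable\<close>

text \<open>Two obstacles shape the subcritical case. Splitting f into differences of consecutive
  \<open>T\<^sub>k f\<close> would express each term through mollifications of f itself, which are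
  not small; a product of two commuting operators leaves an outer mollification acting on a small
  function, and that is the form the atoms require. Moreover, the errors must be summed over all
  dyadic scales against |h|^(-n-s). The mollifier is therefore supported in a box with sides
  [1/2, 1], away from the origin, so that for each h at most one dyadic scale contributes. For s > 1
  the order q of the differences is raised by the number of derivatives that the Besov space
  controls, each such difference being paid for by one derivative and a factor |h|. In the critical
  case the scales depend on the successive remainders, so the construction is not linear in f. Sums
  over scales and integrals over centres are treated as one integral over an index measure.
  Derivatives of the superposition are weak ones, obtained by Fubini; uniqueness up to null sets
  links them with the derivatives chosen by \<open>SOME\<close> in the norms.\<close>

primrec times_diff :: "nat \<Rightarrow> (real \<Rightarrow> real) \<Rightarrow> bool" where
  "times_diff 0 f = True"
| "times_diff (Suc n) f =
     (\<exists>f'. (\<forall>x. (f has_real_derivative f' x) (at x)) \<and> times_diff n f')"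

text \<open>The existential recursion of \<open>times_diff\<close> gives closure under sums,
  products and affine substitution by induction; iterates of \<open>deriv\<close> are tied to it
  afterwards by uniqueness of derivatives.\<close>

definition smooth_real :: "(real \<Rightarrow> real) \<Rightarrow> bool" where
  "smooth_real f \<longleftrightarrow> (\<forall>n. times_diff n f)"

lemma times_diff_SucD: "times_diff (Suc n) f \<Longrightarrow> times_diff n f"
proof (induction n arbitrary: f)
  case (Suc n)
  then show ?case by (metis times_diff.simps(2))
qed simp

lemma times_diff_add: "times_diff n f \<Longrightarrow> times_diff n g \<Longrightarrow> times_diff n (\<lambda>x. f x + g x)"
proof (induction n arbitrary: f g)
  case (Suc n)
  then obtain f' g' where "\<forall>x. (f has_real_derivative f' x) (at x)" "times_diff n f'"
    "\<forall>x. (g has_real_derivative g' x) (at x)" "times_diff n g'" by auto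
  with Suc.IH show ?case
    by (auto intro!: exI[of _ "\<lambda>x. f' x + g' x"] derivative_intros)
qed simp

lemma times_diff_mult: "times_diff n f \<Longrightarrow> times_diff n g \<Longrightarrow> times_diff n (\<lambda>x. f x * g x)"
proof (induction n arbitrary: f g)
  case (Suc n)
  then obtain f' g' where d: "\<forall>x. (f has_real_derivative f' x) (at x)" "times_diff n f'"
    "\<forall>x. (g has_real_derivative g' x) (at x)" "times_diff n g'" by auto
  have "times_diff n (\<lambda>x. f' x * g x + g' x * f x)"
    using Suc d times_diff_SucD[OF Suc.prems(1)] times_diff_SucD[OF Suc.prems(2)]
    by (intro times_diff_add) auto
  with d show ?case
    by (auto intro!: exI[of _ "\<lambda>x. f' x * g x + g' x * f x"] DERIV_mult)
qed simp

lemma times_diff_const: "times_diff n (\<lambda>x. c)"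
proof (induction n arbitrary: c)
  case (Suc n)
  then show ?case by (auto intro!: exI[of _ "\<lambda>x. 0"])
qed simp

lemma times_diff_affine: "times_diff n f \<Longrightarrow> times_diff n (\<lambda>x. f (c * x + d))"
proof (induction n arbitrary: f)
  case (Suc n)
  then obtain f' where f': "\<forall>x. (f has_real_derivative f' x) (at x)" "times_diff n f'"
    by auto
  have "((\<lambda>x. f (c * x + d)) has_real_derivative f' (c * x + d) * c) (at x)" for x
    by (rule DERIV_chain2[OF f'(1)[rule_format]]) (auto intro!: derivative_eq_intros)
  moreover have "times_diff n (\<lambda>x. f' (c * x + d) * c)"
    using Suc.IH[OF f'(2)] by (intro times_diff_mult times_diff_const)
  ultimately show ?case by (auto intro!: exI[of _ "\<lambda>x. f' (c * x + d) * c"])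
qed simp

lemma smooth_real_mult: "smooth_real f \<Longrightarrow> smooth_real g \<Longrightarrow> smooth_real (\<lambda>x. f x * g x)"
  by (simp add: smooth_real_def times_diff_mult)

lemma smooth_real_affine: "smooth_real f \<Longrightarrow> smooth_real (\<lambda>x. f (c * x + d))"
  by (simp add: smooth_real_def times_diff_affine)

lemma smooth_real_antideriv:
  assumes "\<And>x. (f has_real_derivative f' x) (at x)" "smooth_real f'"
  shows "smooth_real f"
  unfolding smooth_real_def
proof
  fix n show "times_diff n f" using assms by (cases n) (auto simp: smooth_real_def)
qed

lemma smooth_real_deriv:
  assumes "smooth_real f"
  shows "(f has_real_derivative deriv f x) (at x)" "smooth_real (deriv f)"
proof -
  have *: "\<exists>f'. (\<forall>x. (f has_real_derivative f' x) (at x)) \<and> times_diff n f'" for n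
    using assms unfolding smooth_real_def by (metis times_diff.simps(2))
  have **: "f' = deriv f" if "\<forall>x. (f has_real_derivative f' x) (at x)" for f'
    using that DERIV_imp_deriv by (metis ext)
  show "(f has_real_derivative deriv f x) (at x)" using * ** by blast
  show "smooth_real (deriv f)" unfolding smooth_real_def using * ** by metis
qed

lemma smooth_real_higher_deriv: "smooth_real f \<Longrightarrow> smooth_real ((deriv ^^ i) f)"
  by (induction i) (auto simp: smooth_real_deriv)

lemma has_higher_deriv:
  "smooth_real f \<Longrightarrow> ((deriv ^^ i) f has_real_derivative (deriv ^^ Suc i) f x) (at x)"
  using smooth_real_deriv(1)[OF smooth_real_higher_deriv] by simp

lemma continuous_higher_deriv: "smooth_real f \<Longrightarrow> continuous_on S ((deriv ^^ i) f)"
  by (meson DERIV_isCont continuous_at_imp_continuous_on has_higher_deriv)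

text \<open>Differentiation is local, so a derivative inherits zeros on open sets. This locates the
  supports of all derivatives of \<open>bump\<close> and \<open>cutoff\<close>.\<close>

lemma higher_deriv_eq_0_on_open:
  assumes "smooth_real f" "open S" "\<And>x. x \<in> S \<Longrightarrow> f x = 0" "x \<in> S"
  shows "(deriv ^^ i) f x = 0"
  using assms(4)
proof (induction i arbitrary: x)
  case 0
  then show ?case using assms by simp
next
  case (Suc i)
  have "((deriv ^^ i) f has_real_derivative 0) (at x)"
    by (rule has_field_derivative_transform_within_open[OF _ assms(2) Suc.prems, of "\<lambda>_. 0"])
      (auto simp: Suc.IH)
  then show ?case
    using has_higher_deriv[OF assms(1)] DERIV_unique by blast
qed

text \<open>Allowing a polynomial in 1/x in front of exp (-1/x) closes the family under
  differentiation, with p replaced by X^2 (p - p'); smoothness is then a single induction over all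
  p.\<close>

definition flat :: "real poly \<Rightarrow> real \<Rightarrow> real" where
  "flat p x = (if x > 0 then poly p (1/x) * exp (-1/x) else 0)"

lemma poly_exp_decay: "((\<lambda>y::real. poly p y * exp (- y)) \<longlongrightarrow> 0) at_top"
proof -
  have "((\<lambda>y. \<Sum>i\<le>degree p. coeff p i * (y ^ i / exp y)) \<longlongrightarrow> (\<Sum>i\<le>degree p. coeff p i * 0)) at_top"
    by (intro tendsto_sum tendsto_mult tendsto_const tendsto_power_div_exp_0)
  moreover have "(\<Sum>i\<le>degree p. coeff p i * (y ^ i / exp y)) = poly p y * exp (- y)" for y
    by (simp add: poly_altdef sum_distrib_right exp_minus divide_inverse mult.assoc)
  ultimately show ?thesis by simp
qed

lemma flat_has_deriv:
  "(flat p has_real_derivative flat (monom 1 2 * (p - pderiv p)) x) (at x)"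
proof -
  let ?q = "monom 1 2 * (p - pderiv p)"
  consider "x > 0" | "x < 0" | "x = 0" by linarith
  then show ?thesis
  proof cases
    case 1
    have "((\<lambda>x. poly p (1/x) * exp (-1/x)) has_real_derivative flat ?q x) (at x)"
      using 1 unfolding flat_def
      by (auto intro!: derivative_eq_intros simp: poly_monom field_simps power2_eq_square)
    then show ?thesis
      by (rule has_field_derivative_transform_within_open[of _ _ _ "{0<..}"])
        (use 1 in \<open>auto simp: flat_def\<close>)
  next
    case 2
    have "((\<lambda>x. 0) has_real_derivative flat ?q x) (at x)"
      using 2 unfolding flat_def by simp
    then show ?thesis
      by (rule has_field_derivative_transform_within_open[of _ _ _ "{..<0}"])
        (use 2 in \<open>auto simp: flat_def\<close>)
  next
    case 3
    \<comment> \<open>With y = 1/h the quotient \<open>flat p h / h\<close> is y p(y) exp (-y); the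
      factor \<open>monom 1 1\<close> is this additional y.\<close>
    have "((\<lambda>y. poly (monom 1 1 * p) y * exp (- y)) \<longlongrightarrow> 0) at_top"
      by (rule poly_exp_decay)
    then have "((\<lambda>h. poly (monom 1 1 * p) (inverse h) * exp (- inverse h)) \<longlongrightarrow> 0) (at_right 0)"
      by (simp add: filterlim_at_right_to_top)
    then have right: "((\<lambda>h. flat p h / h) \<longlongrightarrow> 0) (at_right 0)"
      by (rule Lim_transform_eventually)
        (auto simp: eventually_at_filter flat_def poly_monom field_simps)
    have left: "((\<lambda>h. flat p h / h) \<longlongrightarrow> 0) (at_left 0)"
      by (rule Lim_transform_eventually[of "\<lambda>_. 0"])
        (auto simp: eventually_at_filter flat_def)
    have "((\<lambda>h. flat p h / h) \<longlongrightarrow> 0) (at 0)"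
      by (rule filterlim_split_at[OF left right])
    then show ?thesis using 3 by (simp add: DERIV_def flat_def)
  qed
qed

lemma smooth_flat: "smooth_real (flat p)"
proof -
  have "times_diff n (flat p)" for n
  proof (induction n arbitrary: p)
    case (Suc n)
    then show ?case using flat_has_deriv by auto
  qed simp
  then show ?thesis by (simp add: smooth_real_def)
qed

text \<open>The endpoints have ratio 2 and exclude 0: no two dyadic dilates of the resulting
  mollifier are nonzero at the same point, on which \<open>sum_dyadic_mollifier_le\<close>
  rests.\<close>

definition bump :: "real \<Rightarrow> real" where
  "bump x = flat 1 (x - 1/2) * flat 1 (1 - x)"

lemma smooth_bump: "smooth_real bump"
proof -
  have "smooth_real (\<lambda>x. flat 1 (1 * x + (- 1/2)) * flat 1 ((-1) * x + 1))"
    by (intro smooth_real_mult smooth_real_affine smooth_flat)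
  then show ?thesis by (simp add: bump_def[abs_def])
qed

lemma bump_nonneg: "0 \<le> bump x" and bump_pos_iff: "0 < bump x \<longleftrightarrow> 1/2 < x \<and> x < 1"
  by (auto simp: bump_def flat_def)

lemma bump_eq_0: "x \<le> 1/2 \<or> 1 \<le> x \<Longrightarrow> bump x = 0"
  by (auto simp: bump_def flat_def)

lemma higher_deriv_bump_eq_0: "x \<notin> {1/2..1} \<Longrightarrow> (deriv ^^ i) bump x = 0"
  by (rule higher_deriv_eq_0_on_open[OF smooth_bump, of "- {1/2..1}"])
    (auto intro: bump_eq_0)

lemma higher_deriv_bump_bounded: "\<exists>M. \<forall>x. \<bar>(deriv ^^ i) bump x\<bar> \<le> M"
proof -
  have "compact ((deriv ^^ i) bump ` {1/2..1})"
    by (intro compact_continuous_image continuous_higher_deriv smooth_bump) auto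
  then obtain M where "\<And>x. x \<in> {1/2..1} \<Longrightarrow> norm ((deriv ^^ i) bump x) \<le> M"
    by (meson compact_imp_bounded bounded_iff image_eqI)
  then have "\<bar>(deriv ^^ i) bump x\<bar> \<le> max M 0" for x
    using higher_deriv_bump_eq_0[of x i] by (cases "x \<in> {1/2..1}") force+
  then show ?thesis by blast
qed

lemma cutoff_exists:
  "\<exists>\<theta>. smooth_real \<theta> \<and> (\<forall>t\<ge>-1/2. \<theta> t = 1) \<and> (\<forall>t\<le>-1. \<theta> t = 0) \<and> (\<forall>t. 0 \<le> \<theta> t \<and> \<theta> t \<le> 1)
    \<and> (\<forall>i. \<exists>M. \<forall>t. \<bar>(deriv ^^ i) \<theta> t\<bar> \<le> M)"
proof -
  have "\<exists>F. \<forall>x. - \<infinity> < ereal x \<longrightarrow> ereal x < \<infinity> \<longrightarrow> (F has_vector_derivative bump x) (at x)"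
    using continuous_higher_deriv[OF smooth_bump, of UNIV 0]
    by (intro einterval_antiderivative) (auto simp: continuous_on_eq_continuous_at)
  then obtain F where F: "\<And>x. (F has_real_derivative bump x) (at x)"
    by (auto simp: has_real_derivative_iff_has_vector_derivative)
  have mono: "F x \<le> F y" if "x \<le> y" for x y
    using that F bump_nonneg by (meson DERIV_nonneg_imp_nondecreasing)
  have const: "F x = F y" if "x \<le> y" "\<And>z. x \<le> z \<Longrightarrow> z \<le> y \<Longrightarrow> bump z = 0" for x y
  proof (cases "x = y")
    case False
    have "continuous_on {x..y} F"
      using F by (meson DERIV_isCont continuous_at_imp_continuous_on)
    moreover have "(F has_real_derivative 0) (at z)" if "x < z" "z < y" for z
      using F[of z] that \<open>\<And>z. x \<le> z \<Longrightarrow> z \<le> y \<Longrightarrow> bump z = 0\<close>[of z] by simp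
    ultimately show ?thesis
      using DERIV_isconst2[of x y F y] False \<open>x \<le> y\<close> by simp
  qed simp
  have lt: "F (1/2) < F 1"
    by (rule DERIV_pos_imp_increasing_open[of _ _ F])
      (use F bump_pos_iff DERIV_isCont in \<open>force intro: continuous_at_imp_continuous_on\<close>)+
  have F1: "F x = F 1" if "x \<ge> 1" for x
    using const[of 1 x] that bump_eq_0 by auto
  have F2: "F x = F (1/2)" if "x \<le> 1/2" for x
    using const[of x "1/2"] that bump_eq_0 by auto
  have Fb: "F (1/2) \<le> F x" "F x \<le> F 1" for x
    using mono F1 F2 by (metis linear)+
  define D where "D = F 1 - F (1/2)"
  have D: "D > 0" using lt by (simp add: D_def)
  \<comment> \<open>\<open>F\<close> is constant on either side of (1/2, 1), so dividing by its
    increment \<open>D\<close> produces the values 0 and 1; the reflection moves the transition to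
    (-1, -1/2).\<close>
  define \<theta> where "\<theta> t = (F 1 - F (- t)) / D" for t
  have d\<theta>: "(\<theta> has_real_derivative bump (-1 * t + 0) / D) (at t)" for t
  proof -
    have "((\<lambda>t. F (- t)) has_real_derivative bump (- t) * (-1)) (at t)"
      by (rule DERIV_chain2[OF F]) (auto intro!: derivative_eq_intros)
    then show ?thesis
      unfolding \<theta>_def using D by (auto intro!: derivative_eq_intros)
  qed
  have "smooth_real (\<lambda>_. 1/D)" by (simp add: smooth_real_def times_diff_const)
  from smooth_real_mult[OF smooth_real_affine[OF smooth_bump, of "-1" 0] this] have s: "smooth_real (\<lambda>t. bump (-1 * t + 0) / D)" by (simp del: mult_minus1)
  have "smooth_real \<theta>" by (rule smooth_real_antideriv[OF d\<theta> s])
  moreover have "\<exists>M. \<forall>t. \<bar>(deriv ^^ i) \<theta> t\<bar> \<le> M" for i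
  proof -
    \<comment> \<open>Derivatives of \<theta> of positive order are reflected derivatives of
      \<open>bump\<close> divided by \<open>D\<close>, so their bounds are inherited from
      \<open>bump\<close>.\<close>
    have *: "(deriv ^^ i) (\<lambda>t. bump (-1 * t + 0) / D) t = (-1) ^ i * (deriv ^^ i) bump (- t) / D" for i t
    proof (induction i arbitrary: t)
      case (Suc i)
      have "((\<lambda>t. (-1) ^ i * (deriv ^^ i) bump (- t) / D) has_real_derivative
          (-1) ^ Suc i * (deriv ^^ Suc i) bump (- t) / D) (at t)"
      proof -
        have "((\<lambda>t. (deriv ^^ i) bump (- t)) has_real_derivative (deriv ^^ Suc i) bump (- t) * (-1)) (at t)"
          by (rule DERIV_chain2[OF has_higher_deriv[OF smooth_bump]]) (auto intro!: derivative_eq_intros)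
        from DERIV_cdivide[OF DERIV_cmult[OF this, of "(-1) ^ i"], of D] show ?thesis
          by (simp add: mult_ac)
      qed
      moreover have "(deriv ^^ i) (\<lambda>t. bump (-1 * t + 0) / D) = (\<lambda>t. (-1) ^ i * (deriv ^^ i) bump (- t) / D)"
        using Suc.IH by blast
      ultimately show ?case
        by (simp add: DERIV_imp_deriv)
    qed simp
    show ?thesis
    proof (cases i)
      case 0
      have "\<forall>t. \<bar>\<theta> t\<bar> \<le> 1" using Fb D by (auto simp: \<theta>_def D_def abs_le_iff field_simps)
      then show ?thesis using 0 by auto
    next
      case (Suc j)
      have "deriv \<theta> = (\<lambda>t. bump (-1 * t + 0) / D)"
        using d\<theta> by (auto intro!: DERIV_imp_deriv)
      then have eq: "(deriv ^^ i) \<theta> = (deriv ^^ j) (\<lambda>t. bump (-1 * t + 0) / D)"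
        using Suc by (simp add: funpow_swap1)
      obtain M where "\<And>x. \<bar>(deriv ^^ j) bump x\<bar> \<le> M" using higher_deriv_bump_bounded by blast
      then have "\<bar>(deriv ^^ i) \<theta> t\<bar> \<le> M / D" for t
        using D unfolding eq * by (simp add: abs_mult power_abs divide_right_mono)
      then show ?thesis by blast
    qed
  qed
  moreover have "\<theta> t = 1" if "t \<ge> -1/2" for t
    using F2[of "-t"] that D by (simp add: \<theta>_def D_def)
  moreover have "\<theta> t = 0" if "t \<le> -1" for t
    using F1[of "-t"] that by (simp add: \<theta>_def)
  moreover have "0 \<le> \<theta> t \<and> \<theta> t \<le> 1" for t
    using Fb[of "-t"] D by (simp add: \<theta>_def D_def)
  ultimately show ?thesis by blast
qed

text \<open>The cutoff increases from \<open>0\<close> on \<open>(-\<infinity>, -1]\<close> to \<open>1\<close> on \<open>[-1/2, \<infinity>)\<close>: it is applied to \<open>- t / r\<close>.\<close>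

definition cutoff :: "real \<Rightarrow> real" where
  "cutoff = (SOME \<theta>. smooth_real \<theta> \<and> (\<forall>t\<ge>-1/2. \<theta> t = 1) \<and> (\<forall>t\<le>-1. \<theta> t = 0) \<and>
     (\<forall>t. 0 \<le> \<theta> t \<and> \<theta> t \<le> 1) \<and> (\<forall>i. \<exists>M. \<forall>t. \<bar>(deriv ^^ i) \<theta> t\<bar> \<le> M))"

lemma smooth_cutoff: "smooth_real cutoff"
  and cutoff_eq_1: "t \<ge> -1/2 \<Longrightarrow> cutoff t = 1"
  and cutoff_eq_0: "t \<le> -1 \<Longrightarrow> cutoff t = 0"
  and cutoff_range: "0 \<le> cutoff t" "cutoff t \<le> 1"
  and higher_deriv_cutoff_bounded: "\<exists>M. \<forall>t. \<bar>(deriv ^^ i) cutoff t\<bar> \<le> M"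
  using someI_ex[OF cutoff_exists, folded cutoff_def] by blast+

lemma higher_deriv_cutoff_eq_0: "t < -1 \<Longrightarrow> (deriv ^^ i) cutoff t = 0"
  by (rule higher_deriv_eq_0_on_open[OF smooth_cutoff, of "{..< -1}"])
    (auto intro: cutoff_eq_0)

section \<open>Families of classical derivatives and integration by parts\<close>

text \<open>Indexing by multisets builds the symmetry of mixed partial derivatives into the data.
  Every member is smooth, because its derivative is again expressed through members.\<close>

definition deriv_family :: "('a::euclidean_space multiset \<Rightarrow> 'a \<Rightarrow> real) \<Rightarrow> bool" where
  "deriv_family D \<longleftrightarrow>
     (\<forall>\<alpha> x. (D \<alpha> has_derivative (\<lambda>h. \<Sum>b\<in>Basis. (h \<bullet> b) * D (add_mset b \<alpha>) x)) (at x))"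

lemma deriv_familyD:
  "deriv_family D \<Longrightarrow> (D \<alpha> has_derivative (\<lambda>h. \<Sum>b\<in>Basis. (h \<bullet> b) * D (add_mset b \<alpha>) x)) (at x)"
  unfolding deriv_family_def by (elim allE)

lemma deriv_family_differentiable: "deriv_family D \<Longrightarrow> D \<alpha> differentiable (at x)"
  unfolding differentiable_def by (rule exI) (rule deriv_familyD)

lemma deriv_family_continuous: "deriv_family D \<Longrightarrow> continuous_on S (D \<alpha>)"
  by (rule continuous_at_imp_continuous_on)
    (simp add: deriv_family_differentiable[of D] differentiable_imp_continuous_within)

lemma deriv_family_partial_deriv:
  assumes "deriv_family D" "b \<in> Basis"
  shows "partial_deriv b (D \<alpha>) = D (add_mset b \<alpha>)"
proof
  fix x
  have "frechet_derivative (D \<alpha>) (at x) = (\<lambda>h. \<Sum>b\<in>Basis. (h \<bullet> b) * D (add_mset b \<alpha>) x)"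
    using frechet_derivative_at[OF deriv_familyD[OF assms(1)]] by metis
  then show "partial_deriv b (D \<alpha>) x = D (add_mset b \<alpha>) x"
    using assms(2) by (simp add: partial_deriv_def inner_Basis if_distrib if_distribR sum.delta' cong: if_cong)
qed

lemma deriv_family_iter_partial:
  assumes "deriv_family D" "set w \<subseteq> Basis"
  shows "iter_partial w (D \<alpha>) = D (mset w + \<alpha>)"
  using assms(2)
  by (induction w) (auto simp: iter_partial_def deriv_family_partial_deriv[OF assms(1)])

lemma deriv_family_smooth: "deriv_family D \<Longrightarrow> smooth (D \<alpha>)"
  by (auto simp: smooth_def words_def deriv_family_iter_partial differentiable_on_def
      deriv_family_differentiable[of D])

lemma test_functionI:
  assumes "smooth \<psi>" "compact K" "K \<subseteq> \<Omega>" "\<And>x. x \<notin> K \<Longrightarrow> \<psi> x = 0"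
  shows "\<psi> \<in> test_functions \<Omega>"
proof -
  have "closure (support_on UNIV \<psi>) \<subseteq> K"
    by (rule closure_minimal) (use assms in \<open>auto simp: support_on_def compact_imp_closed\<close>)
  moreover from this have "compact (closure (support_on UNIV \<psi>))"
    using assms(2) by (metis closed_closure compact_Int_closed inf.absorb_iff2)
  ultimately show ?thesis using assms by (auto simp: test_functions_def)
qed

definition product_family :: "('a::euclidean_space \<Rightarrow> real \<Rightarrow> real) \<Rightarrow> 'a multiset \<Rightarrow> 'a \<Rightarrow> real" where
  "product_family p \<alpha> x = (\<Prod>b\<in>Basis. (deriv ^^ count \<alpha> b) (p b) (x \<bullet> b))"

lemma deriv_family_product:
  fixes p :: "'a::euclidean_space \<Rightarrow> real \<Rightarrow> real"
  assumes "\<And>b. b \<in> Basis \<Longrightarrow> smooth_real (p b)"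
  shows "deriv_family (product_family p)"
  unfolding deriv_family_def
proof (intro allI)
  fix \<alpha> and x :: 'a
  let ?f = "\<lambda>b x. (deriv ^^ count \<alpha> b) (p b) (x \<bullet> b)"
  let ?f' = "\<lambda>b h. (h \<bullet> b) * (deriv ^^ Suc (count \<alpha> b)) (p b) (x \<bullet> b)"
  have "(?f b has_derivative ?f' b) (at x)" if "b \<in> Basis" for b
  proof -
    have "((deriv ^^ count \<alpha> b) (p b) has_derivative
        (\<lambda>y. y * (deriv ^^ Suc (count \<alpha> b)) (p b) (x \<bullet> b))) (at (x \<bullet> b))"
      using has_higher_deriv[OF assms[OF that], of "count \<alpha> b" "x \<bullet> b"]
      by (simp add: has_field_derivative_def mult.commute[of _ "(deriv ^^ _) _ _"] mult_commute_abs)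
    then show ?thesis
      using has_derivative_compose[OF has_derivative_inner_left[OF has_derivative_ident]] by fastforce
  qed
  then have "((\<lambda>x. \<Prod>b\<in>Basis. ?f b x) has_derivative
      (\<lambda>h. \<Sum>b\<in>Basis. ?f' b h * (\<Prod>c\<in>Basis - {b}. ?f c x))) (at x)"
    by (rule has_derivative_prod)
  moreover have "(\<lambda>h. \<Sum>b\<in>Basis. ?f' b h * (\<Prod>c\<in>Basis - {b}. ?f c x)) =
      (\<lambda>h. \<Sum>b\<in>Basis. (h \<bullet> b) * product_family p (add_mset b \<alpha>) x)"
  proof (intro ext sum.cong refl)
    fix b h assume that: "b \<in> (Basis :: 'a set)"
    show "?f' b h * (\<Prod>c\<in>Basis - {b}. ?f c x) = (h \<bullet> b) * product_family p (add_mset b \<alpha>) x"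
    proof -
      have "(\<Prod>c\<in>Basis - {b}. (deriv ^^ count (add_mset b \<alpha>) c) (p c) (x \<bullet> c)) = (\<Prod>c\<in>Basis - {b}. ?f c x)"
        by (rule prod.cong) auto
      then show ?thesis
        using that by (simp add: product_family_def prod.remove[of Basis b] del: count_add_mset)
          (simp add: mult_ac)
    qed
  qed
  ultimately show "(product_family p \<alpha> has_derivative
      (\<lambda>h. \<Sum>b\<in>Basis. (h \<bullet> b) * product_family p (add_mset b \<alpha>) x)) (at x)"
    by (simp only: product_family_def[of p \<alpha>, abs_def])
qed

text \<open>By the chain rule each derivative in x contributes a factor -1/r. This is where the loss
  of one power of the scale per order originates.\<close>

lemma deriv_family_scale:
  fixes D :: "'a::euclidean_space multiset \<Rightarrow> 'a \<Rightarrow> real"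
  assumes D: "deriv_family D"
  shows "deriv_family (\<lambda>\<alpha> x. c * (- 1 / r) ^ size \<alpha> * D \<alpha> ((y - x) /\<^sub>R r))"
  unfolding deriv_family_def
proof (intro allI)
  fix \<alpha> and x :: 'a
  have "((\<lambda>x. (y - x) /\<^sub>R r) has_derivative (\<lambda>h. (- h) /\<^sub>R r)) (at x)"
    by (auto intro!: derivative_eq_intros)
  from has_derivative_compose[OF this deriv_familyD[OF D]]
  have "((\<lambda>x. c * (- 1 / r) ^ size \<alpha> * D \<alpha> ((y - x) /\<^sub>R r)) has_derivative
     (\<lambda>h. c * (- 1 / r) ^ size \<alpha> *
        (\<Sum>b\<in>Basis. (((- h) /\<^sub>R r) \<bullet> b) * D (add_mset b \<alpha>) ((y - x) /\<^sub>R r)))) (at x)"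
    by (rule has_derivative_mult_right)
  then show "((\<lambda>x. c * (- 1 / r) ^ size \<alpha> * D \<alpha> ((y - x) /\<^sub>R r)) has_derivative
     (\<lambda>h. \<Sum>b\<in>Basis. (h \<bullet> b) *
        (c * (- 1 / r) ^ size (add_mset b \<alpha>) * D (add_mset b \<alpha>) ((y - x) /\<^sub>R r)))) (at x)"
    by (simp add: sum_distrib_left divide_inverse mult_ac)
qed

lemma smooth_iter_partial:
  assumes "smooth \<psi>" "set w \<subseteq> Basis"
  shows "iter_partial w \<psi> differentiable (at x)" "continuous_on S (iter_partial w \<psi>)"
proof -
  show "iter_partial w \<psi> differentiable (at x)" for x
    using assms by (auto simp: smooth_def words_def differentiable_on_def)
  then show "continuous_on S (iter_partial w \<psi>)"
    by (meson continuous_at_imp_continuous_on differentiable_imp_continuous_within)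
qed

lemma iter_partial_eq_0:
  assumes "closed K" "\<And>x. x \<notin> K \<Longrightarrow> \<psi> x = 0" "x \<notin> K"
  shows "iter_partial w \<psi> x = 0"
  using assms(3)
proof (induction w arbitrary: x)
  case Nil
  then show ?case by (simp add: iter_partial_def assms)
next
  case (Cons b w)
  have "(iter_partial w \<psi> has_derivative (\<lambda>h. 0)) (at x)"
    by (rule has_derivative_transform_within_open[of "\<lambda>_. 0" _ x UNIV "- K"])
      (use assms(1) Cons in auto)
  then have "frechet_derivative (iter_partial w \<psi>) (at x) b = 0"
    using frechet_derivative_at by metis
  then show ?case by (simp add: iter_partial_def partial_deriv_def)
qed

section \<open>Integration by parts against compactly supported functions\<close>

lemma integrable_continuous_compact_support:
  fixes f :: "'a::euclidean_space \<Rightarrow> real"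
  assumes "continuous_on UNIV f" "compact K" "\<And>x. x \<notin> K \<Longrightarrow> f x = 0"
  shows "integrable lborel f"
proof -
  have "integrable lborel (\<lambda>x. indicator K x *\<^sub>R f x)"
    by (rule borel_integrable_compact[OF assms(2) continuous_on_subset[OF assms(1) subset_UNIV]])
  moreover have "(\<lambda>x. indicator K x *\<^sub>R f x) = f"
    using assms(3) by (auto simp: indicator_def fun_eq_iff)
  ultimately show ?thesis by simp
qed

lemma bounded_continuous_compact_support:
  fixes f :: "'a::euclidean_space \<Rightarrow> real"
  assumes "continuous_on UNIV f" "compact K" "\<And>x. x \<notin> K \<Longrightarrow> f x = 0"
  obtains M where "M \<ge> 0" "\<And>x. \<bar>f x\<bar> \<le> M"
proof -
  have "compact (f ` K)" using assms by (meson compact_continuous_image continuous_on_subset subset_UNIV)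
  then obtain M where M: "\<And>x. x \<in> K \<Longrightarrow> \<bar>f x\<bar> \<le> M"
    by (metis bounded_iff compact_imp_bounded image_eqI real_norm_def)
  have "\<bar>f x\<bar> \<le> max M 0" for x
    using M[of x] assms(3)[of x] by (cases "x \<in> K") auto
  then show thesis using that[of "max M 0"] by auto
qed

lemma lborel_integral_shift:
  fixes f :: "'a::euclidean_space \<Rightarrow> real"
  assumes "f \<in> borel_measurable borel"
  shows "(\<integral>x. f (x + c) \<partial>lborel) = (\<integral>x. f x \<partial>lborel)"
proof -
  have "(\<integral>x. f x \<partial>lborel) = (\<integral>x. f x \<partial>distr lborel borel ((+) c))"
    by (simp add: lborel_distr_plus)
  also have "\<dots> = (\<integral>x. f (c + x) \<partial>lborel)"
    by (rule integral_distr) (use assms in auto)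
  finally show ?thesis by (simp add: add.commute)
qed

lemma has_real_derivative_line:
  assumes "g differentiable (at (x + s *\<^sub>R h))"
  shows "((\<lambda>s. g (x + s *\<^sub>R h)) has_real_derivative frechet_derivative g (at (x + s *\<^sub>R h)) h) (at s)"
proof -
  let ?D = "frechet_derivative g (at (x + s *\<^sub>R h))"
  have D: "(g has_derivative ?D) (at (x + s *\<^sub>R h))"
    using assms by (simp add: frechet_derivative_works)
  have "((\<lambda>s. x + s *\<^sub>R h) has_derivative (\<lambda>k. k *\<^sub>R h)) (at s)"
    by (auto intro!: derivative_eq_intros)
  from has_derivative_compose[OF this D]
  have "((\<lambda>s. g (x + s *\<^sub>R h)) has_derivative (\<lambda>k. ?D (k *\<^sub>R h))) (at s)" .
  moreover have "(\<lambda>k. ?D (k *\<^sub>R h)) = (*) (?D h)"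
    using linear_cmul[OF has_derivative_linear[OF D]] by (auto simp: mult.commute)
  ultimately show ?thesis by (simp add: has_field_derivative_def)
qed

text \<open>Difference quotients of a compactly supported function have integral zero by translation
  invariance, and dominated convergence passes this to the partial derivative. No iterated
  integration is involved.\<close>

lemma integral_partial_deriv_eq_0:
  fixes g :: "'a::euclidean_space \<Rightarrow> real"
  assumes diff: "\<And>x. g differentiable (at x)"
    and cont: "continuous_on UNIV (partial_deriv b g)"
    and K: "compact K" "\<And>x. x \<notin> K \<Longrightarrow> g x = 0"
  shows "(\<integral>x. partial_deriv b g x \<partial>lborel) = 0"
proof -
  have contg: "continuous_on UNIV g"
    using diff by (meson continuous_at_imp_continuous_on differentiable_imp_continuous_within)
  have pd0: "partial_deriv b g x = 0" if "x \<notin> K" for x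
    using iter_partial_eq_0[where x=x and w="[b]" and K=K and \<psi>=g] K that
    by (simp add: iter_partial_def compact_imp_closed)
  obtain M where M: "M \<ge> 0" "\<And>x. \<bar>partial_deriv b g x\<bar> \<le> M"
    using bounded_continuous_compact_support[OF cont K(1) pd0] by blast
  obtain R where R: "\<And>x. x \<in> K \<Longrightarrow> norm x \<le> R"
    using compact_imp_bounded[OF K(1)] by (auto simp: bounded_iff)
  \<comment> \<open>Steps of length at most 1 keep the supports of all difference quotients in one
    ball, and the mean value theorem bounds the quotients by \<open>M\<close>; together this is an
    integrable majorant.\<close>
  define h where "h n = inverse (real (Suc n))" for n
  have h: "h n > 0" "h n \<le> 1" for n by (auto simp: h_def field_simps)
  define q where "q n x = (g (x + h n *\<^sub>R b) - g x) / h n" for n x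
  have line: "((\<lambda>s. g (x + s *\<^sub>R b)) has_real_derivative partial_deriv b g (x + s *\<^sub>R b)) (at s)" for x s
    unfolding partial_deriv_def by (rule has_real_derivative_line) (rule diff)
  have qM: "\<bar>q n x\<bar> \<le> M" for n x
  proof -
    obtain z where "g (x + h n *\<^sub>R b) - g (x + 0 *\<^sub>R b) = (h n - 0) * partial_deriv b g (x + z *\<^sub>R b)"
      using MVT2[of 0 "h n" "\<lambda>s. g (x + s *\<^sub>R b)" "\<lambda>s. partial_deriv b g (x + s *\<^sub>R b)"] h line by blast
    then have "q n x = partial_deriv b g (x + z *\<^sub>R b)" using h[of n] by (simp add: q_def)
    then show ?thesis using M by simp
  qed
  let ?B = "cball 0 (R + norm b) :: 'a set"
  have q0: "q n x = 0" if "x \<notin> ?B" for n x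
  proof -
    have "norm x > R + norm b" using that by simp
    moreover have "norm x \<le> norm (x + h n *\<^sub>R b) + norm (h n *\<^sub>R b)"
      by (metis add_diff_cancel_right' norm_triangle_ineq4)
    moreover have "norm (h n *\<^sub>R b) \<le> norm b" using h[of n] by (simp add: mult_left_le_one_le)
    ultimately have "x \<notin> K" "x + h n *\<^sub>R b \<notin> K" using R[of x] R[of "x + h n *\<^sub>R b"] norm_ge_zero[of b] by linarith+
    then show ?thesis by (simp add: q_def K)
  qed
  have [measurable]: "g \<in> borel_measurable borel" "partial_deriv b g \<in> borel_measurable borel"
    using contg cont by (auto intro: borel_measurable_continuous_onI)
  have "(\<lambda>n. \<integral>x. q n x \<partial>lborel) \<longlonglongrightarrow> (\<integral>x. partial_deriv b g x \<partial>lborel)"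
  proof (rule integral_dominated_convergence[where w="\<lambda>x. M * indicator ?B x"])
    show "integrable lborel (\<lambda>x. M * indicator ?B x)"
      by (intro integrable_mult_right integrable_real_indicator) (auto simp: emeasure_lborel_cball_finite[unfolded infinity_ennreal_def])
    show "AE x in lborel. (\<lambda>n. q n x) \<longlonglongrightarrow> partial_deriv b g x"
    proof (rule AE_I2)
      fix x
      have "((\<lambda>h. (g (x + (0 + h) *\<^sub>R b) - g (x + 0 *\<^sub>R b)) / h) \<longlongrightarrow> partial_deriv b g (x + 0 *\<^sub>R b)) (at 0)"
        using line[of x 0] by (simp add: DERIV_def)
      moreover have "filterlim h (at 0) sequentially"
        using LIMSEQ_inverse_real_of_nat h
        by (auto simp: filterlim_at h_def[abs_def] intro!: always_eventually)
      ultimately show "(\<lambda>n. q n x) \<longlonglongrightarrow> partial_deriv b g x"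
        unfolding q_def by (auto dest: filterlim_compose)
    qed
    show "AE x in lborel. norm (q n x) \<le> M * indicator ?B x" for n
      using qM q0 by (intro AE_I2) (auto simp: indicator_def)
  qed (auto simp: q_def)
  moreover have "(\<integral>x. q n x \<partial>lborel) = 0" for n
  proof -
    have i: "integrable lborel g" by (rule integrable_continuous_compact_support[OF contg K])
    have "(\<integral>x. g (x + h n *\<^sub>R b) - g x \<partial>lborel) = (\<integral>x. g (x + h n *\<^sub>R b) \<partial>lborel) - (\<integral>x. g x \<partial>lborel)"
    proof (rule Bochner_Integration.integral_diff[OF _ i])
      show "integrable lborel (\<lambda>x. g (x + h n *\<^sub>R b))"
      proof (rule integrable_continuous_compact_support)
        show "continuous_on UNIV (\<lambda>x. g (x + h n *\<^sub>R b))"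
          by (intro continuous_on_compose2[OF contg] continuous_intros) auto
        show "compact ((\<lambda>x. x - h n *\<^sub>R b) ` K)"
          by (intro compact_continuous_image K continuous_intros)
        show "g (x + h n *\<^sub>R b) = 0" if "x \<notin> (\<lambda>x. x - h n *\<^sub>R b) ` K" for x
          using that by (intro K) (force simp: image_iff)
      qed
    qed
    then show ?thesis by (simp add: q_def lborel_integral_shift)
  qed
  ultimately show ?thesis by (simp add: LIMSEQ_const_iff)
qed

text \<open>The product of \<open>u\<close> and \<open>v\<close> inherits compact support from
  \<open>v\<close>, so the integral of its partial derivative vanishes.\<close>

lemma integration_by_parts_partial:
  fixes u v :: "'a::euclidean_space \<Rightarrow> real"
  assumes u: "\<And>x. u differentiable (at x)" "continuous_on UNIV (partial_deriv b u)"
    and v: "\<And>x. v differentiable (at x)" "continuous_on UNIV (partial_deriv b v)"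
    and K: "compact K" "\<And>x. x \<notin> K \<Longrightarrow> v x = 0"
  shows "(\<integral>x. u x * partial_deriv b v x \<partial>lborel) = - (\<integral>x. partial_deriv b u x * v x \<partial>lborel)"
proof -
  have cu: "continuous_on UNIV u" "continuous_on UNIV v"
    using u v by (meson continuous_at_imp_continuous_on differentiable_imp_continuous_within)+
  have pd: "partial_deriv b (\<lambda>x. u x * v x) = (\<lambda>x. u x * partial_deriv b v x + partial_deriv b u x * v x)"
  proof
    fix x
    have "((\<lambda>x. u x * v x) has_derivative (\<lambda>h. u x * frechet_derivative v (at x) h + frechet_derivative u (at x) h * v x)) (at x)"
      using u(1) v(1) by (intro has_derivative_mult) (simp_all add: frechet_derivative_works[symmetric])
    from frechet_derivative_at[OF this]
    show "partial_deriv b (\<lambda>x. u x * v x) x = u x * partial_deriv b v x + partial_deriv b u x * v x"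
      unfolding partial_deriv_def by (simp add: fun_eq_iff)
  qed
  have v0: "partial_deriv b v x = 0" if "x \<notin> K" for x
    using iter_partial_eq_0[where x=x and w="[b]" and K=K and \<psi>=v] K that
    by (simp add: iter_partial_def compact_imp_closed)
  have "(\<integral>x. partial_deriv b (\<lambda>x. u x * v x) x \<partial>lborel) = 0"
  proof (rule integral_partial_deriv_eq_0[where K=K])
    show "(\<lambda>x. u x * v x) differentiable (at x)" for x
      using u(1) v(1) by (intro differentiable_mult)
    show "continuous_on UNIV (partial_deriv b (\<lambda>x. u x * v x))"
      unfolding pd by (intro continuous_intros u v cu)
  qed (use K in auto)
  moreover have "integrable lborel (\<lambda>x. u x * partial_deriv b v x)"
    by (rule integrable_continuous_compact_support[OF _ K(1)]) (auto intro!: continuous_intros u v cu simp: v0)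
  moreover have "integrable lborel (\<lambda>x. partial_deriv b u x * v x)"
    by (rule integrable_continuous_compact_support[OF _ K(1)]) (auto intro!: continuous_intros u v cu simp: K)
  ultimately show ?thesis by (simp add: pd)
qed

text \<open>Each derivative moved away from \<psi> enlarges the multiset \<alpha>, hence the
  induction over the word with \<alpha> arbitrary.\<close>

lemma integration_by_parts_iter_partial:
  fixes D :: "'a::euclidean_space multiset \<Rightarrow> 'a \<Rightarrow> real"
  assumes D: "deriv_family D" and \<psi>: "smooth \<psi>" and K: "compact K" "\<And>x. x \<notin> K \<Longrightarrow> \<psi> x = 0"
    and w: "set w \<subseteq> Basis"
  shows "(\<integral>x. D \<alpha> x * iter_partial w \<psi> x \<partial>lborel) = (-1) ^ length w * (\<integral>x. D (mset w + \<alpha>) x * \<psi> x \<partial>lborel)"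
  using w
proof (induction w arbitrary: \<alpha>)
  case Nil
  then show ?case by (simp add: iter_partial_def)
next
  case (Cons b w)
  have b: "b \<in> Basis" "set w \<subseteq> Basis" using Cons.prems by auto
  have eq: "iter_partial (b # w) \<psi> = partial_deriv b (iter_partial w \<psi>)"
    by (simp add: iter_partial_def)
  have "(\<integral>x. D \<alpha> x * partial_deriv b (iter_partial w \<psi>) x \<partial>lborel)
      = - (\<integral>x. partial_deriv b (D \<alpha>) x * iter_partial w \<psi> x \<partial>lborel)"
  proof (rule integration_by_parts_partial[OF _ _ _ _ K(1)])
    show "D \<alpha> differentiable (at x)" for x by (rule deriv_family_differentiable[OF D])
    show "continuous_on UNIV (partial_deriv b (D \<alpha>))"
      by (simp add: deriv_family_partial_deriv[OF D b(1)] deriv_family_continuous[OF D])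
    show "iter_partial w \<psi> differentiable (at x)" for x using smooth_iter_partial[OF \<psi> b(2)] by simp
    show "continuous_on UNIV (partial_deriv b (iter_partial w \<psi>))"
      using smooth_iter_partial(2)[OF \<psi>, of "b # w"] Cons.prems by (simp add: eq)
    show "iter_partial w \<psi> x = 0" if "x \<notin> K" for x
      by (rule iter_partial_eq_0[OF compact_imp_closed[OF K(1)] K(2) that])
  qed
  also have "\<dots> = - ((-1) ^ length w * (\<integral>x. D (mset w + add_mset b \<alpha>) x * \<psi> x \<partial>lborel))"
    by (simp add: deriv_family_partial_deriv[OF D b(1)] Cons.IH[OF b(2)])
  finally show ?case by (simp add: eq)
qed

lemma test_functionD:
  fixes \<psi> :: "'a::euclidean_space \<Rightarrow> real"
  assumes "\<psi> \<in> test_functions \<Omega>"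
  obtains K where "smooth \<psi>" "compact K" "K \<subseteq> \<Omega>" "\<And>w x. x \<notin> K \<Longrightarrow> iter_partial w \<psi> x = 0"
    "\<And>x. x \<notin> K \<Longrightarrow> \<psi> x = 0"
proof -
  let ?K = "closure (support_on UNIV \<psi>)"
  have K: "smooth \<psi>" "compact ?K" "?K \<subseteq> \<Omega>" using assms by (auto simp: test_functions_def)
  have 0: "\<psi> x = 0" if "x \<notin> ?K" for x
    using subsetD[OF closure_subset, of x "support_on UNIV \<psi>"] that by (auto simp: support_on_def)
  show thesis
    by (rule that[OF K iter_partial_eq_0 0]) (use 0 in auto)
qed

lemma set_lebesgue_integral_test:
  fixes f :: "'a::euclidean_space \<Rightarrow> real"
  assumes "\<And>x. x \<notin> \<Omega> \<Longrightarrow> f x = 0" "f \<in> borel_measurable borel"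
  shows "(LINT x:\<Omega>|lebesgue. f x) = (\<integral>x. f x \<partial>lborel)"
proof -
  have "(\<lambda>x. indicator \<Omega> x *\<^sub>R f x) = f" using assms(1) by (auto simp: indicator_def fun_eq_iff)
  then show ?thesis
    unfolding set_lebesgue_integral_def using integral_completion[of f lborel] assms by simp
qed

section \<open>Continuity of translations in the mean\<close>

lemma L1_norm_lborel: "L1_norm f = (\<integral>\<^sup>+x. ennreal \<bar>f x\<bar> \<partial>lborel)"
  by (simp add: L1_norm_def nn_integral_completion)

lemma integrable_lborel_iff_L1_norm:
  "integrable lborel f \<longleftrightarrow> f \<in> borel_measurable borel \<and> L1_norm f < \<infinity>"
  by (simp add: integrable_iff_bounded L1_norm_lborel)

lemma L1_norm_eq_integral: "integrable lborel f \<Longrightarrow> L1_norm f = ennreal (\<integral>x. \<bar>f x\<bar> \<partial>lborel)"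
  by (simp add: L1_norm_lborel nn_integral_eq_integral)

lemma nn_integral_lborel_affine:
  fixes f :: "'a::euclidean_space \<Rightarrow> ennreal"
  assumes [measurable]: "f \<in> borel_measurable borel" and "c \<noteq> 0"
  shows "(\<integral>\<^sup>+x. f x \<partial>lborel) = ennreal (\<bar>c\<bar> ^ DIM('a)) * (\<integral>\<^sup>+x. f (t + c *\<^sub>R x) \<partial>lborel)"
  by (subst lborel_affine[OF \<open>c \<noteq> 0\<close>, of t])
    (simp add: nn_integral_density nn_integral_distr nn_integral_cmult)

lemma integral_lborel_affine:
  fixes f :: "'a::euclidean_space \<Rightarrow> real"
  assumes [measurable]: "f \<in> borel_measurable borel" and "c \<noteq> 0"
  shows "(\<integral>x. f x \<partial>lborel) = \<bar>c\<bar> ^ DIM('a) * (\<integral>x. f (t + c *\<^sub>R x) \<partial>lborel)"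
  by (subst lborel_affine[OF \<open>c \<noteq> 0\<close>, of t])
    (simp add: integral_density integral_distr)

lemma integrable_lborel_affine:
  fixes f :: "'a::euclidean_space \<Rightarrow> real"
  assumes "integrable lborel f" and "c \<noteq> 0"
  shows "integrable lborel (\<lambda>x. f (t + c *\<^sub>R x))"
proof -
  have [measurable]: "f \<in> borel_measurable borel" using assms by auto
  have "ennreal (\<bar>c\<bar> ^ DIM('a)) * (\<integral>\<^sup>+x. ennreal (norm (f (t + c *\<^sub>R x))) \<partial>lborel) < \<infinity>"
    using nn_integral_lborel_affine[of "\<lambda>x. ennreal (norm (f x))" c t] assms
    by (simp add: integrable_iff_bounded)
  then have "(\<integral>\<^sup>+x. ennreal (norm (f (t + c *\<^sub>R x))) \<partial>lborel) < \<infinity>"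
    using \<open>c \<noteq> 0\<close> by (auto simp: ennreal_mult_less_top)
  then show ?thesis by (intro integrableI_bounded) auto
qed

lemma integrable_lborel_shift:
  fixes f :: "'a::euclidean_space \<Rightarrow> real"
  shows "integrable lborel f \<Longrightarrow> integrable lborel (\<lambda>x. f (x + c))"
  using integrable_lborel_affine[of f 1 c] by (simp add: add.commute)

lemma L1_norm_shift:
  fixes f :: "'a::euclidean_space \<Rightarrow> real"
  shows "f \<in> borel_measurable borel \<Longrightarrow> L1_norm (\<lambda>x. f (x + c)) = L1_norm f"
  using nn_integral_lborel_affine[of "\<lambda>x. ennreal \<bar>f x\<bar>" 1 c]
  by (simp add: L1_norm_lborel add.commute)

section \<open>The modulus of continuity in L1\<close>

definition translation_modulus :: "('a::euclidean_space \<Rightarrow> real) \<Rightarrow> 'a \<Rightarrow> real" where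
  "translation_modulus f z = (\<integral>x. \<bar>f (x + z) - f x\<bar> \<partial>lborel)"

definition mean_continuous :: "('a::euclidean_space \<Rightarrow> real) \<Rightarrow> bool" where
  "mean_continuous f \<longleftrightarrow> integrable lborel f \<and> (translation_modulus f \<longlongrightarrow> 0) (at 0)"

lemma translation_modulus_nonneg: "0 \<le> translation_modulus f z"
  by (simp add: translation_modulus_def)

lemma translation_modulus_add:
  assumes f: "integrable lborel f" and g: "integrable lborel g"
  shows "translation_modulus (\<lambda>x. f x + g x) z \<le> translation_modulus f z + translation_modulus g z"
proof -
  note [simp] = f g integrable_lborel_shift[OF f, of z] integrable_lborel_shift[OF g, of z]
  have "translation_modulus (\<lambda>x. f x + g x) z \<le>
      (\<integral>x. \<bar>f (x + z) - f x\<bar> + \<bar>g (x + z) - g x\<bar> \<partial>lborel)"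
    unfolding translation_modulus_def by (rule integral_mono) auto
  also have "\<dots> = translation_modulus f z + translation_modulus g z"
    unfolding translation_modulus_def by (rule Bochner_Integration.integral_add) auto
  finally show ?thesis .
qed

lemma translation_modulus_le:
  assumes f: "integrable lborel f"
  shows "translation_modulus f z \<le> 2 * (\<integral>x. \<bar>f x\<bar> \<partial>lborel)"
proof -
  have [measurable]: "f \<in> borel_measurable borel" using f by auto
  note [simp] = f integrable_lborel_shift[OF f, of z]
  have "translation_modulus f z \<le> (\<integral>x. \<bar>f (x + z)\<bar> + \<bar>f x\<bar> \<partial>lborel)"
    unfolding translation_modulus_def by (rule integral_mono) auto
  also have "\<dots> = (\<integral>x. \<bar>f (x + z)\<bar> \<partial>lborel) + (\<integral>x. \<bar>f x\<bar> \<partial>lborel)"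
    by (rule Bochner_Integration.integral_add) auto
  also have "(\<integral>x. \<bar>f (x + z)\<bar> \<partial>lborel) = (\<integral>x. \<bar>f x\<bar> \<partial>lborel)"
    by (rule lborel_integral_shift) measurable
  finally show ?thesis by simp
qed

lemma mean_continuous_add:
  assumes "mean_continuous f" "mean_continuous g"
  shows "mean_continuous (\<lambda>x. f x + g x)"
proof -
  have i: "integrable lborel f" "integrable lborel g" using assms by (auto simp: mean_continuous_def)
  have "((\<lambda>z. translation_modulus f z + translation_modulus g z) \<longlongrightarrow> 0 + 0) (at 0)"
    using assms by (intro tendsto_add) (auto simp: mean_continuous_def)
  then have lim: "((\<lambda>z. translation_modulus f z + translation_modulus g z) \<longlongrightarrow> 0) (at 0)" by simp
  have "(translation_modulus (\<lambda>x. f x + g x) \<longlongrightarrow> 0) (at 0)"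
    by (rule tendsto_sandwich[OF _ _ tendsto_const[of 0] lim])
      (simp_all add: translation_modulus_nonneg translation_modulus_add[OF i])
  then show ?thesis using i by (simp add: mean_continuous_def)
qed

lemma mean_continuous_cmult: "mean_continuous f \<Longrightarrow> mean_continuous (\<lambda>x. c * f x)"
proof -
  assume f: "mean_continuous f"
  have "translation_modulus (\<lambda>x. c * f x) z = \<bar>c\<bar> * translation_modulus f z" for z
    by (simp add: translation_modulus_def right_diff_distrib[symmetric] abs_mult)
  then have "translation_modulus (\<lambda>x. c * f x) = (\<lambda>z. \<bar>c\<bar> * translation_modulus f z)" by auto
  moreover have "((\<lambda>z. \<bar>c\<bar> * translation_modulus f z) \<longlongrightarrow> 0) (at 0)"
    using f by (intro tendsto_mult_right_zero) (simp add: mean_continuous_def)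
  ultimately show ?thesis using f by (simp add: mean_continuous_def)
qed

text \<open>The modulus of f is at most the modulus of g plus twice the L1 distance of f and g; both
  quantities are made smaller than e/3.\<close>

lemma mean_continuous_approx:
  assumes f: "integrable lborel f"
    and approx: "\<And>e. e > 0 \<Longrightarrow> \<exists>g. mean_continuous g \<and> (\<integral>x. \<bar>f x - g x\<bar> \<partial>lborel) < e"
  shows "mean_continuous f"
proof -
  have small: "\<forall>\<^sub>F z in at 0. translation_modulus f z < e" if "e > 0" for e
  proof -
    have "e/3 > 0" using that by simp
    from approx[OF this] obtain g where g: "mean_continuous g" "(\<integral>x. \<bar>f x - g x\<bar> \<partial>lborel) < e/3"
      by blast
    have gi: "integrable lborel g" using g by (simp add: mean_continuous_def)
    have d: "integrable lborel (\<lambda>x. f x - g x)" using f gi by auto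
    have "\<forall>\<^sub>F z in at 0. translation_modulus g z < e/3"
      using g(1) \<open>e/3 > 0\<close> unfolding mean_continuous_def by (blast intro: order_tendstoD)
    then show ?thesis
    proof eventually_elim
      case (elim z)
      have "translation_modulus f z = translation_modulus (\<lambda>x. (f x - g x) + g x) z" by simp
      also have "\<dots> \<le> translation_modulus (\<lambda>x. f x - g x) z + translation_modulus g z"
        by (rule translation_modulus_add[OF d gi])
      also have "\<dots> < e" using translation_modulus_le[OF d, of z] g(2) elim by linarith
      finally show ?case .
    qed
  qed
  have "(translation_modulus f \<longlongrightarrow> 0) (at 0)"
  proof (rule order_tendstoI)
    fix c :: real assume "c < 0"
    then show "\<forall>\<^sub>F z in at 0. c < translation_modulus f z"
      by (intro always_eventually allI less_le_trans[OF _ translation_modulus_nonneg])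
  qed (rule small)
  then show ?thesis using f by (simp add: mean_continuous_def)
qed

text \<open>The modulus is twice the measure of U minus twice the measure of the overlap of U with
  its translate. Openness makes the overlap integrand converge pointwise to the indicator of U,
  which also dominates it.\<close>

lemma mean_continuous_indicator_open:
  fixes U :: "'a::euclidean_space set"
  assumes U: "open U" "emeasure lborel U < \<infinity>"
  shows "mean_continuous (indicator U)"
proof -
  let ?f = "indicator U :: 'a \<Rightarrow> real"
  have [measurable]: "U \<in> sets borel" using U by auto
  have i: "integrable lborel ?f" using U by (intro integrable_real_indicator) auto
  have ip: "integrable lborel (\<lambda>x. ?f x * ?f (x + z))" for z
    by (rule Bochner_Integration.integrable_bound[OF i]) (auto simp: indicator_def)
  have eq: "translation_modulus ?f z = 2 * (\<integral>x. ?f x \<partial>lborel) - 2 * (\<integral>x. ?f x * ?f (x + z) \<partial>lborel)" for z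
  proof -
    have "translation_modulus ?f z = (\<integral>x. ?f (x + z) + ?f x - 2 * (?f x * ?f (x + z)) \<partial>lborel)"
      unfolding translation_modulus_def
      by (rule Bochner_Integration.integral_cong) (auto simp: indicator_def)
    also have "\<dots> = (\<integral>x. ?f (x + z) \<partial>lborel) + (\<integral>x. ?f x \<partial>lborel) - 2 * (\<integral>x. ?f x * ?f (x + z) \<partial>lborel)"
      using integrable_lborel_shift[OF i, of z] i ip by simp
    finally show ?thesis by (simp add: lborel_integral_shift)
  qed
  have "((\<lambda>z. \<integral>x. ?f x * ?f (x + z) \<partial>lborel) \<longlongrightarrow> (\<integral>x. ?f x \<partial>lborel)) (at 0)"
    unfolding tendsto_at_iff_sequentially comp_def
  proof (intro allI impI)
    fix X :: "nat \<Rightarrow> 'a" assume "X \<longlonglongrightarrow> 0"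
    show "(\<lambda>n. \<integral>x. ?f x * ?f (x + X n) \<partial>lborel) \<longlonglongrightarrow> (\<integral>x. ?f x \<partial>lborel)"
    proof (rule integral_dominated_convergence[OF _ _ i])
      show "AE x in lborel. (\<lambda>n. ?f x * ?f (x + X n)) \<longlonglongrightarrow> ?f x"
      proof (rule AE_I2)
        fix x
        show "(\<lambda>n. ?f x * ?f (x + X n)) \<longlonglongrightarrow> ?f x"
        proof (cases "x \<in> U")
          case True
          have "(\<lambda>n. x + X n) \<longlonglongrightarrow> x + 0" by (intro tendsto_intros \<open>X \<longlonglongrightarrow> 0\<close>)
          then have "\<forall>\<^sub>F n in sequentially. x + X n \<in> U"
            using U(1) True by (auto dest: topological_tendstoD)
          then have "\<forall>\<^sub>F n in sequentially. ?f x * ?f (x + X n) = ?f x"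
            by eventually_elim (use True in auto)
          then show ?thesis by (rule tendsto_eventually)
        qed auto
      qed
    qed (auto simp: indicator_def)
  qed
  then have "((\<lambda>z. 2 * (\<integral>x. ?f x \<partial>lborel) - 2 * (\<integral>x. ?f x * ?f (x + z) \<partial>lborel)) \<longlongrightarrow>
      2 * (\<integral>x. ?f x \<partial>lborel) - 2 * (\<integral>x. ?f x \<partial>lborel)) (at 0)"
    by (intro tendsto_intros)
  then have "(translation_modulus ?f \<longlongrightarrow> 0) (at 0)"
    unfolding eq[symmetric] by simp
  then show ?thesis using i by (simp add: mean_continuous_def)
qed

text \<open>Outer regularity supplies an open superset with excess measure below e. Its measure is
  finite again, so the open case applies to it.\<close>

lemma mean_continuous_indicator:
  fixes A :: "'a::euclidean_space set"
  assumes A: "A \<in> sets borel" "emeasure lborel A < \<infinity>"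
  shows "mean_continuous (indicator A)"
proof (rule mean_continuous_approx)
  show "integrable lborel (indicator A :: 'a \<Rightarrow> real)"
    using A by (intro integrable_real_indicator) auto
  fix e :: real assume e: "e > 0"
  obtain U where U: "open U" "A \<subseteq> U" "emeasure lborel (U - A) < e"
    using outer_regular_lborel[OF A(1) e] by blast
  have UA: "U - A \<in> sets borel" using U A by auto
  have "emeasure lborel U = emeasure lborel (U - A) + emeasure lborel A"
    using U A by (subst plus_emeasure) (auto simp: Un_absorb2)
  also have "\<dots> < \<infinity>" using U(3) A(2) less_trans[OF U(3), of \<infinity>] by (auto simp: ennreal_add_less_top)
  finally have "mean_continuous (indicator U)" using U(1) by (intro mean_continuous_indicator_open)
  moreover have "(\<integral>x. \<bar>indicator A x - indicator U x\<bar> \<partial>lborel) < e"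
  proof -
    have "(\<lambda>x. \<bar>indicator A x - indicator U x\<bar>) = (indicator (U - A) :: 'a \<Rightarrow> real)"
      using U(2) by (auto simp: indicator_def fun_eq_iff)
    then have "(\<integral>x. \<bar>indicator A x - indicator U x\<bar> \<partial>lborel) = measure lborel (U - A)"
      using UA by simp
    also have "\<dots> < e"
      using U(3) e less_trans[OF U(3), of top] by (simp add: measure_def enn2real_less_iff)
    finally show ?thesis .
  qed
  ultimately show "\<exists>g. mean_continuous g \<and> (\<integral>x. \<bar>indicator A x - g x\<bar> \<partial>lborel) < e" by blast
qed

lemma integrable_imp_mean_continuous:
  fixes f :: "'a::euclidean_space \<Rightarrow> real"
  assumes "integrable lborel f"
  shows "mean_continuous f"
  using assms
proof (induction rule: integrable_induct)
  case (base A c)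
  then show ?case
    using mean_continuous_cmult[OF mean_continuous_indicator[of A], of c] by (simp add: mult.commute)
next
  case (add f g)
  then show ?case by (intro mean_continuous_add)
next
  case (lim f s)
  show ?case
  proof (rule mean_continuous_approx[OF lim.hyps(4)])
    fix e :: real assume "e > 0"
    have [measurable]: "f \<in> borel_measurable lborel" "s n \<in> borel_measurable lborel" for n
      using lim.hyps(1,4) by auto
    have "(\<lambda>n. \<integral>x. \<bar>f x - s n x\<bar> \<partial>lborel) \<longlonglongrightarrow> integral\<^sup>L lborel (\<lambda>x::'a. 0)"
    \<comment> \<open>The approximants satisfy |s n| <= 2 |f|, whence the majorant 3 |f|.\<close>
    proof (rule integral_dominated_convergence[where w="\<lambda>x. 3 * \<bar>f x\<bar>" and f="\<lambda>_. 0" and M=lborel and s="\<lambda>n x. \<bar>f x - s n x\<bar>"])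
      show "integrable lborel (\<lambda>x. 3 * \<bar>f x\<bar>)" using lim.hyps(4) by auto
      show "AE x in lborel. (\<lambda>n. \<bar>f x - s n x\<bar>) \<longlonglongrightarrow> 0"
      proof (rule AE_I2)
        fix x
        have "(\<lambda>n. \<bar>f x - s n x\<bar>) \<longlonglongrightarrow> \<bar>f x - f x\<bar>"
          using lim.hyps(2)[of x] by (intro tendsto_intros) auto
        then show "(\<lambda>n. \<bar>f x - s n x\<bar>) \<longlonglongrightarrow> 0" by simp
      qed
      show "AE x in lborel. norm \<bar>f x - s n x\<bar> \<le> 3 * \<bar>f x\<bar>" for n
      proof (rule AE_I2)
        fix x
        have "\<bar>s n x\<bar> \<le> 2 * \<bar>f x\<bar>" using lim.hyps(3)[of x n] by simp
        then show "norm \<bar>f x - s n x\<bar> \<le> 3 * \<bar>f x\<bar>" by simp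
      qed
    qed auto
    then have "\<forall>\<^sub>F n in sequentially. (\<integral>x. \<bar>f x - s n x\<bar> \<partial>lborel) < e"
      using \<open>e > 0\<close> by (auto intro: order_tendstoD)
    then obtain n where "(\<integral>x. \<bar>f x - s n x\<bar> \<partial>lborel) < e"
      by (auto simp: eventually_sequentially)
    then show "\<exists>g. mean_continuous g \<and> (\<integral>x. \<bar>f x - g x\<bar> \<partial>lborel) < e" using lim.IH by blast
  qed
qed

lemma translation_modulus_small:
  fixes f :: "'a::euclidean_space \<Rightarrow> real"
  assumes "integrable lborel f" "e > 0"
  obtains \<delta> where "\<delta> > 0" "\<And>z. norm z < \<delta> \<Longrightarrow> translation_modulus f z < e"
proof -
  have "\<forall>\<^sub>F z in at 0. translation_modulus f z < e"
    using integrable_imp_mean_continuous[OF assms(1)] assms(2)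
    by (auto simp: mean_continuous_def intro: order_tendstoD)
  then obtain \<delta> where d: "\<delta> > 0" "\<And>z. z \<noteq> 0 \<Longrightarrow> norm z < \<delta> \<Longrightarrow> translation_modulus f z < e"
    by (auto simp: eventually_at)
  moreover have "translation_modulus f 0 < e" using assms by (simp add: translation_modulus_def)
  ultimately show thesis using that[of \<delta>] by metis
qed

section \<open>Mollification\<close>

lemma deriv_family_cmult:
  assumes "deriv_family D" shows "deriv_family (\<lambda>\<alpha> x. c * D \<alpha> x)"
  unfolding deriv_family_def
proof (intro allI)
  fix \<alpha> x
  show "((\<lambda>x. c * D \<alpha> x) has_derivative (\<lambda>h. \<Sum>b\<in>Basis. (h \<bullet> b) * (c * D (add_mset b \<alpha>) x))) (at x)"
    using has_derivative_mult_right[OF deriv_familyD[OF assms], of c \<alpha> x]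
    by (simp add: sum_distrib_left mult_ac)
qed

section \<open>The normalised mollifier and its derivatives\<close>

abbreviation bump_box :: "'a::euclidean_space set" where
  "bump_box \<equiv> cbox ((1/2) *\<^sub>R One) One"

abbreviation bump_family :: "'a::euclidean_space multiset \<Rightarrow> 'a \<Rightarrow> real" where
  "bump_family \<equiv> product_family (\<lambda>_. bump)"

definition mollifier_family :: "'a::euclidean_space multiset \<Rightarrow> 'a \<Rightarrow> real" where
  "mollifier_family \<alpha> z = bump_family \<alpha> z / (\<integral>z. bump_family {#} (z :: 'a) \<partial>lborel)"

abbreviation mollifier :: "'a::euclidean_space \<Rightarrow> real" where
  "mollifier \<equiv> mollifier_family {#}"

lemma bump_family_eq_0:
  fixes z :: "'a::euclidean_space"
  assumes "z \<notin> bump_box" shows "bump_family \<alpha> z = 0"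
proof -
  obtain b where "b \<in> Basis" "z \<bullet> b \<notin> {1/2..1}"
    using assms by (auto simp: mem_box inner_add_left)
  from higher_deriv_bump_eq_0[OF this(2)] this(1) show ?thesis
    unfolding product_family_def by (intro prod_zero bexI[of _ b]) auto
qed

lemma deriv_family_bump: "deriv_family bump_family"
  by (rule deriv_family_product) (rule smooth_bump)

lemma bump_family_nonneg: "0 \<le> bump_family {#} z"
  by (simp add: product_family_def prod_nonneg bump_nonneg)

text \<open>A vanishing integral would force this nonnegative function to vanish almost everywhere,
  whereas it is positive on an open box of measure 2^(-n).\<close>

lemma integral_bump_family_pos: "0 < (\<integral>z. bump_family {#} (z :: 'a::euclidean_space) \<partial>lborel)"
proof -
  let ?I = "\<integral>z. bump_family {#} (z :: 'a) \<partial>lborel"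
  have i: "integrable lborel (bump_family {#} :: 'a \<Rightarrow> real)"
    by (rule integrable_continuous_compact_support[OF deriv_family_continuous[OF deriv_family_bump]
          compact_cbox bump_family_eq_0])
  have "?I \<noteq> 0"
  proof
    assume "?I = 0"
    then have "AE z :: 'a in lborel. bump_family {#} z = 0"
      using i by (subst (asm) integral_nonneg_eq_0_iff_AE) (auto simp: bump_family_nonneg)
    moreover have "bump_family {#} z \<noteq> 0" if "z \<in> box ((1/2) *\<^sub>R One) One" for z :: 'a
    proof -
      have "0 < bump_family {#} z"
        unfolding product_family_def using that by (intro prod_pos) (auto simp: bump_pos_iff mem_box)
      then show ?thesis by simp
    qed
    ultimately have "AE z :: 'a in lborel. z \<notin> box ((1/2) *\<^sub>R One) One"
      by (auto elim: eventually_mono)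
    then have "emeasure lborel (box ((1/2) *\<^sub>R One) One :: 'a set) = 0"
      by (subst (asm) AE_iff_measurable[OF _ refl]) auto
    moreover have "emeasure lborel (box ((1/2) *\<^sub>R One) One :: 'a set) = ennreal ((1/2) ^ DIM('a))"
      by (simp add: emeasure_lborel_box_eq inner_diff_left)
    ultimately show False by simp
  qed
  moreover have "0 \<le> ?I" by (rule integral_nonneg_AE) (simp add: bump_family_nonneg)
  ultimately show ?thesis by simp
qed

lemma deriv_family_mollifier: "deriv_family (mollifier_family :: 'a::euclidean_space multiset \<Rightarrow> _)"
  using deriv_family_cmult[OF deriv_family_bump, of "1 / (\<integral>z. bump_family {#} (z :: 'a) \<partial>lborel)"]
  by (simp add: mollifier_family_def[abs_def])

lemma mollifier_family_eq_0: "z \<notin> bump_box \<Longrightarrow> mollifier_family \<alpha> z = 0"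
  by (simp add: mollifier_family_def bump_family_eq_0)

lemma mollifier_family_measurable [measurable]:
  "mollifier_family \<alpha> \<in> borel_measurable (borel :: 'a::euclidean_space measure)"
  by (rule borel_measurable_continuous_onI[OF deriv_family_continuous[OF deriv_family_mollifier]])

lemma mollifier_family_bounded:
  obtains M where "M \<ge> 0" "\<And>z :: 'a::euclidean_space. \<bar>mollifier_family \<alpha> z\<bar> \<le> M"
  using bounded_continuous_compact_support[OF deriv_family_continuous[OF deriv_family_mollifier]
      compact_cbox mollifier_family_eq_0] by metis

lemma mollifier_nonneg: "0 \<le> mollifier z"
  by (simp add: mollifier_family_def bump_family_nonneg integral_bump_family_pos[THEN less_imp_le])

lemma mollifier_nonzero:
  assumes "mollifier z \<noteq> 0" "b \<in> Basis" shows "1/2 < z \<bullet> b" "z \<bullet> b < 1"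
proof -
  have "bump (z \<bullet> b) \<noteq> 0"
    using assms by (auto simp: mollifier_family_def product_family_def)
  then show "1/2 < z \<bullet> b" "z \<bullet> b < 1" using bump_eq_0[of "z \<bullet> b"] by linarith+
qed

lemma mollifier_nonzero_norm_less:
  fixes z :: "'a::euclidean_space"
  assumes "mollifier z \<noteq> 0" shows "norm z \<le> DIM('a)"
proof -
  have "norm z \<le> (\<Sum>b\<in>Basis. \<bar>z \<bullet> b\<bar>)" by (rule norm_le_l1)
  also have "\<dots> \<le> (\<Sum>b\<in>(Basis :: 'a set). 1)"
    using mollifier_nonzero[OF assms] by (intro sum_mono) (force simp: abs_le_iff)
  finally show ?thesis by simp
qed

lemma integrable_mollifier: "integrable lborel (mollifier_family \<alpha> :: 'a::euclidean_space \<Rightarrow> real)"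
  by (rule integrable_continuous_compact_support[OF deriv_family_continuous[OF deriv_family_mollifier]
        compact_cbox mollifier_family_eq_0])

lemma integral_mollifier: "(\<integral>y. mollifier (y :: 'a::euclidean_space) \<partial>lborel) = 1"
  using integral_bump_family_pos[where 'a='a] by (simp add: mollifier_family_def)

lemma nn_integral_mollifier: "(\<integral>\<^sup>+y. ennreal (mollifier (y :: 'a::euclidean_space)) \<partial>lborel) = 1"
  by (subst nn_integral_eq_integral[OF integrable_mollifier])
    (auto simp: mollifier_nonneg integral_mollifier)

text \<open>The Bochner integral is 0 by convention when the function is not integrable, which
  settles that case. Norm estimates for averages can thus precede their integrability.\<close>

lemma ennreal_abs_integral_le:
  fixes f :: "'b \<Rightarrow> real"
  shows "ennreal \<bar>\<integral>x. f x \<partial>M\<bar> \<le> (\<integral>\<^sup>+x. ennreal \<bar>f x\<bar> \<partial>M)"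
proof (cases "integrable M f")
  case True
  then show ?thesis using integral_norm_bound_ennreal[OF True] by simp
qed (simp add: not_integrable_integral_eq)

text \<open>Minkowski's integral inequality for the density \<open>mollifier\<close>: the absolute
  value is taken inside and Tonelli is applied.\<close>

lemma L1_norm_average_le:
  fixes G :: "'a::euclidean_space \<Rightarrow> 'a \<Rightarrow> real"
  assumes [measurable]: "(\<lambda>(y, x). G y x) \<in> borel_measurable (lborel \<Otimes>\<^sub>M lborel)"
  shows "L1_norm (\<lambda>x. \<integral>y. mollifier y * G y x \<partial>lborel)
    \<le> (\<integral>\<^sup>+y. ennreal (mollifier y) * L1_norm (G y) \<partial>lborel)"
proof -
  have "L1_norm (\<lambda>x. \<integral>y. mollifier y * G y x \<partial>lborel)
      \<le> (\<integral>\<^sup>+x. \<integral>\<^sup>+y. ennreal \<bar>mollifier y * G y x\<bar> \<partial>lborel \<partial>lborel)"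
    unfolding L1_norm_lborel by (intro nn_integral_mono ennreal_abs_integral_le)
  also have "\<dots> = (\<integral>\<^sup>+y. \<integral>\<^sup>+x. ennreal \<bar>mollifier y * G y x\<bar> \<partial>lborel \<partial>lborel)"
    by (rule lborel_pair.Fubini') measurable
  also have "\<dots> = (\<integral>\<^sup>+y. ennreal (mollifier y) * L1_norm (G y) \<partial>lborel)"
    by (simp add: L1_norm_lborel abs_mult ennreal_mult mollifier_nonneg nn_integral_cmult)
  finally show ?thesis .
qed

text \<open>The plus sign suits forward differences: averaging f (x + j h) over h = r y gives
  \<open>smear (j * r) f\<close>. In terms of convolution, the kernel is the reflected mollifier at
  scale r.\<close>

definition smear :: "real \<Rightarrow> ('a::euclidean_space \<Rightarrow> real) \<Rightarrow> 'a \<Rightarrow> real" where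
  "smear r f x = (\<integral>y. mollifier y * f (x + r *\<^sub>R y) \<partial>lborel)"

lemma smear_measurable [measurable]:
  assumes [measurable]: "f \<in> borel_measurable borel"
  shows "smear r f \<in> borel_measurable borel"
  unfolding smear_def[abs_def] by measurable

lemma L1_norm_smear_le:
  fixes f :: "'a::euclidean_space \<Rightarrow> real"
  assumes [measurable]: "f \<in> borel_measurable borel"
  shows "L1_norm (smear r f) \<le> L1_norm f"
proof -
  have "L1_norm (smear r f) \<le> (\<integral>\<^sup>+y. ennreal (mollifier (y :: 'a)) * L1_norm (\<lambda>x. f (x + r *\<^sub>R y)) \<partial>lborel)"
    unfolding smear_def[abs_def] by (rule L1_norm_average_le) measurable
  also have "\<dots> = L1_norm f"
    by (simp add: L1_norm_shift nn_integral_multc nn_integral_mollifier)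
  finally show ?thesis .
qed

lemma integrable_smear:
  fixes f :: "'a::euclidean_space \<Rightarrow> real"
  shows "integrable lborel f \<Longrightarrow> integrable lborel (smear r f)"
  using le_less_trans[OF L1_norm_smear_le[of f r]] smear_measurable[of f r]
  by (simp add: integrable_lborel_iff_L1_norm)

lemma integrable_smear_integrand:
  fixes f :: "'a::euclidean_space \<Rightarrow> real"
  assumes f: "integrable lborel f" and "r \<noteq> 0"
  shows "integrable lborel (\<lambda>y. mollifier y * f (x + r *\<^sub>R y))"
proof -
  obtain M where M: "M \<ge> 0" "\<And>z :: 'a. \<bar>mollifier z\<bar> \<le> M" using mollifier_family_bounded by blast
  have [measurable]: "f \<in> borel_measurable borel" using f by auto
  show ?thesis
  proof (rule Bochner_Integration.integrable_bound)
    show "integrable lborel (\<lambda>y. M * f (x + r *\<^sub>R y))"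
      using integrable_lborel_affine[OF f \<open>r \<noteq> 0\<close>] by simp
    show "AE y in lborel. norm (mollifier y * f (x + r *\<^sub>R y)) \<le> norm (M * f (x + r *\<^sub>R y))"
      using M by (intro AE_I2) (simp add: abs_mult mult_right_mono)
  qed measurable
qed

lemma smear_diff:
  fixes f :: "'a::euclidean_space \<Rightarrow> real"
  assumes "integrable lborel f" "integrable lborel g" "r \<noteq> 0"
  shows "smear r (\<lambda>x. f x - g x) x = smear r f x - smear r g x"
  using integrable_smear_integrand[OF assms(1,3)] integrable_smear_integrand[OF assms(2,3)]
  by (simp add: smear_def right_diff_distrib)

text \<open>The error is a \<open>mollifier\<close> average of f (x + r y) - f x. On the support of
  the mollifier |y| <= n, so the shift r y is shorter than \<delta> once r < \<delta> / n.\<close>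

lemma smear_error_small:
  fixes f :: "'a::euclidean_space \<Rightarrow> real"
  assumes f: "integrable lborel f" and "e > 0"
  obtains \<delta> where "\<delta> > 0" "\<And>r. 0 < r \<Longrightarrow> r < \<delta> \<Longrightarrow> L1_norm (\<lambda>x. smear r f x - f x) \<le> ennreal e"
proof -
  have [measurable]: "f \<in> borel_measurable borel" using f by auto
  obtain \<delta> where \<delta>: "\<delta> > 0" "\<And>z. norm z < \<delta> \<Longrightarrow> translation_modulus f z < e"
    using translation_modulus_small[OF assms] by blast
  have "L1_norm (\<lambda>x. smear r f x - f x) \<le> ennreal e" if r: "0 < r" "r < \<delta> / DIM('a)" for r
  proof -
    have eq: "smear r f x - f x = (\<integral>y. mollifier y * (f (x + r *\<^sub>R y) - f x) \<partial>lborel)" for x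
    proof -
      have "f x = (\<integral>y. mollifier (y :: 'a) * f x \<partial>lborel)" by (simp add: integral_mollifier)
      then show ?thesis
        using integrable_smear_integrand[OF f, of r x] r integrable_mollifier[of "{#} :: 'a multiset"]
        by (simp add: smear_def right_diff_distrib)
    qed
    have "L1_norm (\<lambda>x. smear r f x - f x) \<le>
        (\<integral>\<^sup>+y. ennreal (mollifier (y :: 'a)) * L1_norm (\<lambda>x. f (x + r *\<^sub>R y) - f x) \<partial>lborel)"
      unfolding eq by (rule L1_norm_average_le) measurable
    also have "\<dots> \<le> (\<integral>\<^sup>+y. ennreal (mollifier (y :: 'a)) * ennreal e \<partial>lborel)"
    proof (rule nn_integral_mono)
      fix y :: 'a
      show "ennreal (mollifier y) * L1_norm (\<lambda>x. f (x + r *\<^sub>R y) - f x) \<le> ennreal (mollifier y) * ennreal e"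
      proof (cases "mollifier y = 0")
        case False
        have "norm (r *\<^sub>R y) \<le> r * DIM('a)"
          using mollifier_nonzero_norm_less[OF False] r by (simp add: mult_left_mono)
        also have "\<dots> < \<delta>" using r by (simp add: field_simps)
        finally have "translation_modulus f (r *\<^sub>R y) < e" by (rule \<delta>)
        moreover have "L1_norm (\<lambda>x. f (x + r *\<^sub>R y) - f x) = ennreal (translation_modulus f (r *\<^sub>R y))"
          unfolding translation_modulus_def
          by (rule L1_norm_eq_integral) (use f integrable_lborel_shift[OF f] in auto)
        ultimately show ?thesis by (intro mult_left_mono) (auto intro: ennreal_leI)
      qed simp
    qed
    also have "\<dots> = ennreal e" by (simp add: nn_integral_multc nn_integral_mollifier)
    finally show ?thesis .
  qed
  then show thesis using that[of "\<delta> / DIM('a)"] \<delta> by simp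
qed

text \<open>With the argument of \<open>f\<close> as integration variable, the kernel can serve as a
  test function in y, and all dependence on x sits in a smooth factor.\<close>

lemma smear_eq_kernel:
  fixes f :: "'a::euclidean_space \<Rightarrow> real"
  assumes [measurable]: "f \<in> borel_measurable borel" and "r > 0"
  shows "smear r f x = (\<integral>y. (1 / r) ^ DIM('a) * mollifier ((y - x) /\<^sub>R r) * f y \<partial>lborel)"
proof -
  have "(\<integral>y. (1 / r) ^ DIM('a) * mollifier ((y - x) /\<^sub>R r) * f y \<partial>lborel)
      = r ^ DIM('a) * (\<integral>y. (1 / r) ^ DIM('a) * mollifier ((x + r *\<^sub>R y - x) /\<^sub>R r) * f (x + r *\<^sub>R y) \<partial>lborel)"
    using \<open>r > 0\<close> by (subst integral_lborel_affine[where c=r and t=x]) auto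
  also have "\<dots> = r ^ DIM('a) * ((1 / r) ^ DIM('a) * smear r f x)"
    using \<open>r > 0\<close> by (simp add: smear_def mult.assoc)
  also have "\<dots> = smear r f x" using \<open>r > 0\<close> by (simp add: power_one_over)
  finally show ?thesis by simp
qed

section \<open>Uniqueness of weak derivatives\<close>

lemma mollifier_kernel_test_function:
  fixes x :: "'a::euclidean_space"
  assumes "r > 0" "(\<lambda>z. x + r *\<^sub>R z) ` bump_box \<subseteq> \<Omega>"
  shows "(\<lambda>y. (1 / r) ^ DIM('a) * mollifier ((y - x) /\<^sub>R r)) \<in> test_functions \<Omega>"
proof (rule test_functionI)
  \<comment> \<open>\<open>deriv_family_scale\<close> differentiates in the subtracted variable;
    with centre x and scale -r the quotient (x - y) / (-r) is the required (y - x) / r.\<close>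
  have "deriv_family (\<lambda>\<alpha> y. (1 / r) ^ DIM('a) * (- 1 / - r) ^ size \<alpha> * mollifier_family \<alpha> ((x - y) /\<^sub>R (- r)))"
    by (rule deriv_family_scale[OF deriv_family_mollifier])
  from deriv_family_smooth[OF this, of "{#}"]
  have "smooth (\<lambda>y. (1 / r) ^ DIM('a) * mollifier ((x - y) /\<^sub>R (- r)))" by simp
  moreover have "(x - y) /\<^sub>R (- r) = (y - x) /\<^sub>R r" for y by (simp add: algebra_simps)
  ultimately show "smooth (\<lambda>y. (1 / r) ^ DIM('a) * mollifier ((y - x) /\<^sub>R r))" by simp
  show "compact ((\<lambda>z. x + r *\<^sub>R z) ` bump_box)"
    by (intro compact_continuous_image continuous_intros) auto
  fix y assume y: "y \<notin> (\<lambda>z. x + r *\<^sub>R z) ` bump_box"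
  have "(y - x) /\<^sub>R r \<notin> bump_box"
  proof
    assume "(y - x) /\<^sub>R r \<in> bump_box"
    moreover have "y = x + r *\<^sub>R ((y - x) /\<^sub>R r)" using \<open>r > 0\<close> by simp
    ultimately show False using y by blast
  qed
  then show "(1 / r) ^ DIM('a) * mollifier ((y - x) /\<^sub>R r) = 0"
    by (simp add: mollifier_family_eq_0)
qed (use assms in auto)

lemma bump_box_norm_le:
  fixes z :: "'a::euclidean_space"
  assumes "z \<in> bump_box" shows "norm z \<le> DIM('a)"
proof -
  have "norm z \<le> (\<Sum>b\<in>Basis. \<bar>z \<bullet> b\<bar>)" by (rule norm_le_l1)
  also have "\<dots> \<le> (\<Sum>b\<in>(Basis :: 'a set). 1)"
    using assms by (intro sum_mono) (force simp: mem_box abs_le_iff)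
  finally show ?thesis by simp
qed

lemma borel_version:
  fixes f :: "'a::euclidean_space \<Rightarrow> real"
  assumes "f \<in> borel_measurable lebesgue"
  obtains f' where "f' \<in> borel_measurable borel" "AE x in lebesgue. f x = f' x"
proof -
  obtain f' where "f' \<in> borel_measurable lborel" "AE x in lborel. f x = f' x"
    using completion_ex_borel_measurable_real[OF assms] by blast
  then show thesis using that[of f'] AE_completion[of "\<lambda>x. f x = f' x" lborel] by simp
qed

text \<open>Near a compact K the shifted kernels are admissible test functions, so small
  mollifications of the localised g vanish on K; since they converge to it in L1, g vanishes almost
  everywhere on K.\<close>

lemma fundamental_lemma:
  fixes g :: "'a::euclidean_space \<Rightarrow> real"
  assumes \<Omega>: "open \<Omega>" and g: "locally_integrable \<Omega> g"
    and 0: "\<And>\<psi>. \<psi> \<in> test_functions \<Omega> \<Longrightarrow> (LINT x:\<Omega>|lebesgue. g x * \<psi> x) = 0"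
  shows "AE x in lebesgue. x \<in> \<Omega> \<longrightarrow> g x = 0"
proof -
  have main: "AE x in lebesgue. x \<in> K \<longrightarrow> g x = 0" if K: "compact K" "K \<subseteq> \<Omega>" for K
  proof -
    obtain \<eta> where \<eta>: "\<eta> > 0" "(\<Union>x\<in>K. cball x \<eta>) \<subseteq> \<Omega>"
      using compact_subset_open_imp_cball_epsilon_subset[OF K(1) \<Omega> K(2)] by blast
    \<comment> \<open>A compact neighbourhood of K inside \<Omega>. Kernels of small radius centred
      in K are supported in it, so g can be cut off to an integrable function.\<close>
    define K' where "K' = {x + z | x z. x \<in> K \<and> z \<in> cball 0 \<eta>}"
    have K': "compact K'" unfolding K'_def by (intro compact_sums K compact_cball)
    have mem_K': "y \<in> K'" if "x \<in> K" "dist x y \<le> \<eta>" for x y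
    proof -
      have "y = x + (y - x)" "y - x \<in> cball 0 \<eta>" using that(2) by (auto simp: dist_norm norm_minus_commute)
      then show ?thesis unfolding K'_def using that(1) by blast
    qed
    have K'\<Omega>: "K' \<subseteq> \<Omega>"
    proof
      fix y assume "y \<in> K'"
      then obtain x z where "x \<in> K" "norm z \<le> \<eta>" "y = x + z" by (auto simp: K'_def)
      then have "y \<in> cball x \<eta>" by (simp add: dist_norm)
      then show "y \<in> \<Omega>" using \<eta>(2) \<open>x \<in> K\<close> by blast
    qed
    have gi: "integrable lebesgue (\<lambda>x. indicator K' x *\<^sub>R g x)"
      using g K' K'\<Omega> by (auto simp: locally_integrable_def set_integrable_def)
    obtain g' where g'[measurable]: "g' \<in> borel_measurable borel"
      and gg': "AE x in lebesgue. indicator K' x *\<^sub>R g x = g' x"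
      using borel_version[OF borel_measurable_integrable[OF gi]] .
    have g'_leb: "g' \<in> borel_measurable lebesgue" by (simp add: measurable_completion)
    have "integrable lebesgue g'"
      using integrable_cong_AE_imp[OF gi g'_leb] gg' by (auto elim: eventually_mono)
    then have g'i: "integrable lborel g'" by (simp add: integrable_completion)
    have zero: "smear r g' x = 0" if "x \<in> K" "0 < r" "r < \<eta> / DIM('a)" for x r
    proof -
      define \<psi> where "\<psi> y = (1 / r) ^ DIM('a) * mollifier ((y - x) /\<^sub>R r)" for y
      have sub: "(\<lambda>z. x + r *\<^sub>R z) ` bump_box \<subseteq> K'"
      proof clarify
        fix z :: 'a assume "z \<in> bump_box"
        then have "norm (r *\<^sub>R z) \<le> r * DIM('a)"
          using bump_box_norm_le[of z] \<open>0 < r\<close> by (simp add: mult_left_mono)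
        also have "\<dots> \<le> \<eta>" using that by (simp add: field_simps)
        finally show "x + r *\<^sub>R z \<in> K'" by (intro mem_K'[OF \<open>x \<in> K\<close>]) (simp add: dist_norm)
      qed
      have \<psi>0: "\<psi> y = 0" if "y \<notin> K'" for y
      proof -
        have "(y - x) /\<^sub>R r \<notin> bump_box"
        proof
          assume "(y - x) /\<^sub>R r \<in> bump_box"
          moreover have "y = x + r *\<^sub>R ((y - x) /\<^sub>R r)" using \<open>r > 0\<close> by simp
          ultimately show False using that sub by blast
        qed
        then show ?thesis by (simp add: \<psi>_def mollifier_family_eq_0)
      qed
      have [measurable]: "\<psi> \<in> borel_measurable borel" unfolding \<psi>_def by measurable
      have "smear r g' x = (\<integral>y. g' y * \<psi> y \<partial>lborel)"
        using smear_eq_kernel[OF g' \<open>0 < r\<close>, of x] by (simp add: \<psi>_def mult_ac)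
      also have "\<dots> = (\<integral>y. g' y * \<psi> y \<partial>lebesgue)"
        by (rule integral_completion[symmetric]) simp
      also have "\<dots> = (\<integral>y. indicator \<Omega> y *\<^sub>R (g y * \<psi> y) \<partial>lebesgue)"
      proof (rule integral_cong_AE)
        have eq: "indicator \<Omega> y *\<^sub>R (g y * \<psi> y) = (indicator K' y *\<^sub>R g y) * \<psi> y" for y
          using \<psi>0[of y] K'\<Omega> by (cases "y \<in> K'") auto
        have \<psi>m: "\<psi> \<in> borel_measurable lebesgue" by (simp add: measurable_completion)
        then show "(\<lambda>y. indicator \<Omega> y *\<^sub>R (g y * \<psi> y)) \<in> borel_measurable lebesgue"
          unfolding eq by (rule borel_measurable_times[OF borel_measurable_integrable[OF gi]])
        show "(\<lambda>y. g' y * \<psi> y) \<in> borel_measurable lebesgue"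
          by (rule borel_measurable_times[OF g'_leb \<psi>m])
        show "AE y in lebesgue. g' y * \<psi> y = indicator \<Omega> y *\<^sub>R (g y * \<psi> y)"
          using gg' unfolding eq by eventually_elim simp
      qed
      also have "\<dots> = 0"
      proof -
        have "\<psi> \<in> test_functions \<Omega>"
          unfolding \<psi>_def using sub K'\<Omega> by (intro mollifier_kernel_test_function \<open>0 < r\<close>) auto
        from 0[OF this] show ?thesis by (simp add: set_lebesgue_integral_def)
      qed
      finally show ?thesis .
    qed
    \<comment> \<open>On K the mollified function vanishes, so there |g'| is the mollification error
      itself, which is arbitrarily small in L1.\<close>
    have small: "(\<integral>\<^sup>+x. indicator K x * ennreal \<bar>g' x\<bar> \<partial>lborel) \<le> 0 + ennreal e" if "e > 0" for e
    proof -
      obtain \<delta> where \<delta>: "\<delta> > 0" "\<And>r. 0 < r \<Longrightarrow> r < \<delta> \<Longrightarrow> L1_norm (\<lambda>x. smear r g' x - g' x) \<le> ennreal e"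
        using smear_error_small[OF g'i \<open>e > 0\<close>] by blast
      define r where "r = min \<delta> (\<eta> / DIM('a)) / 2"
      have r: "0 < r" "r < \<delta>" "r < \<eta> / DIM('a)" using \<delta> \<eta> by (auto simp: r_def min_def field_simps)
      have "(\<integral>\<^sup>+x. indicator K x * ennreal \<bar>g' x\<bar> \<partial>lborel) \<le> L1_norm (\<lambda>x. smear r g' x - g' x)"
        unfolding L1_norm_lborel
        by (intro nn_integral_mono) (auto simp: indicator_def zero[OF _ r(1,3)])
      also have "\<dots> \<le> ennreal e" by (rule \<delta>(2)[OF r(1,2)])
      finally show ?thesis by simp
    qed
    have "(\<integral>\<^sup>+x. indicator K x * ennreal \<bar>g' x\<bar> \<partial>lborel) \<le> 0"
      by (rule ennreal_le_epsilon) (rule small)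
    then have "(\<integral>\<^sup>+x. indicator K x * ennreal \<bar>g' x\<bar> \<partial>lborel) = 0" by simp
    moreover have [measurable]: "K \<in> sets borel" using K by (simp add: compact_imp_closed borel_closed)
    ultimately have "AE x in lborel. indicator K x * ennreal \<bar>g' x\<bar> = 0"
      by (subst (asm) nn_integral_0_iff_AE) measurable
    then have "AE x in lebesgue. indicator K x * ennreal \<bar>g' x\<bar> = 0" by (rule AE_completion)
    with gg' show ?thesis
    proof eventually_elim
      case (elim x)
      show ?case
      proof
        assume "x \<in> K"
        moreover have "x \<in> K'" using mem_K'[OF \<open>x \<in> K\<close>, of x] \<eta>(1) by simp
        ultimately show "g x = 0" using elim by simp
      qed
    qed
  qed
  \<comment> \<open>Countably many compact boxes exhaust \<Omega>, so the exceptional null sets have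
    a null union.\<close>
  obtain F where F: "countable F" "\<And>X. X \<in> F \<Longrightarrow> \<exists>a b. X = cbox a b" "\<And>X. X \<in> F \<Longrightarrow> X \<subseteq> \<Omega>" "\<Union>F = \<Omega>"
    using open_countable_Union_open_cbox[OF \<Omega>] by (metis PowD subsetD)
  have "AE x in lebesgue. \<forall>X\<in>F. x \<in> X \<longrightarrow> g x = 0"
    unfolding AE_ball_countable[OF F(1)] using F(2,3) main by (metis compact_cbox)
  then show ?thesis by eventually_elim (use F(4) in auto)
qed

lemma locally_integrable_mult_test:
  fixes g :: "'a::euclidean_space \<Rightarrow> real"
  assumes g: "locally_integrable \<Omega> g" and \<psi>: "\<psi> \<in> test_functions \<Omega>" and w: "set w \<subseteq> Basis"
  shows "set_integrable lebesgue \<Omega> (\<lambda>x. g x * iter_partial w \<psi> x)"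
proof -
  obtain K where K: "smooth \<psi>" "compact K" "K \<subseteq> \<Omega>" "\<And>x. x \<notin> K \<Longrightarrow> iter_partial w \<psi> x = 0"
    using test_functionD[OF \<psi>] by metis
  have cont: "continuous_on UNIV (iter_partial w \<psi>)" by (rule smooth_iter_partial(2)[OF K(1) w])
  obtain M where M: "M \<ge> 0" "\<And>x. \<bar>iter_partial w \<psi> x\<bar> \<le> M"
    using bounded_continuous_compact_support[OF cont K(2,4)] by blast
  have gi: "integrable lebesgue (\<lambda>x. indicator K x *\<^sub>R g x)"
    using g K(2,3) by (auto simp: locally_integrable_def set_integrable_def)
  have m: "iter_partial w \<psi> \<in> borel_measurable lebesgue"
    using borel_measurable_continuous_onI[OF cont] by (simp add: measurable_completion)
  have eq: "indicator \<Omega> x *\<^sub>R (g x * iter_partial w \<psi> x) = (indicator K x *\<^sub>R g x) * iter_partial w \<psi> x" for x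
    using K(3) K(4)[of x] by (cases "x \<in> K") auto
  show ?thesis
    unfolding set_integrable_def eq
  proof (rule Bochner_Integration.integrable_bound)
    show "integrable lebesgue (\<lambda>x. M * (indicator K x *\<^sub>R g x))" using gi by simp
    show "(\<lambda>x. (indicator K x *\<^sub>R g x) * iter_partial w \<psi> x) \<in> borel_measurable lebesgue"
      by (rule borel_measurable_times[OF borel_measurable_integrable[OF gi] m])
    show "AE x in lebesgue. norm ((indicator K x *\<^sub>R g x) * iter_partial w \<psi> x) \<le> norm (M * (indicator K x *\<^sub>R g x))"
      using M by (intro AE_I2) (simp add: abs_mult mult_left_mono mult.commute[of M])
  qed
qed

text \<open>\<open>weak_deriv\<close> is an unspecified choice; this is what allows an explicitly
  computed derivative to replace it under an integral.\<close>

lemma has_weak_deriv_unique: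
  assumes \<Omega>: "open \<Omega>" and g: "has_weak_deriv \<Omega> \<alpha> u g" "has_weak_deriv \<Omega> \<alpha> u h"
  shows "AE x in lebesgue. x \<in> \<Omega> \<longrightarrow> g x = h x"
proof -
  have l: "locally_integrable \<Omega> g" "locally_integrable \<Omega> h"
    using g by (auto simp: has_weak_deriv_def)
  obtain w where w: "mset w = \<alpha>" using ex_mset by blast
  have "AE x in lebesgue. x \<in> \<Omega> \<longrightarrow> g x - h x = 0"
  proof (rule fundamental_lemma[OF \<Omega>])
    show "locally_integrable \<Omega> (\<lambda>x. g x - h x)"
      using l by (auto simp: locally_integrable_def intro!: set_integral_diff)
    fix \<psi> assume \<psi>: "\<psi> \<in> test_functions \<Omega>"
    have i: "set_integrable lebesgue \<Omega> (\<lambda>x. g x * \<psi> x)" "set_integrable lebesgue \<Omega> (\<lambda>x. h x * \<psi> x)"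
      using locally_integrable_mult_test[OF l(1) \<psi>, of "[]"] locally_integrable_mult_test[OF l(2) \<psi>, of "[]"]
      by (simp_all add: iter_partial_def)
    have "(LINT x:\<Omega>|lebesgue. u x * iter_partial w \<psi> x) = (-1) ^ size \<alpha> * (LINT x:\<Omega>|lebesgue. g x * \<psi> x)"
      "(LINT x:\<Omega>|lebesgue. u x * iter_partial w \<psi> x) = (-1) ^ size \<alpha> * (LINT x:\<Omega>|lebesgue. h x * \<psi> x)"
      using g \<psi> w unfolding has_weak_deriv_def by blast+
    then have "(LINT x:\<Omega>|lebesgue. g x * \<psi> x) = (LINT x:\<Omega>|lebesgue. h x * \<psi> x)" by simp
    then show "(LINT x:\<Omega>|lebesgue. (g x - h x) * \<psi> x) = 0"
      using set_integral_diff(2)[OF i] by (simp add: left_diff_distrib)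
  qed
  then show ?thesis by eventually_elim simp
qed

section \<open>Superpositions of smooth functions\<close>

lemma finite_words: "finite (words k :: 'a::euclidean_space list set)"
  unfolding words_def by (rule finite_lists_length_eq) simp

lemma finite_multi_indices: "finite (multi_indices k :: 'a::euclidean_space multiset set)"
proof -
  have "multi_indices k \<subseteq> mset ` (words k :: 'a list set)"
  proof
    fix \<alpha> :: "'a multiset" assume "\<alpha> \<in> multi_indices k"
    moreover obtain w where "mset w = \<alpha>" using ex_mset by blast
    ultimately show "\<alpha> \<in> mset ` words k" by (auto simp: multi_indices_def words_def)
  qed
  then show ?thesis using finite_words finite_surj by blast
qed

lemma mset_words: "w \<in> words k \<Longrightarrow> mset w \<in> multi_indices k"
  by (auto simp: words_def multi_indices_def)

lemma weak_deriv_works: "has_weak_deriv \<Omega> \<alpha> u g \<Longrightarrow> has_weak_deriv \<Omega> \<alpha> u (weak_deriv \<Omega> \<alpha> u)"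
  unfolding weak_deriv_def by (rule someI[of "has_weak_deriv \<Omega> \<alpha> u"])

lemma grad_norm_le: "grad_norm \<Omega> j u x \<le> (\<Sum>w\<in>words j. \<bar>weak_deriv \<Omega> (mset w) u x\<bar>)"
  using L2_set_le_sum_abs[of "\<lambda>w. weak_deriv \<Omega> (mset w) u x" "words j"]
  by (simp add: grad_norm_def L2_set_def)

text \<open>The index measure \<open>N\<close> covers sums over scales and integrals over centres at
  once. \<open>bound\<close> is the total weighted mass of each derivative, and the lower bound for
  \<omega> on compact sets turns it into local integrability with respect to Lebesgue
  measure.\<close>

locale superposition = sigma_finite_measure N
  for N :: "'n measure" +
  fixes A :: "'n \<Rightarrow> 'e::euclidean_space multiset \<Rightarrow> 'e \<Rightarrow> real" and \<Omega> :: "'e set" and \<omega> :: "'e \<Rightarrow> real"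
    and k :: nat and B :: ennreal
  assumes family: "\<And>\<nu>. deriv_family (A \<nu>)"
    and family_measurable [measurable]: "\<And>\<alpha>. (\<lambda>(\<nu>, v). A \<nu> \<alpha> v) \<in> borel_measurable (N \<Otimes>\<^sub>M lborel)"
    and open_\<Omega>: "open \<Omega>"
    and \<omega>_measurable [measurable]: "\<omega> \<in> borel_measurable borel"
    and \<omega>_nonneg: "\<And>v. 0 \<le> \<omega> v"
    and \<omega>_lower: "\<And>K. compact K \<Longrightarrow> K \<subseteq> \<Omega> \<Longrightarrow> \<exists>c>0. \<forall>v\<in>K. c \<le> \<omega> v"
    and bound: "\<And>\<alpha> j. \<alpha> \<in> multi_indices j \<Longrightarrow> j \<le> k \<Longrightarrow>
      (\<integral>\<^sup>+\<nu>. (\<integral>\<^sup>+v\<in>\<Omega>. ennreal (\<omega> v * \<bar>A \<nu> \<alpha> v\<bar>) \<partial>lborel) \<partial>N) \<le> B"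
    and bound_finite: "B < \<infinity>"
begin

sublocale pair: pair_sigma_finite N "lborel :: 'e measure" ..

definition integrated :: "'e multiset \<Rightarrow> 'e \<Rightarrow> real" where
  "integrated \<alpha> v = (\<integral>\<nu>. A \<nu> \<alpha> v \<partial>N)"

lemma \<Omega>_measurable [measurable]: "\<Omega> \<in> sets borel"
  using open_\<Omega> by simp

lemma family_measurable' [measurable]: "(\<lambda>(v, \<nu>). A \<nu> \<alpha> v) \<in> borel_measurable (lborel \<Otimes>\<^sub>M N)"
  using measurable_pair_swap[OF family_measurable[of \<alpha>]] by (simp add: split_beta')

lemma family_measurable_slice [measurable]: "A \<nu> \<alpha> \<in> borel_measurable borel"
  by (rule borel_measurable_continuous_onI[OF deriv_family_continuous[OF family]])

lemma integrated_measurable [measurable]: "integrated \<alpha> \<in> borel_measurable borel"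
proof -
  have "(\<lambda>v. \<integral>\<nu>. A \<nu> \<alpha> v \<partial>N) \<in> borel_measurable lborel" by measurable
  then show ?thesis by (simp add: integrated_def[abs_def])
qed

lemma weighted_integral_le:
  assumes "\<alpha> \<in> multi_indices j" "j \<le> k"
  shows "(\<integral>\<^sup>+v\<in>\<Omega>. ennreal (\<omega> v * \<bar>integrated \<alpha> v\<bar>) \<partial>lborel) \<le> B"
proof -
  have "(\<integral>\<^sup>+v\<in>\<Omega>. ennreal (\<omega> v * \<bar>integrated \<alpha> v\<bar>) \<partial>lborel)
      \<le> (\<integral>\<^sup>+v. \<integral>\<^sup>+\<nu>. ennreal (\<omega> v * \<bar>A \<nu> \<alpha> v\<bar>) * indicator \<Omega> v \<partial>N \<partial>lborel)"
  proof (rule nn_integral_mono)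
    fix v
    have "ennreal (\<omega> v * \<bar>integrated \<alpha> v\<bar>) * indicator \<Omega> v
        \<le> ennreal (\<omega> v) * (\<integral>\<^sup>+\<nu>. ennreal \<bar>A \<nu> \<alpha> v\<bar> \<partial>N) * indicator \<Omega> v"
      unfolding integrated_def
      by (intro mult_right_mono) (auto simp: ennreal_mult \<omega>_nonneg intro!: mult_left_mono ennreal_abs_integral_le)
    also have "\<dots> = (\<integral>\<^sup>+\<nu>. ennreal (\<omega> v * \<bar>A \<nu> \<alpha> v\<bar>) * indicator \<Omega> v \<partial>N)"
      by (simp add: ennreal_mult \<omega>_nonneg nn_integral_cmult nn_integral_multc)
    finally show "ennreal (\<omega> v * \<bar>integrated \<alpha> v\<bar>) * indicator \<Omega> v
        \<le> (\<integral>\<^sup>+\<nu>. ennreal (\<omega> v * \<bar>A \<nu> \<alpha> v\<bar>) * indicator \<Omega> v \<partial>N)" .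
  qed
  also have "\<dots> = (\<integral>\<^sup>+\<nu>. (\<integral>\<^sup>+v\<in>\<Omega>. ennreal (\<omega> v * \<bar>A \<nu> \<alpha> v\<bar>) \<partial>lborel) \<partial>N)"
    by (rule pair.Fubini') measurable
  also have "\<dots> \<le> B" by (rule bound[OF assms])
  finally show ?thesis .
qed

lemma compact_integral_finite:
  assumes "\<alpha> \<in> multi_indices j" "j \<le> k" and K: "compact K" "K \<subseteq> \<Omega>"
  shows "(\<integral>\<^sup>+\<nu>. \<integral>\<^sup>+v. indicator K v * ennreal \<bar>A \<nu> \<alpha> v\<bar> \<partial>lborel \<partial>N) < \<infinity>"
proof -
  obtain c where c: "c > 0" "\<And>v. v \<in> K \<Longrightarrow> c \<le> \<omega> v" using \<omega>_lower[OF K] by auto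
  have "(\<integral>\<^sup>+\<nu>. \<integral>\<^sup>+v. indicator K v * ennreal \<bar>A \<nu> \<alpha> v\<bar> \<partial>lborel \<partial>N)
      \<le> (\<integral>\<^sup>+\<nu>. \<integral>\<^sup>+v. ennreal (1 / c) * (ennreal (\<omega> v * \<bar>A \<nu> \<alpha> v\<bar>) * indicator \<Omega> v) \<partial>lborel \<partial>N)"
  proof (intro nn_integral_mono)
    fix \<nu> v
    show "indicator K v * ennreal \<bar>A \<nu> \<alpha> v\<bar> \<le> ennreal (1 / c) * (ennreal (\<omega> v * \<bar>A \<nu> \<alpha> v\<bar>) * indicator \<Omega> v)"
    proof (cases "v \<in> K")
      case True
      have "\<bar>A \<nu> \<alpha> v\<bar> = (1 / c) * (c * \<bar>A \<nu> \<alpha> v\<bar>)" using c by simp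
      also have "\<dots> \<le> (1 / c) * (\<omega> v * \<bar>A \<nu> \<alpha> v\<bar>)"
        using c True by (intro mult_left_mono mult_right_mono) auto
      finally have "ennreal \<bar>A \<nu> \<alpha> v\<bar> \<le> ennreal ((1 / c) * (\<omega> v * \<bar>A \<nu> \<alpha> v\<bar>))" by (rule ennreal_leI)
      then show ?thesis using True K c \<omega>_nonneg by (auto simp: ennreal_mult[symmetric])
    qed simp
  qed
  also have "\<dots> = ennreal (1 / c) * (\<integral>\<^sup>+\<nu>. (\<integral>\<^sup>+v\<in>\<Omega>. ennreal (\<omega> v * \<bar>A \<nu> \<alpha> v\<bar>) \<partial>lborel) \<partial>N)"
    by (simp add: nn_integral_cmult)
  also have "\<dots> < \<infinity>"
    using le_less_trans[OF bound[OF assms(1,2)] bound_finite] by (simp add: ennreal_mult_less_top)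
  finally show ?thesis .
qed

text \<open>The joint integrability behind every exchange of the index integral with an integral
  against a test function or an indicator.\<close>

lemma integrable_pair:
  assumes \<alpha>: "\<alpha> \<in> multi_indices j" "j \<le> k" and K: "compact K" "K \<subseteq> \<Omega>"
    and \<zeta>: "\<zeta> \<in> borel_measurable borel" "\<And>v. \<bar>\<zeta> v\<bar> \<le> M" "\<And>v. v \<notin> K \<Longrightarrow> \<zeta> v = 0"
  shows "integrable (N \<Otimes>\<^sub>M lborel) (\<lambda>(\<nu>, v). A \<nu> \<alpha> v * \<zeta> v)"
proof (rule integrableI_bounded)
  note \<zeta>(1)[measurable]
  have M: "M \<ge> 0" using \<zeta>(2)[of undefined] by linarith
  show "(\<lambda>(\<nu>, v). A \<nu> \<alpha> v * \<zeta> v) \<in> borel_measurable (N \<Otimes>\<^sub>M lborel)" by measurable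
  have [measurable]: "K \<in> sets borel" using K by (simp add: compact_imp_closed borel_closed)
  have "(\<integral>\<^sup>+p. ennreal (norm (case p of (\<nu>, v) \<Rightarrow> A \<nu> \<alpha> v * \<zeta> v)) \<partial>(N \<Otimes>\<^sub>M lborel))
      = (\<integral>\<^sup>+\<nu>. \<integral>\<^sup>+v. ennreal \<bar>A \<nu> \<alpha> v * \<zeta> v\<bar> \<partial>lborel \<partial>N)"
    by (subst lborel.nn_integral_fst[symmetric]) (auto simp: split_beta')
  also have "\<dots> \<le> (\<integral>\<^sup>+\<nu>. \<integral>\<^sup>+v. ennreal M * (indicator K v * ennreal \<bar>A \<nu> \<alpha> v\<bar>) \<partial>lborel \<partial>N)"
  proof (intro nn_integral_mono)
    fix \<nu> v
    show "ennreal \<bar>A \<nu> \<alpha> v * \<zeta> v\<bar> \<le> ennreal M * (indicator K v * ennreal \<bar>A \<nu> \<alpha> v\<bar>)"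
    proof (cases "v \<in> K")
      case True
      have "\<bar>A \<nu> \<alpha> v * \<zeta> v\<bar> \<le> M * \<bar>A \<nu> \<alpha> v\<bar>"
        using mult_left_mono[OF \<zeta>(2)[of v], of "\<bar>A \<nu> \<alpha> v\<bar>"] by (simp add: abs_mult mult.commute)
      then show ?thesis using True M by (simp add: ennreal_mult[symmetric] ennreal_leI)
    qed (simp add: \<zeta>)
  qed
  also have "\<dots> = ennreal M * (\<integral>\<^sup>+\<nu>. \<integral>\<^sup>+v. indicator K v * ennreal \<bar>A \<nu> \<alpha> v\<bar> \<partial>lborel \<partial>N)"
    by (simp add: nn_integral_cmult)
  also have "\<dots> < \<infinity>"
    using compact_integral_finite[OF \<alpha> K] by (simp add: ennreal_mult_less_top)
  finally show "(\<integral>\<^sup>+p. ennreal (norm (case p of (\<nu>, v) \<Rightarrow> A \<nu> \<alpha> v * \<zeta> v)) \<partial>(N \<Otimes>\<^sub>M lborel)) < \<infinity>" .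
qed

lemma integral_integrated_mult:
  assumes "\<alpha> \<in> multi_indices j" "j \<le> k" and "compact K" "K \<subseteq> \<Omega>"
    and "\<zeta> \<in> borel_measurable borel" "\<And>v. \<bar>\<zeta> v\<bar> \<le> M" "\<And>v. v \<notin> K \<Longrightarrow> \<zeta> v = 0"
  shows "(\<integral>v. integrated \<alpha> v * \<zeta> v \<partial>lborel) = (\<integral>\<nu>. \<integral>v. A \<nu> \<alpha> v * \<zeta> v \<partial>lborel \<partial>N)"
proof -
  have "(\<integral>v. integrated \<alpha> v * \<zeta> v \<partial>lborel) = (\<integral>v. \<integral>\<nu>. A \<nu> \<alpha> v * \<zeta> v \<partial>N \<partial>lborel)"
    by (simp add: integrated_def)
  also have "\<dots> = (\<integral>\<nu>. \<integral>v. A \<nu> \<alpha> v * \<zeta> v \<partial>lborel \<partial>N)"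
    by (rule pair.Fubini_integral) (rule integrable_pair[OF assms])
  finally show ?thesis .
qed

lemma integrated_locally_integrable:
  assumes \<alpha>: "\<alpha> \<in> multi_indices j" "j \<le> k"
  shows "locally_integrable \<Omega> (integrated \<alpha>)"
  unfolding locally_integrable_def set_integrable_def
proof (intro allI impI)
  fix K assume K: "compact K \<and> K \<subseteq> \<Omega>"
  then have [measurable]: "K \<in> sets borel" by (simp add: compact_imp_closed borel_closed)
  have "integrable (N \<Otimes>\<^sub>M lborel) (\<lambda>(\<nu>, v). A \<nu> \<alpha> v * indicator K v)"
    by (rule integrable_pair[OF \<alpha>, where K=K and M=1]) (use K in \<open>auto simp: indicator_def\<close>)
  then have "integrable lborel (\<lambda>v. \<integral>\<nu>. A \<nu> \<alpha> v * indicator K v \<partial>N)"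
    by (rule pair.integrable_snd)
  then have "integrable lborel (\<lambda>v. indicator K v *\<^sub>R integrated \<alpha> v)"
    by (simp add: integrated_def mult.commute)
  then show "integrable lebesgue (\<lambda>v. indicator K v *\<^sub>R integrated \<alpha> v)"
    by (subst integrable_completion) auto
qed

text \<open>Fubini moves the index integral outside, classical integration by parts applies to each
  \<open>A \<nu>\<close>, and Fubini moves the integral back.\<close>

lemma integrated_has_weak_deriv:
  assumes \<alpha>: "\<alpha> \<in> multi_indices j" "j \<le> k"
  shows "has_weak_deriv \<Omega> \<alpha> (integrated {#}) (integrated \<alpha>)"
  unfolding has_weak_deriv_def
proof (intro conjI ballI allI impI)
  have e: "{#} \<in> multi_indices 0" by (simp add: multi_indices_def)
  show "locally_integrable \<Omega> (integrated {#})" "locally_integrable \<Omega> (integrated \<alpha>)"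
    using integrated_locally_integrable[OF e] integrated_locally_integrable[OF \<alpha>] by auto
  fix \<psi> w assume \<psi>: "\<psi> \<in> test_functions \<Omega>" and w: "mset w = \<alpha>"
  have wB: "set w \<subseteq> Basis" "length w = size \<alpha>"
    using w \<alpha> by (auto simp: multi_indices_def)
  obtain K where K: "smooth \<psi>" "compact K" "K \<subseteq> \<Omega>" "\<And>w x. x \<notin> K \<Longrightarrow> iter_partial w \<psi> x = 0"
    "\<And>x. x \<notin> K \<Longrightarrow> \<psi> x = 0"
    using test_functionD[OF \<psi>] by metis
  have c: "continuous_on UNIV (iter_partial w \<psi>)" "continuous_on UNIV \<psi>"
    using smooth_iter_partial(2)[OF K(1), of w] smooth_iter_partial(2)[OF K(1), of "[]"] wB
    by (simp_all add: iter_partial_def)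
  note m = borel_measurable_continuous_onI[OF c(1)] borel_measurable_continuous_onI[OF c(2)]
  obtain M1 where M1: "\<And>v. \<bar>iter_partial w \<psi> v\<bar> \<le> M1"
    using bounded_continuous_compact_support[OF c(1) K(2) K(4)] by blast
  obtain M2 where M2: "\<And>v. \<bar>\<psi> v\<bar> \<le> M2"
    using bounded_continuous_compact_support[OF c(2) K(2) K(5)] by blast
  have off: "iter_partial w \<psi> v = 0" "\<psi> v = 0" if "v \<notin> \<Omega>" for v
    using that K by auto
  have "(LINT v:\<Omega>|lebesgue. integrated {#} v * iter_partial w \<psi> v)
      = (\<integral>v. integrated {#} v * iter_partial w \<psi> v \<partial>lborel)"
    by (rule set_lebesgue_integral_test) (use off m in auto)
  also have "\<dots> = (\<integral>\<nu>. \<integral>v. A \<nu> {#} v * iter_partial w \<psi> v \<partial>lborel \<partial>N)"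
    by (rule integral_integrated_mult[OF e _ K(2,3) m(1) M1 K(4)]) auto
  also have "\<dots> = (\<integral>\<nu>. (-1) ^ size \<alpha> * (\<integral>v. A \<nu> \<alpha> v * \<psi> v \<partial>lborel) \<partial>N)"
    using integration_by_parts_iter_partial[OF family K(1,2,5) wB(1), of _ "{#}"] wB w by simp
  also have "\<dots> = (-1) ^ size \<alpha> * (\<integral>\<nu>. \<integral>v. A \<nu> \<alpha> v * \<psi> v \<partial>lborel \<partial>N)"
    by simp
  also have "(\<integral>\<nu>. \<integral>v. A \<nu> \<alpha> v * \<psi> v \<partial>lborel \<partial>N) = (\<integral>v. integrated \<alpha> v * \<psi> v \<partial>lborel)"
    by (rule integral_integrated_mult[OF \<alpha> K(2,3) m(2) M2 K(5), symmetric])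
  also have "\<dots> = (LINT v:\<Omega>|lebesgue. integrated \<alpha> v * \<psi> v)"
    by (rule set_lebesgue_integral_test[symmetric]) (use off m in auto)
  finally show "(LINT v:\<Omega>|lebesgue. integrated {#} v * iter_partial w \<psi> v)
      = (-1) ^ size \<alpha> * (LINT v:\<Omega>|lebesgue. integrated \<alpha> v * \<psi> v)" .
qed

text \<open>Uniqueness identifies each \<open>weak_deriv\<close> with the integrated classical
  derivative almost everywhere. The Euclidean norm is at most the sum over all words, hence the
  factor counting them.\<close>

lemma grad_norm_integral_le:
  assumes j: "j \<le> k"
  shows "(\<integral>\<^sup>+v\<in>\<Omega>. ennreal (\<omega> v * grad_norm \<Omega> j (integrated {#}) v) \<partial>lebesgue)
    \<le> of_nat (card (words j :: 'e list set)) * B"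
proof -
  let ?W = "words j :: 'e list set"
  have "AE v in lebesgue. \<forall>w\<in>?W. v \<in> \<Omega> \<longrightarrow> weak_deriv \<Omega> (mset w) (integrated {#}) v = integrated (mset w) v"
  proof (subst AE_ball_countable[OF countable_finite[OF finite_words]], rule ballI)
    fix w assume "w \<in> ?W"
    from integrated_has_weak_deriv[OF mset_words[OF this] j]
    have "has_weak_deriv \<Omega> (mset w) (integrated {#}) (integrated (mset w))" .
    from this weak_deriv_works[OF this]
    show "AE v in lebesgue. v \<in> \<Omega> \<longrightarrow> weak_deriv \<Omega> (mset w) (integrated {#}) v = integrated (mset w) v"
      by (intro has_weak_deriv_unique[OF open_\<Omega>])
  qed
  then have "(\<integral>\<^sup>+v\<in>\<Omega>. ennreal (\<omega> v * grad_norm \<Omega> j (integrated {#}) v) \<partial>lebesgue)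
      \<le> (\<integral>\<^sup>+v. (\<Sum>w\<in>?W. ennreal (\<omega> v * \<bar>integrated (mset w) v\<bar>) * indicator \<Omega> v) \<partial>lebesgue)"
  proof (intro nn_integral_mono_AE, eventually_elim)
    case (elim v)
    show ?case
    proof (cases "v \<in> \<Omega>")
      case True
      have "\<omega> v * grad_norm \<Omega> j (integrated {#}) v \<le> \<omega> v * (\<Sum>w\<in>?W. \<bar>weak_deriv \<Omega> (mset w) (integrated {#}) v\<bar>)"
        by (intro mult_left_mono grad_norm_le \<omega>_nonneg)
      also have "\<dots> = (\<Sum>w\<in>?W. \<omega> v * \<bar>integrated (mset w) v\<bar>)"
        unfolding sum_distrib_left by (rule sum.cong) (use elim True in auto)
      finally show ?thesis using True by (simp add: sum_ennreal \<omega>_nonneg ennreal_leI)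
    qed simp
  qed
  also have "\<dots> = (\<integral>\<^sup>+v. (\<Sum>w\<in>?W. ennreal (\<omega> v * \<bar>integrated (mset w) v\<bar>) * indicator \<Omega> v) \<partial>lborel)"
    by (rule nn_integral_completion)
  also have "\<dots> = (\<Sum>w\<in>?W. \<integral>\<^sup>+v\<in>\<Omega>. ennreal (\<omega> v * \<bar>integrated (mset w) v\<bar>) \<partial>lborel)"
    by (rule nn_integral_sum) measurable
  also have "\<dots> \<le> (\<Sum>w\<in>?W. B)"
    by (intro sum_mono weighted_integral_le[OF mset_words j])
  also have "\<dots> = of_nat (card ?W) * B" by simp
  finally show ?thesis .
qed

lemma sobolev_norm_integrated_le:
  "sobolev_norm \<Omega> \<omega> k (integrated {#}) \<le> of_nat (1 + (\<Sum>j=1..k. card (words j :: 'e list set))) * B"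
proof -
  have "(\<integral>\<^sup>+v\<in>\<Omega>. ennreal (\<omega> v * \<bar>integrated {#} v\<bar>) \<partial>lebesgue) \<le> B"
    unfolding nn_integral_completion by (rule weighted_integral_le[of _ 0]) (auto simp: multi_indices_def)
  moreover have "(\<Sum>j=1..k. \<integral>\<^sup>+v\<in>\<Omega>. ennreal (\<omega> v * grad_norm \<Omega> j (integrated {#}) v) \<partial>lebesgue)
      \<le> (\<Sum>j=1..k. of_nat (card (words j :: 'e list set)) * B)"
    by (intro sum_mono grad_norm_integral_le) auto
  ultimately show ?thesis
    unfolding sobolev_norm_def by (simp add: sum_distrib_right distrib_right add_mono)
qed

lemma integrated_in_sobolev_space: "integrated {#} \<in> sobolev_space \<Omega> \<omega> k"
proof -
  have "sobolev_norm \<Omega> \<omega> k (integrated {#}) < \<infinity>"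
    by (rule le_less_trans[OF sobolev_norm_integrated_le])
      (use bound_finite in \<open>auto simp: ennreal_mult_less_top of_nat_less_top\<close>)
  then show ?thesis
    using integrated_has_weak_deriv by (auto simp: sobolev_space_def sobolev_loc_def)
qed

end

section \<open>The extension operator\<close>

lemma borel_measurable_fst_snd [measurable]:
  "fst \<in> borel_measurable (borel :: ('a::euclidean_space \<times> 'b::euclidean_space) measure)"
  "snd \<in> borel_measurable (borel :: ('a::euclidean_space \<times> 'b::euclidean_space) measure)"
  by (auto intro!: borel_measurable_continuous_onI continuous_intros)

lemma open_upper_half_space: "open (upper_half_space :: ('a::euclidean_space \<times> real) set)"
  unfolding upper_half_space_def by (intro open_Collect_less continuous_intros)

text \<open>The derivatives of the unit atom (z, t) |-> mollifier z * cutoff t. The basis vector (0,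
  1) is the t-direction; the divisor normalises the z-factor only.\<close>

definition ext_family :: "('a::euclidean_space \<times> real) multiset \<Rightarrow> 'a \<times> real \<Rightarrow> real" where
  "ext_family \<alpha> v = product_family (\<lambda>b. if b = (0, 1) then cutoff else bump) \<alpha> v
     / (\<integral>z. bump_family {#} (z :: 'a) \<partial>lborel)"

lemma deriv_family_ext: "deriv_family (ext_family :: ('a::euclidean_space \<times> real) multiset \<Rightarrow> _)"
proof -
  have "deriv_family (product_family (\<lambda>b :: 'a \<times> real. if b = (0, 1) then cutoff else bump))"
    by (rule deriv_family_product) (simp add: smooth_bump smooth_cutoff)
  from deriv_family_cmult[OF this, of "1 / (\<integral>z. bump_family {#} (z :: 'a) \<partial>lborel)"]
  show ?thesis by (simp add: ext_family_def[abs_def])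
qed

lemma ext_family_measurable [measurable]:
  "ext_family \<alpha> \<in> borel_measurable (borel :: ('a::euclidean_space \<times> real) measure)"
  by (rule borel_measurable_continuous_onI[OF deriv_family_continuous[OF deriv_family_ext]])

lemma product_family_Pair:
  fixes z :: "'a::euclidean_space"
  shows "product_family p \<alpha> (z, t) =
    (\<Prod>b\<in>Basis. (deriv ^^ count \<alpha> (b, 0)) (p (b, 0)) (z \<bullet> b)) * (deriv ^^ count \<alpha> (0, 1)) (p (0, 1)) t"
proof -
  have "product_family p \<alpha> (z, t) =
      (\<Prod>b\<in>(\<lambda>u. (u, 0)) ` Basis. (deriv ^^ count \<alpha> b) (p b) ((z, t) \<bullet> b)) *
      (\<Prod>b\<in>(\<lambda>v. (0, v)) ` Basis. (deriv ^^ count \<alpha> b) (p b) ((z, t) \<bullet> b))"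
    unfolding product_family_def Basis_prod_def
    by (rule prod.union_disjoint) auto
  also have "(\<Prod>b\<in>(\<lambda>u. (u, 0)) ` Basis. (deriv ^^ count \<alpha> b) (p b) ((z, t) \<bullet> b)) =
      (\<Prod>b\<in>Basis. (deriv ^^ count \<alpha> (b, 0)) (p (b, 0)) (z \<bullet> b))"
    by (subst prod.reindex) (auto intro: inj_onI)
  also have "(\<Prod>b\<in>(\<lambda>v. (0, v)) ` Basis. (deriv ^^ count \<alpha> b) (p b) ((z, t) \<bullet> b)) =
      (deriv ^^ count \<alpha> (0, 1)) (p (0, 1)) t"
    by (subst prod.reindex) (auto intro: inj_onI)
  finally show ?thesis .
qed

lemma ext_family_empty: "ext_family {#} (z, t) = mollifier z * cutoff t"
proof -
  have "(b, 0) \<noteq> (0 :: 'a, 1 :: real)" for b by simp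
  then show ?thesis
    unfolding ext_family_def product_family_Pair mollifier_family_def
    by (simp add: product_family_def)
qed

lemma ext_family_eq_0:
  fixes z :: "'a::euclidean_space"
  assumes "z \<notin> bump_box \<or> t < -1" shows "ext_family \<alpha> (z, t) = 0"
  using assms
proof
  assume "z \<notin> bump_box"
  then obtain b where b: "b \<in> Basis" "z \<bullet> b \<notin> {1/2..1}"
    by (auto simp: mem_box inner_add_left)
  from higher_deriv_bump_eq_0[OF b(2)] b(1)
  have "(\<Prod>b\<in>Basis. (deriv ^^ count \<alpha> (b, 0)) bump (z \<bullet> b)) = 0"
    by (intro prod_zero bexI[of _ b]) auto
  then show ?thesis by (simp add: ext_family_def product_family_Pair)
next
  assume "t < -1"
  then show ?thesis
    by (simp add: ext_family_def product_family_Pair higher_deriv_cutoff_eq_0)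
qed

lemma ext_family_bounded:
  obtains M where "M \<ge> 0" "\<And>v :: 'a::euclidean_space \<times> real. \<bar>ext_family \<alpha> v\<bar> \<le> M"
proof -
  have "\<exists>M. \<forall>b\<in>Basis. \<forall>x. \<bar>(deriv ^^ count \<alpha> (b :: 'a, 0)) bump x\<bar> \<le> M b"
    by (intro bchoice ballI higher_deriv_bump_bounded)
  then obtain M1 where M1: "\<And>b x. b \<in> Basis \<Longrightarrow> \<bar>(deriv ^^ count \<alpha> (b :: 'a, 0)) bump x\<bar> \<le> M1 b"
    by blast
  obtain M2 where M2: "\<And>x. \<bar>(deriv ^^ count \<alpha> (0, 1)) cutoff x\<bar> \<le> M2"
    using higher_deriv_cutoff_bounded by blast
  let ?I = "\<integral>z. bump_family {#} (z :: 'a) \<partial>lborel"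
  let ?M = "(\<Prod>b\<in>Basis. M1 b) * M2 / ?I"
  have "\<bar>ext_family \<alpha> (z, t)\<bar> \<le> ?M" for z t
  proof -
    have "\<bar>\<Prod>b\<in>Basis. (deriv ^^ count \<alpha> (b, 0)) bump (z \<bullet> b)\<bar> \<le> (\<Prod>b\<in>Basis. M1 b)"
      unfolding abs_prod by (rule prod_mono) (use M1 in auto)
    then have "\<bar>(\<Prod>b\<in>Basis. (deriv ^^ count \<alpha> (b, 0)) bump (z \<bullet> b)) * (deriv ^^ count \<alpha> (0, 1)) cutoff t\<bar>
        \<le> (\<Prod>b\<in>Basis. M1 b) * M2"
      unfolding abs_mult by (intro mult_mono M2) (auto intro: order_trans[OF abs_ge_zero])
    then show ?thesis
      using integral_bump_family_pos[where 'a='a]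
      by (simp add: ext_family_def product_family_Pair divide_right_mono)
  qed
  then have "\<bar>ext_family \<alpha> v\<bar> \<le> max ?M 0" for v by (cases v) (metis max.coboundedI1)
  then show thesis using that[of "max ?M 0"] by simp
qed

text \<open>The weighted mass of a derivative of the unit atom. The half-space appears reflected
  because atoms are evaluated at ((y, 0) - v) / r, whose last coordinate is negative.\<close>

definition ext_moment :: "real \<Rightarrow> ('a::euclidean_space \<times> real) multiset \<Rightarrow> ennreal" where
  "ext_moment a \<alpha> = (\<integral>\<^sup>+w. ennreal (\<bar>snd w\<bar> powr a * \<bar>ext_family \<alpha> w\<bar>) * indicator {w. snd w < 0} w \<partial>lborel)"

text \<open>The function is bounded and, for t < 0, supported in the box times [-1, 0], which leaves
  the integral of t powr a over [0, 1]. This is where -1 < a enters.\<close>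

lemma ext_moment_finite:
  fixes \<alpha> :: "('a::euclidean_space \<times> real) multiset"
  assumes a: "-1 < a"
  shows "ext_moment a \<alpha> < \<infinity>"
proof -
  obtain M where M: "M \<ge> 0" "\<And>v. \<bar>ext_family \<alpha> v\<bar> \<le> M" using ext_family_bounded by blast
  have "ext_moment a \<alpha> \<le> (\<integral>\<^sup>+w. ennreal M * (indicator (bump_box :: 'a set) (fst w) * (ennreal (\<bar>snd w\<bar> powr a) * indicator {-1..0} (snd w))) \<partial>lborel)"
    unfolding ext_moment_def
  proof (rule nn_integral_mono)
    fix w :: "'a \<times> real"
    show "ennreal (\<bar>snd w\<bar> powr a * \<bar>ext_family \<alpha> w\<bar>) * indicator {w. snd w < 0} w
        \<le> ennreal M * (indicator (bump_box :: 'a set) (fst w) * (ennreal (\<bar>snd w\<bar> powr a) * indicator {-1..0} (snd w)))"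
    proof (cases "fst w \<in> bump_box \<and> -1 \<le> snd w \<and> snd w < 0")
      case True
      have "\<bar>snd w\<bar> powr a * \<bar>ext_family \<alpha> w\<bar> \<le> M * \<bar>snd w\<bar> powr a"
        using mult_right_mono[OF M(2)[of w], of "\<bar>snd w\<bar> powr a"] by (simp add: mult.commute)
      then show ?thesis using True M by (simp add: ennreal_mult[symmetric] ennreal_leI)
    next
      case False
      then have "ext_family \<alpha> w = 0 \<or> \<not> snd w < 0"
        using ext_family_eq_0[of "fst w" "snd w" \<alpha>] by (cases w) auto
      then show ?thesis by auto
    qed
  qed
  also have "\<dots> = ennreal M * (\<integral>\<^sup>+w. (indicator (bump_box :: 'a set) (fst w) * (ennreal (\<bar>snd w\<bar> powr a) * indicator {-1..0} (snd w))) \<partial>(lborel \<Otimes>\<^sub>M lborel))"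
    by (subst nn_integral_cmult) (auto simp: lborel_prod)
  also have "(\<integral>\<^sup>+w. (indicator (bump_box :: 'a set) (fst w) * (ennreal (\<bar>snd w\<bar> powr a) * indicator {-1..0} (snd w))) \<partial>(lborel \<Otimes>\<^sub>M lborel))
      = (\<integral>\<^sup>+z. \<integral>\<^sup>+t. indicator bump_box (z :: 'a) * (ennreal (\<bar>t\<bar> powr a) * indicator {-1..0} t) \<partial>lborel \<partial>lborel)"
    by (subst lborel.nn_integral_fst[symmetric]) auto
  also have "\<dots> = emeasure lborel (bump_box :: 'a set) * (\<integral>\<^sup>+t. ennreal (\<bar>t\<bar> powr a) * indicator {-1..0} t \<partial>lborel)"
    by (simp add: nn_integral_cmult nn_integral_multc)
  also have "(\<integral>\<^sup>+t. ennreal (\<bar>t\<bar> powr a) * indicator {-1..0} t \<partial>lborel) = ennreal (1 / (a + 1))"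
  proof -
    have "(\<integral>\<^sup>+t. ennreal (\<bar>t\<bar> powr a) * indicator {-1..0} t \<partial>lborel)
        = (\<integral>\<^sup>+t. ennreal (t powr a) * indicator {0..1} t \<partial>lborel)"
      by (subst nn_integral_real_affine[where c="-1" and t=0])
        (auto intro!: nn_integral_cong simp: indicator_def)
    also have "\<dots> = (\<integral>\<^sup>+t. ennreal (if t \<in> {0..1} then t powr a else 0) \<partial>lborel)"
      by (intro nn_integral_cong) auto
    also have "\<dots> = ennreal (1 / (a + 1))"
    proof (rule nn_integral_has_integral_lborel)
      have "((\<lambda>t. t powr a) has_integral (1 powr (a + 1) / (a + 1))) {0..1}"
        by (rule has_integral_powr_from_0) (use a in auto)
      then show "((\<lambda>t. if t \<in> {0..1} then t powr a else 0) has_integral (1 / (a + 1))) UNIV"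
        unfolding has_integral_restrict_UNIV by simp
    qed auto
    finally show ?thesis .
  qed
  finally show ?thesis
    by (rule le_less_trans) (auto simp: ennreal_mult_less_top emeasure_lborel_cbox_eq)
qed

text \<open>An index \<nu> stands for an atom of mass \<open>h \<nu>\<close>, centre
  \<open>y \<nu>\<close> and scale \<open>r \<nu>\<close>. Derivatives of order below m + 1 carry
  additional positive powers of the scale, which the common bound \<open>R\<close> absorbs.\<close>

locale half_space_extension = sigma_finite_measure N
  for N :: "'n measure" +
  fixes h :: "'n \<Rightarrow> real" and y :: "'n \<Rightarrow> 'a::euclidean_space" and r :: "'n \<Rightarrow> real"
    and m :: nat and a R :: real
  assumes h_measurable [measurable]: "h \<in> borel_measurable N"
    and y_measurable [measurable]: "y \<in> borel_measurable N"
    and r_measurable [measurable]: "r \<in> borel_measurable N"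
    and r_pos: "\<And>\<nu>. 0 < r \<nu>" and r_le: "\<And>\<nu>. r \<nu> \<le> R" and R: "1 \<le> R"
    and a: "-1 < a" "a \<le> m"
    and total_finite: "(\<integral>\<^sup>+\<nu>. ennreal (\<bar>h \<nu>\<bar> * r \<nu> powr (a - m)) \<partial>N) < \<infinity>"
begin

section \<open>Atoms and their weighted norms\<close>

definition atom :: "'n \<Rightarrow> ('a \<times> real) multiset \<Rightarrow> 'a \<times> real \<Rightarrow> real" where
  "atom \<nu> \<alpha> v = (h \<nu> * (1 / r \<nu>) ^ DIM('a)) * (- 1 / r \<nu>) ^ size \<alpha> * ext_family \<alpha> (((y \<nu>, 0) - v) /\<^sub>R r \<nu>)"

lemma atom_measurable [measurable]: "(\<lambda>(\<nu>, v). atom \<nu> \<alpha> v) \<in> borel_measurable (N \<Otimes>\<^sub>M lborel)"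
  unfolding atom_def by measurable

definition total :: ennreal where
  "total = (\<integral>\<^sup>+\<nu>. ennreal (\<bar>h \<nu>\<bar> * r \<nu> powr (a - m)) \<partial>N)"

text \<open>Substituting v = (y, 0) - r w, the Jacobian gives r^(n+1), the weight r^a, the
  normalisation r^(-n) and the derivatives r^(-j). The product is r^(a-m) r^(m+1-j), and the last
  factor is at most R^(m+1).\<close>

lemma atom_integral_le:
  assumes j: "\<alpha> \<in> multi_indices j" "j \<le> m + 1"
  shows "(\<integral>\<^sup>+v\<in>upper_half_space. ennreal (snd v powr a * \<bar>atom \<nu> \<alpha> v\<bar>) \<partial>lborel)
    \<le> ennreal (\<bar>h \<nu>\<bar> * r \<nu> powr (a - m)) * (ennreal (R ^ (m + 1)) * ext_moment a \<alpha>)"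
proof -
  let ?r = "r \<nu>" and ?n = "DIM('a)"
  have r: "0 < ?r" "?r \<le> R" using r_pos r_le by auto
  have sz: "size \<alpha> = j" using j by (simp add: multi_indices_def)
  have uh[measurable]: "(upper_half_space :: ('a \<times> real) set) \<in> sets borel"
    by (rule borel_open[OF open_upper_half_space])
  have [measurable]: "(\<lambda>v. atom \<nu> \<alpha> v) \<in> borel_measurable borel"
    unfolding atom_def by measurable
  have "(\<integral>\<^sup>+v\<in>upper_half_space. ennreal (snd v powr a * \<bar>atom \<nu> \<alpha> v\<bar>) \<partial>lborel)
      = ennreal (\<bar>- ?r\<bar> ^ DIM('a \<times> real)) *
        (\<integral>\<^sup>+w. ennreal (snd ((y \<nu>, 0) + (- ?r) *\<^sub>R w) powr a * \<bar>atom \<nu> \<alpha> ((y \<nu>, 0) + (- ?r) *\<^sub>R w)\<bar>)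
          * indicator upper_half_space ((y \<nu>, 0) + (- ?r) *\<^sub>R w) \<partial>lborel)"
    by (rule nn_integral_lborel_affine) (use r in auto)
  also have "\<dots> = ennreal (?r ^ (?n + 1)) * (\<integral>\<^sup>+w. ennreal (?r powr a * \<bar>h \<nu>\<bar> * (1 / ?r) ^ ?n * (1 / ?r) ^ j) *
      (ennreal (\<bar>snd w\<bar> powr a * \<bar>ext_family \<alpha> w\<bar>) * indicator {w. snd w < 0} w) \<partial>lborel)"
  proof -
    have "ennreal (snd ((y \<nu>, 0) + (- ?r) *\<^sub>R w) powr a * \<bar>atom \<nu> \<alpha> ((y \<nu>, 0) + (- ?r) *\<^sub>R w)\<bar>)
          * indicator upper_half_space ((y \<nu>, 0) + (- ?r) *\<^sub>R w)
        = ennreal (?r powr a * \<bar>h \<nu>\<bar> * (1 / ?r) ^ ?n * (1 / ?r) ^ j) *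
          (ennreal (\<bar>snd w\<bar> powr a * \<bar>ext_family \<alpha> w\<bar>) * indicator {w. snd w < 0} w)" for w :: "'a \<times> real"
    proof (cases "snd w < 0")
      case True
      have s: "snd ((y \<nu>, 0) + (- ?r) *\<^sub>R w) = ?r * \<bar>snd w\<bar>" using True by simp
      have "((y \<nu>, 0) - ((y \<nu>, 0) + (- ?r) *\<^sub>R w)) /\<^sub>R ?r = w" using r by simp
      then have "\<bar>atom \<nu> \<alpha> ((y \<nu>, 0) + (- ?r) *\<^sub>R w)\<bar> = \<bar>h \<nu>\<bar> * (1 / ?r) ^ ?n * (1 / ?r) ^ j * \<bar>ext_family \<alpha> w\<bar>"
        unfolding atom_def using r by (simp add: abs_mult power_abs sz)
      then have "snd ((y \<nu>, 0) + (- ?r) *\<^sub>R w) powr a * \<bar>atom \<nu> \<alpha> ((y \<nu>, 0) + (- ?r) *\<^sub>R w)\<bar>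
          = (?r powr a * \<bar>h \<nu>\<bar> * (1 / ?r) ^ ?n * (1 / ?r) ^ j) * (\<bar>snd w\<bar> powr a * \<bar>ext_family \<alpha> w\<bar>)"
        unfolding s using r by (simp add: powr_mult mult_ac)
      moreover have "(y \<nu>, 0) + (- ?r) *\<^sub>R w \<in> upper_half_space"
        unfolding upper_half_space_def mem_Collect_eq s using r True by (simp add: mult_pos_neg)
      ultimately show ?thesis
        using True r by (simp only: ennreal_mult[symmetric]) (simp add: ennreal_mult[symmetric])
    next
      case False
      then have "(y \<nu>, 0) + (- ?r) *\<^sub>R w \<notin> upper_half_space"
        using r by (simp add: upper_half_space_def not_less)
      then show ?thesis using False by simp
    qed
    then show ?thesis using r by simp
  qed
  also have "\<dots> = ennreal (?r ^ (?n + 1)) * (ennreal (?r powr a * \<bar>h \<nu>\<bar> * (1 / ?r) ^ ?n * (1 / ?r) ^ j) * ext_moment a \<alpha>)"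
    unfolding ext_moment_def by (subst nn_integral_cmult) auto
  also have "\<dots> = ennreal (\<bar>h \<nu>\<bar> * ?r powr (a - m) * ?r ^ (m + 1 - j)) * ext_moment a \<alpha>"
  proof -
    have "?r ^ (?n + 1) * (?r powr a * \<bar>h \<nu>\<bar> * (1 / ?r) ^ ?n * (1 / ?r) ^ j) = \<bar>h \<nu>\<bar> * (?r powr a * ?r / ?r ^ j)"
      using r by (simp add: power_one_over field_simps)
    also have "?r powr a * ?r / ?r ^ j = ?r powr (a - m) * ?r ^ (m + 1 - j)"
    proof -
      have "?r ^ (m + 1) = ?r ^ (m + 1 - j) * ?r ^ j" using j(2) by (simp flip: power_add)
      moreover have "?r powr a = ?r powr (a - m) * ?r ^ m"
        using r by (simp add: powr_diff powr_realpow)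
      ultimately show ?thesis using r by (simp add: field_simps)
    qed
    finally have eq: "?r ^ (?n + 1) * (?r powr a * \<bar>h \<nu>\<bar> * (1 / ?r) ^ ?n * (1 / ?r) ^ j)
      = \<bar>h \<nu>\<bar> * (?r powr (a - m) * ?r ^ (m + 1 - j))" .
    have "ennreal (?r ^ (?n + 1)) * (ennreal (?r powr a * \<bar>h \<nu>\<bar> * (1 / ?r) ^ ?n * (1 / ?r) ^ j) * ext_moment a \<alpha>)
      = ennreal (?r ^ (?n + 1) * (?r powr a * \<bar>h \<nu>\<bar> * (1 / ?r) ^ ?n * (1 / ?r) ^ j)) * ext_moment a \<alpha>"
      using r by (subst ennreal_mult) (auto simp only: mult.assoc intro!: mult_nonneg_nonneg, auto)
    then show ?thesis unfolding eq by (simp only: mult.assoc)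
  qed
  also have "\<dots> \<le> ennreal (\<bar>h \<nu>\<bar> * ?r powr (a - m) * R ^ (m + 1)) * ext_moment a \<alpha>"
  proof (intro mult_right_mono ennreal_leI mult_left_mono)
    have "?r ^ (m + 1 - j) \<le> R ^ (m + 1 - j)" using r by (intro power_mono) auto
    also have "\<dots> \<le> R ^ (m + 1)" using R by (intro power_increasing) auto
    finally show "?r ^ (m + 1 - j) \<le> R ^ (m + 1)" .
  qed (use r in auto)
  also have "\<dots> = ennreal (\<bar>h \<nu>\<bar> * r \<nu> powr (a - m)) * (ennreal (R ^ (m + 1)) * ext_moment a \<alpha>)"
    using R by (simp add: ennreal_mult mult.assoc)
  finally show ?thesis .
qed

text \<open>Summing the moments over all multi-indices of order at most m + 1 gives one bound that
  serves every \<alpha>. The weight is continuous and positive on the half-space, hence bounded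
  below on compact subsets.\<close>

sublocale superposition N atom upper_half_space "\<lambda>p. snd p powr a" "m + 1"
  "ennreal (R ^ (m + 1)) * (\<Sum>j\<le>m+1. \<Sum>\<alpha>\<in>multi_indices j. ext_moment a (\<alpha> :: ('a \<times> real) multiset)) * total"
proof unfold_locales
  show "deriv_family (atom \<nu>)" for \<nu>
    unfolding atom_def[abs_def] by (rule deriv_family_scale[OF deriv_family_ext])
  show "open (upper_half_space :: ('a \<times> real) set)" by (rule open_upper_half_space)
  show "(\<lambda>p :: 'a \<times> real. snd p powr a) \<in> borel_measurable borel" by measurable
  show "\<exists>c>0. \<forall>v\<in>K. c \<le> snd v powr a"
    if K: "compact K" "K \<subseteq> upper_half_space" for K :: "('a \<times> real) set"
  proof (cases "K = {}")
    case False
    have "continuous_on K (\<lambda>v. snd v powr a)"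
      using K(2) by (intro continuous_intros) (auto simp: upper_half_space_def)
    from continuous_attains_inf[OF K(1) False this]
    obtain v where v: "v \<in> K" "\<And>w. w \<in> K \<Longrightarrow> snd v powr a \<le> snd w powr a" by blast
    then show ?thesis using K(2) by (intro exI[of _ "snd v powr a"]) (auto simp: upper_half_space_def)
  qed (auto intro: exI[of _ 1])
  show "(\<integral>\<^sup>+\<nu>. (\<integral>\<^sup>+v\<in>upper_half_space. ennreal (snd v powr a * \<bar>atom \<nu> \<alpha> v\<bar>) \<partial>lborel) \<partial>N)
      \<le> ennreal (R ^ (m + 1)) * (\<Sum>j\<le>m+1. \<Sum>\<alpha>\<in>multi_indices j. ext_moment a (\<alpha> :: ('a \<times> real) multiset)) * total"
    if \<alpha>: "\<alpha> \<in> multi_indices j" "j \<le> m + 1" for \<alpha> :: "('a \<times> real) multiset" and j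
  proof -
    have "ext_moment a \<alpha> \<le> (\<Sum>\<alpha>\<in>multi_indices j. ext_moment a (\<alpha> :: ('a \<times> real) multiset))"
      using sum_mono2[OF finite_multi_indices, of "{\<alpha>}" j "ext_moment a"] \<alpha> by simp
    also have "\<dots> \<le> (\<Sum>j\<le>m+1. \<Sum>\<alpha>\<in>multi_indices j. ext_moment a (\<alpha> :: ('a \<times> real) multiset))"
      using sum_mono2[of "{..m+1}" "{j}" "\<lambda>j. \<Sum>\<alpha>\<in>multi_indices j. ext_moment a (\<alpha> :: ('a \<times> real) multiset)"] \<alpha>
      by simp
    finally have le: "ext_moment a \<alpha> \<le> (\<Sum>j\<le>m+1. \<Sum>\<alpha>\<in>multi_indices j. ext_moment a (\<alpha> :: ('a \<times> real) multiset))" .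
    have "(\<integral>\<^sup>+\<nu>. (\<integral>\<^sup>+v\<in>upper_half_space. ennreal (snd v powr a * \<bar>atom \<nu> \<alpha> v\<bar>) \<partial>lborel) \<partial>N)
        \<le> (\<integral>\<^sup>+\<nu>. ennreal (\<bar>h \<nu>\<bar> * r \<nu> powr (a - m)) * (ennreal (R ^ (m + 1)) * ext_moment a \<alpha>) \<partial>N)"
      by (intro nn_integral_mono atom_integral_le[OF \<alpha>])
    also have "\<dots> = ennreal (R ^ (m + 1)) * ext_moment a \<alpha> * total"
      unfolding total_def by (subst nn_integral_multc) (auto simp: mult_ac)
    also have "\<dots> \<le> ennreal (R ^ (m + 1)) * (\<Sum>j\<le>m+1. \<Sum>\<alpha>\<in>multi_indices j. ext_moment a (\<alpha> :: ('a \<times> real) multiset)) * total"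
      by (intro mult_right_mono mult_left_mono le) auto
    finally show ?thesis .
  qed
  show "ennreal (R ^ (m + 1)) * (\<Sum>j\<le>m+1. \<Sum>\<alpha>\<in>multi_indices j. ext_moment a (\<alpha> :: ('a \<times> real) multiset)) * total < \<infinity>"
  proof -
    have "(\<Sum>j\<le>m+1. \<Sum>\<alpha>\<in>multi_indices j. ext_moment a (\<alpha> :: ('a \<times> real) multiset)) < \<infinity>"
      by (simp add: less_top[symmetric] ext_moment_finite[OF a(1), THEN less_imp_neq, simplified]
          finite_multi_indices)
    then show ?thesis using total_finite by (simp add: ennreal_mult_less_top total_def)
  qed
qed (auto)

lemma norm_bound:
  "sobolev_norm upper_half_space (\<lambda>p. snd p powr a) (m + 1) (integrated {#})
    \<le> of_nat (1 + (\<Sum>j=1..m+1. card (words j :: ('a \<times> real) list set))) *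
      (ennreal (R ^ (m + 1)) * (\<Sum>j\<le>m+1. \<Sum>\<alpha>\<in>multi_indices j. ext_moment a (\<alpha> :: ('a \<times> real) multiset)) * total)"
  by (rule sobolev_norm_integrated_le)

section \<open>The slices of the superposition and their limit at t = 0\<close>

definition base :: "'a \<Rightarrow> real" where
  "base x = (\<integral>\<nu>. h \<nu> * (1 / r \<nu>) ^ DIM('a) * mollifier ((y \<nu> - x) /\<^sub>R r \<nu>) \<partial>N)"

lemma atom_empty:
  "atom \<nu> {#} (x, t) = h \<nu> * (1 / r \<nu>) ^ DIM('a) * mollifier ((y \<nu> - x) /\<^sub>R r \<nu>) * cutoff (- t / r \<nu>)"
  by (simp add: atom_def ext_family_empty divide_inverse mult_ac)

lemma kernel_integral:
  "(\<integral>\<^sup>+x. ennreal ((1 / r \<nu>) ^ DIM('a) * mollifier ((y \<nu> - x) /\<^sub>R r \<nu>)) \<partial>lborel) = 1"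
proof -
  have r: "0 < r \<nu>" by (rule r_pos)
  have "(\<integral>\<^sup>+x. ennreal ((1 / r \<nu>) ^ DIM('a) * mollifier ((y \<nu> - x) /\<^sub>R r \<nu>)) \<partial>lborel)
      = ennreal (\<bar>- r \<nu>\<bar> ^ DIM('a)) * (\<integral>\<^sup>+x. ennreal ((1 / r \<nu>) ^ DIM('a) *
          mollifier ((y \<nu> - (y \<nu> + (- r \<nu>) *\<^sub>R x)) /\<^sub>R r \<nu>)) \<partial>lborel)"
    by (rule nn_integral_lborel_affine) (use r in auto)
  also have "\<dots> = ennreal (r \<nu> ^ DIM('a)) * (\<integral>\<^sup>+x. ennreal ((1 / r \<nu>) ^ DIM('a)) * ennreal (mollifier (x :: 'a)) \<partial>lborel)"
    using r by (simp add: ennreal_mult mollifier_nonneg)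
  also have "\<dots> = ennreal (r \<nu> ^ DIM('a)) * ennreal ((1 / r \<nu>) ^ DIM('a))"
    by (subst nn_integral_cmult) (auto simp: nn_integral_mollifier)
  also have "\<dots> = 1" using r by (simp add: ennreal_mult[symmetric] power_one_over)
  finally show ?thesis .
qed

text \<open>Tonelli, each kernel having integral 1 in x. The weight \<open>q\<close> is later 1, a
  cutoff value, its complement to 1, or the indicator of a tail of indices.\<close>

lemma weighted_kernel_integral:
  assumes [measurable]: "q \<in> borel_measurable N" and q: "\<And>\<nu>. 0 \<le> q \<nu>"
  shows "(\<integral>\<^sup>+x. \<integral>\<^sup>+\<nu>. ennreal \<bar>h \<nu> * (1 / r \<nu>) ^ DIM('a) * mollifier ((y \<nu> - x) /\<^sub>R r \<nu>) * q \<nu>\<bar> \<partial>N \<partial>lborel)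
    = (\<integral>\<^sup>+\<nu>. ennreal (\<bar>h \<nu>\<bar> * q \<nu>) \<partial>N)"
proof -
  interpret L: pair_sigma_finite N "lborel :: 'a measure" ..
  have "(\<integral>\<^sup>+x. \<integral>\<^sup>+\<nu>. ennreal \<bar>h \<nu> * (1 / r \<nu>) ^ DIM('a) * mollifier ((y \<nu> - x) /\<^sub>R r \<nu>) * q \<nu>\<bar> \<partial>N \<partial>lborel)
    = (\<integral>\<^sup>+\<nu>. \<integral>\<^sup>+x. ennreal \<bar>h \<nu> * (1 / r \<nu>) ^ DIM('a) * mollifier ((y \<nu> - x) /\<^sub>R r \<nu>) * q \<nu>\<bar> \<partial>lborel \<partial>N)"
    by (rule L.Fubini') measurable
  also have "\<dots> = (\<integral>\<^sup>+\<nu>. \<integral>\<^sup>+x. ennreal (\<bar>h \<nu>\<bar> * q \<nu>) *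
      ennreal ((1 / r \<nu>) ^ DIM('a) * mollifier ((y \<nu> - x) /\<^sub>R r \<nu>)) \<partial>lborel \<partial>N)"
    by (intro nn_integral_cong)
      (simp add: ennreal_mult[symmetric] abs_mult q mollifier_nonneg r_pos less_imp_le mult_ac)
  also have "\<dots> = (\<integral>\<^sup>+\<nu>. ennreal (\<bar>h \<nu>\<bar> * q \<nu>) \<partial>N)"
    by (subst nn_integral_cmult) (auto simp: kernel_integral)
  finally show ?thesis .
qed

lemma weighted_slice_le:
  assumes [measurable]: "q \<in> borel_measurable N" and q: "\<And>\<nu>. 0 \<le> q \<nu>"
  shows "L1_norm (\<lambda>x. \<integral>\<nu>. h \<nu> * (1 / r \<nu>) ^ DIM('a) * mollifier ((y \<nu> - x) /\<^sub>R r \<nu>) * q \<nu> \<partial>N)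
    \<le> (\<integral>\<^sup>+\<nu>. ennreal (\<bar>h \<nu>\<bar> * q \<nu>) \<partial>N)"
  unfolding L1_norm_lborel weighted_kernel_integral[OF assms, symmetric]
  by (intro nn_integral_mono ennreal_abs_integral_le)

text \<open>As r <= R and a - m <= 0, the factor r powr (a - m) is bounded below by R powr (a - m),
  so finite cost implies finite total mass.\<close>

lemma weight_integrable: "(\<integral>\<^sup>+\<nu>. ennreal \<bar>h \<nu>\<bar> \<partial>N) < \<infinity>"
proof -
  have "(\<integral>\<^sup>+\<nu>. ennreal \<bar>h \<nu>\<bar> \<partial>N)
      \<le> (\<integral>\<^sup>+\<nu>. ennreal (R powr (m - a)) * ennreal (\<bar>h \<nu>\<bar> * r \<nu> powr (a - m)) \<partial>N)"
  proof (rule nn_integral_mono)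
    fix \<nu>
    have "1 = R powr (m - a) * R powr (a - m)" using R by (simp flip: powr_add)
    also have "\<dots> \<le> R powr (m - a) * r \<nu> powr (a - m)"
      using a r_pos[of \<nu>] r_le[of \<nu>] by (intro mult_left_mono powr_mono2') auto
    finally have "\<bar>h \<nu>\<bar> * 1 \<le> \<bar>h \<nu>\<bar> * (R powr (m - a) * r \<nu> powr (a - m))" by (rule mult_left_mono) simp
    then show "ennreal \<bar>h \<nu>\<bar> \<le> ennreal (R powr (m - a)) * ennreal (\<bar>h \<nu>\<bar> * r \<nu> powr (a - m))"
      by (simp add: ennreal_mult[symmetric] ennreal_leI mult_ac)
  qed
  also have "\<dots> = ennreal (R powr (m - a)) * (\<integral>\<^sup>+\<nu>. ennreal (\<bar>h \<nu>\<bar> * r \<nu> powr (a - m)) \<partial>N)"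
    by (rule nn_integral_cmult) measurable
  also have "\<dots> < \<infinity>" using total_finite by (simp add: ennreal_mult_less_top)
  finally show ?thesis .
qed

lemma cutoff_measurable [measurable]: "cutoff \<in> borel_measurable borel"
  by (rule borel_measurable_continuous_onI) (use continuous_higher_deriv[OF smooth_cutoff, of UNIV 0] in simp)

lemma AE_integrable_kernel:
  "AE x in lborel. integrable N (\<lambda>\<nu>. h \<nu> * (1 / r \<nu>) ^ DIM('a) * mollifier ((y \<nu> - x) /\<^sub>R r \<nu>))"
proof -
  have "(\<integral>\<^sup>+x. \<integral>\<^sup>+\<nu>. ennreal \<bar>h \<nu> * (1 / r \<nu>) ^ DIM('a) * mollifier ((y \<nu> - x) /\<^sub>R r \<nu>)\<bar> \<partial>N \<partial>lborel) \<noteq> \<infinity>"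
    using weighted_kernel_integral[of "\<lambda>_. 1"] weight_integrable by simp
  then have "AE x in lborel. (\<integral>\<^sup>+\<nu>. ennreal \<bar>h \<nu> * (1 / r \<nu>) ^ DIM('a) * mollifier ((y \<nu> - x) /\<^sub>R r \<nu>)\<bar> \<partial>N) \<noteq> \<infinity>"
    by (intro nn_integral_PInf_AE) measurable
  then show ?thesis
    by eventually_elim (intro integrableI_bounded, auto simp: less_top)
qed

lemma slice_eq:
  "integrated {#} (x, t) = (\<integral>\<nu>. h \<nu> * (1 / r \<nu>) ^ DIM('a) * mollifier ((y \<nu> - x) /\<^sub>R r \<nu>) * cutoff (- t / r \<nu>) \<partial>N)"
  by (simp add: integrated_def atom_empty)

lemma slice_integrable: "integrable lborel (\<lambda>x. integrated {#} (x, t))"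
proof -
  have "L1_norm (\<lambda>x. integrated {#} (x, t)) \<le> (\<integral>\<^sup>+\<nu>. ennreal (\<bar>h \<nu>\<bar> * cutoff (- t / r \<nu>)) \<partial>N)"
    unfolding slice_eq by (rule weighted_slice_le) (auto simp: cutoff_range)
  also have "\<dots> \<le> (\<integral>\<^sup>+\<nu>. ennreal \<bar>h \<nu>\<bar> \<partial>N)"
    by (intro nn_integral_mono ennreal_leI) (simp add: cutoff_range mult_left_le)
  also have "\<dots> < \<infinity>" by (rule weight_integrable)
  finally show ?thesis
    unfolding integrable_lborel_iff_L1_norm
    using measurable_compose[OF _ integrated_measurable, of "\<lambda>x. (x, t)" borel "{#}"] by simp
qed

text \<open>At t = 0 every cutoff equals 1, so the error is a superposition with weights 1 - cutoff.
  The kernel integrals converge only for almost every x, hence the subtraction is carried out almost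
  everywhere.\<close>

lemma slice_error_le:
  "L1_norm (\<lambda>x. integrated {#} (x, t) - base x) \<le> (\<integral>\<^sup>+\<nu>. ennreal (\<bar>h \<nu>\<bar> * (1 - cutoff (- t / r \<nu>))) \<partial>N)"
proof -
  have "L1_norm (\<lambda>x. integrated {#} (x, t) - base x) =
      L1_norm (\<lambda>x. \<integral>\<nu>. h \<nu> * (1 / r \<nu>) ^ DIM('a) * mollifier ((y \<nu> - x) /\<^sub>R r \<nu>) * (1 - cutoff (- t / r \<nu>)) \<partial>N)"
    unfolding L1_norm_lborel
  proof (rule nn_integral_cong_AE)
    show "AE x in lborel. ennreal \<bar>integrated {#} (x, t) - base x\<bar> = ennreal
      \<bar>\<integral>\<nu>. h \<nu> * (1 / r \<nu>) ^ DIM('a) * mollifier ((y \<nu> - x) /\<^sub>R r \<nu>) * (1 - cutoff (- t / r \<nu>)) \<partial>N\<bar>"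
      using AE_integrable_kernel
    proof eventually_elim
      case (elim x)
      have "integrable N (\<lambda>\<nu>. h \<nu> * (1 / r \<nu>) ^ DIM('a) * mollifier ((y \<nu> - x) /\<^sub>R r \<nu>) * cutoff (- t / r \<nu>))"
        by (rule Bochner_Integration.integrable_bound[OF elim])
          (auto simp: abs_mult cutoff_range mult_left_le)
      then show ?case
        using elim by (simp add: slice_eq base_def right_diff_distrib abs_minus_commute)
    qed
  qed
  also have "\<dots> \<le> (\<integral>\<^sup>+\<nu>. ennreal (\<bar>h \<nu>\<bar> * (1 - cutoff (- t / r \<nu>))) \<partial>N)"
    by (rule weighted_slice_le) (auto simp: cutoff_range)
  finally show ?thesis .
qed

text \<open>The scales have no positive lower bound, so convergence is not uniform in \<nu>. For
  fixed \<nu> the integrand is 0 as soon as t < r / 2, and |h| is an integrable majorant.\<close>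

lemma slice_error_tendsto:
  "((\<lambda>t. \<integral>\<^sup>+\<nu>. ennreal (\<bar>h \<nu>\<bar> * (1 - cutoff (- t / r \<nu>))) \<partial>N) \<longlongrightarrow> 0) (at_right 0)"
  unfolding tendsto_at_iff_sequentially comp_def
proof (intro allI impI)
  fix X :: "nat \<Rightarrow> real" assume X: "\<forall>i. X i \<in> {0<..} - {0}" "X \<longlonglongrightarrow> 0"
  have "(\<lambda>i. \<integral>\<^sup>+\<nu>. ennreal (\<bar>h \<nu>\<bar> * (1 - cutoff (- X i / r \<nu>))) \<partial>N) \<longlonglongrightarrow> (\<integral>\<^sup>+\<nu>. 0 \<partial>N)"
  proof (rule nn_integral_dominated_convergence[where w="\<lambda>\<nu>. ennreal \<bar>h \<nu>\<bar>"])
    show "AE \<nu> in N. ennreal (\<bar>h \<nu>\<bar> * (1 - cutoff (- X i / r \<nu>))) \<le> ennreal \<bar>h \<nu>\<bar>" for i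
      by (intro AE_I2 ennreal_leI) (simp add: cutoff_range mult_left_le)
    show "AE \<nu> in N. (\<lambda>i. ennreal (\<bar>h \<nu>\<bar> * (1 - cutoff (- X i / r \<nu>)))) \<longlonglongrightarrow> 0"
    proof (rule AE_I2)
      fix \<nu>
      have "\<forall>\<^sub>F i in sequentially. X i < r \<nu> / 2"
        using X(2) r_pos[of \<nu>] by (intro order_tendstoD) auto
      then have "\<forall>\<^sub>F i in sequentially. ennreal (\<bar>h \<nu>\<bar> * (1 - cutoff (- X i / r \<nu>))) = 0"
      proof eventually_elim
        case (elim i)
        then have "- X i / r \<nu> \<ge> - 1/2" using r_pos[of \<nu>] by (simp add: field_simps)
        then show ?case by (simp add: cutoff_eq_1)
      qed
      then show "(\<lambda>i. ennreal (\<bar>h \<nu>\<bar> * (1 - cutoff (- X i / r \<nu>)))) \<longlonglongrightarrow> 0"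
        by (rule tendsto_eventually)
    qed
    show "(\<integral>\<^sup>+\<nu>. ennreal \<bar>h \<nu>\<bar> \<partial>N) < \<infinity>" by (rule weight_integrable)
  qed auto
  then show "(\<lambda>i. \<integral>\<^sup>+\<nu>. ennreal (\<bar>h \<nu>\<bar> * (1 - cutoff (- X i / r \<nu>))) \<partial>N) \<longlonglongrightarrow> 0" by simp
qed

lemma has_trace_integrated:
  assumes f: "integrable lebesgue f" and eq: "AE x in lebesgue. base x = f x"
  shows "has_trace (integrated {#}) f"
  unfolding has_trace_def
proof (intro conjI allI impI)
  show "locally_integrable UNIV f"
    unfolding locally_integrable_def set_integrable_def
  proof (intro allI impI)
    fix K :: "'a set" assume "compact K \<and> K \<subseteq> UNIV"
    then have "K \<in> sets lebesgue" by (simp add: compact_imp_closed borel_closed)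
    then show "integrable lebesgue (\<lambda>x. indicator K x *\<^sub>R f x)"
      using f by (rule integrable_mult_indicator)
  qed
  fix K :: "'a set" assume K: "compact K"
  then have Kb: "K \<in> sets borel" by (simp add: compact_imp_closed borel_closed)
  have "set_integrable lebesgue K (\<lambda>x. integrated {#} (x, t))" for t
    unfolding set_integrable_def
    using Kb slice_integrable[of t] by (intro integrable_mult_indicator) (auto simp: integrable_completion)
  then show "\<forall>\<^sub>F t in at_right 0. set_integrable lebesgue K (\<lambda>x. integrated {#} (x, t))" by simp
  have le: "(\<integral>\<^sup>+x\<in>K. ennreal \<bar>integrated {#} (x, t) - f x\<bar> \<partial>lebesgue)
      \<le> (\<integral>\<^sup>+\<nu>. ennreal (\<bar>h \<nu>\<bar> * (1 - cutoff (- t / r \<nu>))) \<partial>N)" for t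
  proof -
    have "(\<integral>\<^sup>+x\<in>K. ennreal \<bar>integrated {#} (x, t) - f x\<bar> \<partial>lebesgue)
        \<le> L1_norm (\<lambda>x. integrated {#} (x, t) - base x)"
      unfolding L1_norm_def
      by (rule nn_integral_mono_AE) (use eq in eventually_elim, auto simp: indicator_def)
    also note slice_error_le
    finally show ?thesis .
  qed
  show "((\<lambda>t. \<integral>\<^sup>+x\<in>K. ennreal \<bar>integrated {#} (x, t) - f x\<bar> \<partial>lebesgue) \<longlongrightarrow> 0) (at_right 0)"
    by (rule tendsto_sandwich[OF _ _ tendsto_const slice_error_tendsto])
      (intro always_eventually allI zero_le le)+
qed

end

section \<open>Extensions from decompositions into mollified functions\<close>

lemma L1_norm_cong_AE:
  assumes "AE x in lborel. f x = g x" shows "L1_norm f = L1_norm g"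
  unfolding L1_norm_lborel by (rule nn_integral_cong_AE) (use assms in eventually_elim, simp)

lemma L1_norm_add_le:
  fixes f g :: "'a::euclidean_space \<Rightarrow> real"
  assumes [measurable]: "f \<in> borel_measurable borel" "g \<in> borel_measurable borel"
  shows "L1_norm (\<lambda>x. f x + g x) \<le> L1_norm f + L1_norm g"
proof -
  have "L1_norm (\<lambda>x. f x + g x) \<le> (\<integral>\<^sup>+x. ennreal \<bar>f x\<bar> + ennreal \<bar>g x\<bar> \<partial>lborel)"
    unfolding L1_norm_lborel
    by (intro nn_integral_mono) (simp flip: ennreal_plus add: ennreal_leI)
  also have "\<dots> = L1_norm f + L1_norm g"
    unfolding L1_norm_lborel by (rule nn_integral_add) measurable
  finally show ?thesis .
qed

lemma L1_norm_uminus: "L1_norm (\<lambda>x. - f x) = L1_norm f"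
  by (simp add: L1_norm_def)

lemma L1_norm_minus_commute: "L1_norm (\<lambda>x. f x - g x) = L1_norm (\<lambda>x. g x - f x)"
  by (simp add: L1_norm_def abs_minus_commute)

lemma L1_norm_diff_le:
  fixes f g :: "'a::euclidean_space \<Rightarrow> real"
  assumes "f \<in> borel_measurable borel" "g \<in> borel_measurable borel"
  shows "L1_norm (\<lambda>x. f x - g x) \<le> L1_norm f + L1_norm g"
  using L1_norm_add_le[OF assms(1), of "\<lambda>x. - g x"] assms by (simp add: L1_norm_uminus)

lemma L1_norm_triangle:
  fixes f g k :: "'a::euclidean_space \<Rightarrow> real"
  assumes [measurable]: "f \<in> borel_measurable borel" "g \<in> borel_measurable borel" "k \<in> borel_measurable borel"
  shows "L1_norm (\<lambda>x. f x - k x) \<le> L1_norm (\<lambda>x. f x - g x) + L1_norm (\<lambda>x. g x - k x)"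
  using L1_norm_add_le[of "\<lambda>x. f x - g x" "\<lambda>x. g x - k x"] by simp

lemma L1_norm_cmult: "L1_norm (\<lambda>x. c * f x) = ennreal \<bar>c\<bar> * L1_norm (f :: 'a::euclidean_space \<Rightarrow> real)"
  if [measurable]: "f \<in> borel_measurable borel"
  by (simp add: L1_norm_lborel abs_mult ennreal_mult nn_integral_cmult)

lemma L1_norm_eq_0_imp_AE:
  fixes f :: "'a::euclidean_space \<Rightarrow> real"
  assumes [measurable]: "f \<in> borel_measurable borel" and 0: "L1_norm f = 0"
  shows "AE x in lborel. f x = 0"
  using 0 unfolding L1_norm_lborel by (subst (asm) nn_integral_0_iff_AE) auto

text \<open>The trace is asserted for all functions that agree with \<open>f\<close> almost everywhere, because the
  construction replaces a Lebesgue measurable function by a Borel measurable one.\<close>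

definition admits_extension :: "nat \<Rightarrow> real \<Rightarrow> ('a::euclidean_space \<Rightarrow> real) \<Rightarrow> ennreal \<Rightarrow> bool" where
  "admits_extension m a f B \<longleftrightarrow> (\<exists>F \<in> half_sobolev_space (m + 1) a.
     (\<forall>f'. integrable lebesgue f' \<longrightarrow> (AE x in lebesgue. f x = f' x) \<longrightarrow> has_trace F f') \<and>
     half_sobolev_norm (m + 1) a F \<le> B)"

text \<open>Convergence is demanded along a single exhaustion \<open>J\<close>. Finite cost with a
  nonpositive exponent makes the series absolutely summable in L1, which fixes its limit.\<close>

definition smear_decomposition ::
  "real \<Rightarrow> ('i \<Rightarrow> 'a::euclidean_space \<Rightarrow> real) \<Rightarrow> ('i \<Rightarrow> real) \<Rightarrow> ('a \<Rightarrow> real) \<Rightarrow> bool" where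
  "smear_decomposition R g \<rho> f \<longleftrightarrow>
     (\<forall>i. integrable lborel (g i)) \<and> (\<forall>i. 0 < \<rho> i \<and> \<rho> i \<le> R) \<and> integrable lborel f \<and>
     (\<exists>J :: nat \<Rightarrow> 'i set. (\<forall>K. finite (J K)) \<and> (\<forall>i. \<forall>\<^sub>F K in sequentially. i \<in> J K) \<and>
        (\<lambda>K. L1_norm (\<lambda>x. f x - (\<Sum>i\<in>J K. smear (\<rho> i) (g i) x))) \<longlonglongrightarrow> 0)"

definition decomposition_cost ::
  "real \<Rightarrow> ('i \<Rightarrow> 'a::euclidean_space \<Rightarrow> real) \<Rightarrow> ('i \<Rightarrow> real) \<Rightarrow> ennreal" where
  "decomposition_cost s g \<rho> = (\<integral>\<^sup>+i. ennreal (\<rho> i powr s) * L1_norm (g i) \<partial>count_space UNIV)"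

text \<open>The exponent is \<open>a - m\<close> because an atom at scale \<open>r\<close> with unit mass has weighted derivatives of
  order \<open>m + 1\<close> of size \<open>r powr (a + 1 - (m + 1))\<close>.\<close>

lemma extension_from_decomposition:
  fixes m :: nat and a R :: real
  assumes a: "-1 < a" "a \<le> m" and R: "1 \<le> R"
  shows "\<exists>C>0. \<forall>(g :: 'i::countable \<Rightarrow> 'a::euclidean_space \<Rightarrow> real) \<rho> f.
    smear_decomposition R g \<rho> f \<longrightarrow> decomposition_cost (a - m) g \<rho> < \<infinity> \<longrightarrow>
    admits_extension m a f (ennreal C * decomposition_cost (a - m) g \<rho>)"
proof -
  let ?S = "\<Sum>j\<le>m+1. \<Sum>\<alpha>\<in>multi_indices j. ext_moment a (\<alpha> :: ('a \<times> real) multiset)"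
  define c where "c = of_nat (1 + (\<Sum>j=1..m+1. card (words j :: ('a \<times> real) list set))) * (ennreal (R ^ (m + 1)) * ?S)"
  have "?S < \<infinity>"
    by (simp add: less_top[symmetric] ext_moment_finite[OF a(1), THEN less_imp_neq, simplified]
          finite_multi_indices)
  then have "c < \<infinity>" unfolding c_def by (simp add: ennreal_mult_less_top of_nat_less_top)
  then obtain C0 where C0: "c = ennreal C0" "0 \<le> C0" by (cases c) auto
  show ?thesis
  \<comment> \<open>\<open>C0\<close> may be 0; adding 1 makes the constant positive.\<close>
  proof (intro exI[of _ "C0 + 1"] conjI allI impI)
    fix g :: "'i \<Rightarrow> 'a \<Rightarrow> real" and \<rho> f
    let ?T = "\<integral>\<^sup>+i. ennreal (\<rho> i powr (a - m)) * L1_norm (g i) \<partial>count_space UNIV"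
    assume dec: "smear_decomposition R g \<rho> f" and cost: "decomposition_cost (a - m) g \<rho> < \<infinity>"
    then have T: "?T < \<infinity>" by (simp add: decomposition_cost_def)
    from dec obtain J where g: "\<forall>i. integrable lborel (g i)" and \<rho>: "\<forall>i. 0 < \<rho> i \<and> \<rho> i \<le> R"
      and f: "integrable lborel f"
      and J: "\<forall>K. finite (J K)" "\<forall>i. \<forall>\<^sub>F K in sequentially. i \<in> J K"
      and lim: "(\<lambda>K :: nat. L1_norm (\<lambda>x. f x - (\<Sum>i\<in>J K. smear (\<rho> i) (g i) x))) \<longlonglongrightarrow> 0"
      unfolding smear_decomposition_def by blast
    have gm[measurable]: "g i \<in> borel_measurable borel" for i
      using borel_measurable_integrable[OF g[rule_format, of i]] by simp
    have [measurable]: "f \<in> borel_measurable borel" using f by auto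
    \<comment> \<open>An index is a pair (i, y) of a term and a centre, and the mass is g_i (y). By
      \<open>smear_eq_kernel\<close>, integrating the kernel over y produces the mollification of
      g_i.\<close>
    define N where "N = count_space (UNIV :: 'i set) \<Otimes>\<^sub>M (lborel :: 'a measure)"
    interpret I: sigma_finite_measure "count_space (UNIV :: 'i set)"
      by (rule sigma_finite_measure_count_space_countable) simp
    interpret P: pair_sigma_finite "count_space (UNIV :: 'i set)" "lborel :: 'a measure" ..
    have hm: "(\<lambda>\<nu>. g (fst \<nu>) (snd \<nu>)) \<in> borel_measurable N"
      unfolding N_def by (rule measurable_pair_measure_countable1) auto
    have ym: "snd \<in> borel_measurable N" unfolding N_def by measurable
    have cm: "(\<lambda>\<nu>. q (fst \<nu>)) \<in> borel_measurable N" for q :: "'i \<Rightarrow> real"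
      unfolding N_def by (rule measurable_compose[OF measurable_fst]) simp
    have weight: "(\<integral>\<^sup>+\<nu>. ennreal (\<bar>g (fst \<nu>) (snd \<nu>)\<bar> * q (fst \<nu>)) \<partial>N)
        = (\<integral>\<^sup>+i. ennreal (q i) * L1_norm (g i) \<partial>count_space UNIV)" if q: "\<And>i. 0 \<le> q i" for q
    proof -
      have "(\<lambda>\<nu>. ennreal (\<bar>g (fst \<nu>) (snd \<nu>)\<bar> * q (fst \<nu>))) \<in> borel_measurable N"
        using hm cm[of q] by measurable
      then have "(\<integral>\<^sup>+\<nu>. ennreal (\<bar>g (fst \<nu>) (snd \<nu>)\<bar> * q (fst \<nu>)) \<partial>N)
          = (\<integral>\<^sup>+i. \<integral>\<^sup>+y. ennreal (\<bar>g i y\<bar> * q i) \<partial>lborel \<partial>count_space UNIV)"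
        unfolding N_def by (subst lborel.nn_integral_fst[symmetric]) auto
      also have "\<dots> = (\<integral>\<^sup>+i. ennreal (q i) * L1_norm (g i) \<partial>count_space UNIV)"
        by (intro nn_integral_cong)
          (simp add: ennreal_mult' q L1_norm_lborel nn_integral_multc mult.commute[of "ennreal (q _)"])
      finally show ?thesis .
    qed
    interpret E: half_space_extension N "\<lambda>\<nu>. g (fst \<nu>) (snd \<nu>)" snd "\<lambda>\<nu>. \<rho> (fst \<nu>)" m a R
    proof
      show "\<exists>A. countable A \<and> A \<subseteq> sets N \<and> \<Union> A = space N \<and> (\<forall>a\<in>A. emeasure N a \<noteq> \<infinity>)"
        unfolding N_def by (rule P.sigma_finite_countable)
      show "(\<integral>\<^sup>+\<nu>. ennreal (\<bar>g (fst \<nu>) (snd \<nu>)\<bar> * \<rho> (fst \<nu>) powr (a - m)) \<partial>N) < \<infinity>"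
        using T by (subst weight) auto
    qed (use hm ym cm \<rho> R a in auto)
    have total: "E.total = ?T" unfolding E.total_def by (subst weight) auto
    have fin: "(\<integral>\<^sup>+i. L1_norm (g i) \<partial>count_space UNIV) < \<infinity>"
      using E.weight_integrable weight[of "\<lambda>_. 1"] by simp
    have baseb[measurable]: "E.base \<in> borel_measurable borel"
    proof -
      have "(\<lambda>(\<nu>, x). g (fst \<nu>) (snd \<nu>) * (1 / \<rho> (fst \<nu>)) ^ DIM('a) * mollifier ((snd \<nu> - x) /\<^sub>R \<rho> (fst \<nu>)))
          \<in> borel_measurable (N \<Otimes>\<^sub>M lborel)"
        using hm ym cm[of \<rho>] by measurable
      from measurable_pair_swap[OF this]
      have "(\<lambda>(x, \<nu>). g (fst \<nu>) (snd \<nu>) * (1 / \<rho> (fst \<nu>)) ^ DIM('a) * mollifier ((snd \<nu> - x) /\<^sub>R \<rho> (fst \<nu>)))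
          \<in> borel_measurable (lborel \<Otimes>\<^sub>M N)" by (simp add: split_beta')
      from E.borel_measurable_lebesgue_integral[OF this]
      show ?thesis by (simp add: E.base_def[abs_def])
    qed
    let ?S = "\<lambda>K x. \<Sum>i\<in>J K. smear (\<rho> i) (g i) x"
    have Sb[measurable]: "?S K \<in> borel_measurable borel" for K by measurable
    \<comment> \<open>The partial sum is the superposition restricted to indices in
      \<open>J K\<close>, so the difference consists of the remaining ones, and each kernel has unit
      mass.\<close>
    have tail: "L1_norm (\<lambda>x. ?S K x - E.base x) \<le>
        (\<integral>\<^sup>+i. ennreal (1 - indicator (J K) i) * L1_norm (g i) \<partial>count_space UNIV)" for K
    proof -
      let ?k = "\<lambda>x \<nu>. g (fst \<nu>) (snd \<nu>) * (1 / \<rho> (fst \<nu>)) ^ DIM('a) * mollifier ((snd \<nu> - x) /\<^sub>R \<rho> (fst \<nu>))"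
      let ?q = "\<lambda>\<nu>. 1 - indicator (J K) (fst \<nu>) :: real"
      have "AE x in lborel. ?S K x - E.base x = - (\<integral>\<nu>. ?k x \<nu> * ?q \<nu> \<partial>N)"
        using E.AE_integrable_kernel
      proof eventually_elim
        case (elim x)
        have i1: "integrable N (\<lambda>\<nu>. ?k x \<nu> * indicator (J K) (fst \<nu>))"
          by (rule Bochner_Integration.integrable_bound[OF elim])
            (use borel_measurable_integrable[OF elim] cm[of "indicator (J K)"] in \<open>auto simp: indicator_def\<close>)
        have "(\<integral>\<nu>. ?k x \<nu> * indicator (J K) (fst \<nu>) \<partial>N)
            = (\<integral>i. \<integral>y. ?k x (i, y) * indicator (J K) i \<partial>lborel \<partial>count_space UNIV)"
          using P.integral_fst'[OF i1[unfolded N_def]] by (simp add: N_def)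
        also have "\<dots> = (\<integral>i. indicator (J K) i * smear (\<rho> i) (g i) x \<partial>count_space UNIV)"
        proof (rule Bochner_Integration.integral_cong[OF refl])
          fix i
          show "(\<integral>y. ?k x (i, y) * indicator (J K) i \<partial>lborel) = indicator (J K) i * smear (\<rho> i) (g i) x"
            by (cases "i \<in> J K") (use \<rho> in \<open>auto simp: smear_eq_kernel mult_ac\<close>)
        qed
        also have "\<dots> = (\<Sum>i | i \<in> UNIV \<and> indicator (J K) i * smear (\<rho> i) (g i) x \<noteq> 0. indicator (J K) i * smear (\<rho> i) (g i) x)"
          by (rule lebesgue_integral_count_space_finite_support)
            (rule finite_subset[OF _ J(1)[rule_format, of K]], auto simp: indicator_def split: if_splits)
        also have "\<dots> = ?S K x"
          by (rule sum.mono_neutral_cong_left) (use J(1) in \<open>auto simp: indicator_def split: if_splits\<close>)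
        finally show ?case
          using elim i1 by (simp add: E.base_def right_diff_distrib)
      qed
      then have "L1_norm (\<lambda>x. ?S K x - E.base x) = L1_norm (\<lambda>x. - (\<integral>\<nu>. ?k x \<nu> * ?q \<nu> \<partial>N))"
        by (rule L1_norm_cong_AE)
      also have "\<dots> = L1_norm (\<lambda>x. \<integral>\<nu>. ?k x \<nu> * ?q \<nu> \<partial>N)" by (rule L1_norm_uminus)
      also have "\<dots> \<le> (\<integral>\<^sup>+\<nu>. ennreal (\<bar>g (fst \<nu>) (snd \<nu>)\<bar> * ?q \<nu>) \<partial>N)"
        by (rule E.weighted_slice_le) (use cm[of "\<lambda>i. 1 - indicator (J K) i"] in \<open>auto simp: indicator_def\<close>)
      also have "\<dots> = (\<integral>\<^sup>+i. ennreal (1 - indicator (J K) i) * L1_norm (g i) \<partial>count_space UNIV)"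
        by (rule weight) (auto simp: indicator_def)
      finally show ?thesis .
    qed
    have tail0: "(\<lambda>K. \<integral>\<^sup>+i. ennreal (1 - indicator (J K) i) * L1_norm (g i) \<partial>count_space UNIV) \<longlonglongrightarrow> (\<integral>\<^sup>+i. 0 \<partial>count_space (UNIV :: 'i set))"
    proof (rule nn_integral_dominated_convergence[where w="\<lambda>i. L1_norm (g i)"])
      show "AE i in count_space UNIV. (\<lambda>K. ennreal (1 - indicator (J K) i) * L1_norm (g i)) \<longlonglongrightarrow> 0"
      proof (rule AE_I2)
        fix i
        have "\<forall>\<^sub>F K in sequentially. ennreal (1 - indicator (J K) i) * L1_norm (g i) = 0"
          using J(2)[rule_format, of i] by eventually_elim simp
        then show "(\<lambda>K. ennreal (1 - indicator (J K) i) * L1_norm (g i)) \<longlonglongrightarrow> 0"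
          by (rule tendsto_eventually)
      qed
      show "AE i in count_space UNIV. ennreal (1 - indicator (J K) i) * L1_norm (g i) \<le> L1_norm (g i)" for K
        by (rule AE_I2) (auto simp: indicator_def)
    qed (use fin in auto)
    \<comment> \<open>The partial sums converge to f by assumption and to \<open>base\<close> by the
      tail estimate.\<close>
    have "L1_norm (\<lambda>x. f x - E.base x) = 0"
    proof -
      have "(\<lambda>K. L1_norm (\<lambda>x. f x - ?S K x) + (\<integral>\<^sup>+i. ennreal (1 - indicator (J K) i) * L1_norm (g i) \<partial>count_space UNIV)) \<longlonglongrightarrow> 0 + 0"
        using lim tail0 by (intro tendsto_add) auto
      moreover have "L1_norm (\<lambda>x. f x - E.base x) \<le> L1_norm (\<lambda>x. f x - ?S K x) +
          (\<integral>\<^sup>+i. ennreal (1 - indicator (J K) i) * L1_norm (g i) \<partial>count_space UNIV)" for K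
        by (rule order_trans[OF L1_norm_triangle[of f "?S K" E.base]]) (auto intro: add_left_mono tail)
      ultimately have "L1_norm (\<lambda>x. f x - E.base x) \<le> 0 + 0"
        by (intro LIMSEQ_le_const) auto
      then show ?thesis by simp
    qed
    then have "AE x in lborel. f x - E.base x = 0"
      by (intro L1_norm_eq_0_imp_AE) measurable
    then have AE: "AE x in lebesgue. f x - E.base x = 0" by (rule AE_completion)
    show "admits_extension m a f (ennreal (C0 + 1) * decomposition_cost (a - m) g \<rho>)"
      unfolding admits_extension_def decomposition_cost_def
    proof (intro bexI[of _ "E.integrated {#}"] conjI allI impI)
      show "has_trace (E.integrated {#}) f'" if "integrable lebesgue f'" "AE x in lebesgue. f x = f' x" for f'
        by (rule E.has_trace_integrated[OF that(1)]) (use AE that(2) in eventually_elim, simp)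
      have "half_sobolev_norm (m + 1) a (E.integrated {#}) \<le> c * ?T"
        using E.norm_bound unfolding total c_def by (simp add: mult.assoc)
      also have "\<dots> \<le> ennreal (C0 + 1) * ?T"
        unfolding C0 by (intro mult_right_mono ennreal_leI) auto
      finally show "half_sobolev_norm (m + 1) a (E.integrated {#}) \<le> ennreal (C0 + 1) * ?T" .
      show "E.integrated {#} \<in> half_sobolev_space (m + 1) a" by (rule E.integrated_in_sobolev_space)
    qed
  qed (use C0 in auto)
qed

section \<open>The critical case\<close>

text \<open>The mollification error tends to 0 with r, while half of a nonzero norm is a fixed
  positive threshold. For norm 0 the scale 1 already works.\<close>

lemma halving_scale:
  fixes u :: "'a::euclidean_space \<Rightarrow> real"
  assumes u: "integrable lborel u"
  shows "\<exists>r. 0 < r \<and> r \<le> 1 \<and> L1_norm (\<lambda>x. u x - smear r u x) \<le> ennreal (1/2) * L1_norm u"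
proof -
  have [measurable]: "u \<in> borel_measurable borel" using u by auto
  obtain c where c: "L1_norm u = ennreal c" "0 \<le> c"
    using u by (cases "L1_norm u") (auto simp: integrable_lborel_iff_L1_norm)
  show ?thesis
  proof (cases "c = 0")
    case True
    have "L1_norm (\<lambda>x. u x - smear 1 u x) \<le> L1_norm u + L1_norm (smear 1 u)"
      by (rule L1_norm_diff_le) measurable
    also have "\<dots> \<le> L1_norm u + L1_norm u" by (intro add_left_mono L1_norm_smear_le) measurable
    finally show ?thesis using True c by (intro exI[of _ 1]) simp
  next
    case False
    then have "c / 2 > 0" using c by simp
    from smear_error_small[OF u this]
    obtain \<delta> where \<delta>: "\<delta> > 0" "\<And>r. 0 < r \<Longrightarrow> r < \<delta> \<Longrightarrow> L1_norm (\<lambda>x. smear r u x - u x) \<le> ennreal (c / 2)"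
      by blast
    define r where "r = min 1 (\<delta> / 2)"
    have r: "0 < r" "r \<le> 1" "r < \<delta>" using \<delta>(1) by (auto simp: r_def)
    have "ennreal (c / 2) = ennreal (1/2) * L1_norm u"
      unfolding c(1) by (subst ennreal_mult[symmetric]) (use c(2) in auto)
    then show ?thesis using \<delta>(2)[OF r(1,3)] r L1_norm_minus_commute[of u "smear r u"] by auto
  qed
qed

definition halving :: "('a::euclidean_space \<Rightarrow> real) \<Rightarrow> real" where
  "halving u = (SOME r. 0 < r \<and> r \<le> 1 \<and> L1_norm (\<lambda>x. u x - smear r u x) \<le> ennreal (1/2) * L1_norm u)"

lemma halving:
  assumes "integrable lborel u"
  shows "0 < halving u" "halving u \<le> 1" "L1_norm (\<lambda>x. u x - smear (halving u) u x) \<le> ennreal (1/2) * L1_norm u"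
  using someI_ex[OF halving_scale[OF assms]] by (auto simp: halving_def)

primrec remainder :: "('a::euclidean_space \<Rightarrow> real) \<Rightarrow> nat \<Rightarrow> 'a \<Rightarrow> real" where
  "remainder f 0 = f"
| "remainder f (Suc k) = (\<lambda>x. remainder f k x - smear (halving (remainder f k)) (remainder f k) x)"

lemma integrable_remainder: "integrable lborel f \<Longrightarrow> integrable lborel (remainder f k)"
  by (induction k) (auto intro!: Bochner_Integration.integrable_diff integrable_smear)

lemma L1_norm_remainder:
  assumes "integrable lborel f"
  shows "L1_norm (remainder f k) \<le> ennreal ((1/2) ^ k) * L1_norm f"
proof (induction k)
  case (Suc k)
  have "L1_norm (remainder f (Suc k)) \<le> ennreal (1/2) * L1_norm (remainder f k)"
    using halving(3)[OF integrable_remainder[OF assms, of k]] by simp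
  also have "\<dots> \<le> ennreal (1/2) * (ennreal ((1/2) ^ k) * L1_norm f)"
    by (intro mult_left_mono Suc.IH) simp
  also have "\<dots> = ennreal ((1/2) ^ Suc k) * L1_norm f"
    by (subst power_Suc, subst ennreal_mult) (simp_all add: mult.assoc)
  finally show ?case .
qed simp

lemma remainder_eq: "f x - (\<Sum>i<K. smear (halving (remainder f i)) (remainder f i) x) = remainder f K x"
  by (induction K) (auto simp: algebra_simps)

lemma nn_integral_geometric:
  "(\<integral>\<^sup>+i. ennreal ((1/2) ^ i) \<partial>count_space (UNIV :: nat set)) = 2"
proof -
  have "(\<lambda>i. (1/2 :: real) ^ i) sums 2" using geometric_sums[of "1/2 :: real"] by simp
  then have "(\<Sum>i. ennreal ((1/2) ^ i)) = ennreal 2" by (intro suminf_ennreal_eq) auto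
  then show ?thesis by (simp add: nn_integral_count_space_nat)
qed

lemma extension_critical:
  fixes m :: nat
  shows "\<exists>C>0. \<forall>f :: 'a::euclidean_space \<Rightarrow> real. f \<in> L1_space \<longrightarrow>
    (\<exists>F \<in> half_sobolev_space (m + 1) (real m). has_trace F f \<and>
       half_sobolev_norm (m + 1) (real m) F \<le> ennreal C * L1_norm f)"
proof -
  obtain C where C: "C > 0" and ext: "\<And>(g :: nat \<Rightarrow> 'a \<Rightarrow> real) \<rho> f.
      smear_decomposition 1 g \<rho> f \<Longrightarrow> decomposition_cost (real m - m) g \<rho> < \<infinity> \<Longrightarrow>
      admits_extension m (real m) f (ennreal C * decomposition_cost (real m - m) g \<rho>)"
    using extension_from_decomposition[of "real m" m 1, where 'i=nat and 'a='a] by auto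
  show ?thesis
  \<comment> \<open>The factor 2 is the sum of the geometric series that bounds the norms of the
    remainders.\<close>
  proof (intro exI[of _ "C * 2"] conjI allI impI)
    fix f0 :: "'a \<Rightarrow> real" assume f0: "f0 \<in> L1_space"
    then have i0: "integrable lebesgue f0" by (simp add: L1_space_def)
    obtain f where fb: "f \<in> borel_measurable borel" and ae: "AE x in lebesgue. f0 x = f x"
      using borel_version[OF borel_measurable_integrable[OF i0]] .
    have "integrable lebesgue f"
      by (rule integrable_cong_AE_imp[OF i0]) (use fb ae in \<open>auto simp: measurable_completion elim: eventually_mono\<close>)
    then have f: "integrable lborel f" using fb by (simp add: integrable_completion)
    have L: "L1_norm f0 = L1_norm f"
      unfolding L1_norm_def by (rule nn_integral_cong_AE) (use ae in eventually_elim, simp)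
    have fin: "L1_norm f < \<infinity>" using f by (simp add: integrable_lborel_iff_L1_norm)
    let ?g = "remainder f" and ?\<rho> = "\<lambda>k. halving (remainder f k)"
    have pos: "0 < ?\<rho> k \<and> ?\<rho> k \<le> 1" for k using halving[OF integrable_remainder[OF f]] by auto
    have "decomposition_cost (real m - m) ?g ?\<rho>
        \<le> (\<integral>\<^sup>+k. ennreal ((1/2) ^ k) * L1_norm f \<partial>count_space UNIV)"
      unfolding decomposition_cost_def
    proof (rule nn_integral_mono)
      fix k
      \<comment> \<open>The exponent is 0, so arbitrarily small scales do not increase the
        cost.\<close>
      have "?\<rho> k powr (real m - m) = 1" using pos[of k] by simp
      then show "ennreal (?\<rho> k powr (real m - m)) * L1_norm (?g k) \<le> ennreal ((1/2) ^ k) * L1_norm f"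
        using L1_norm_remainder[OF f, of k] by simp
    qed
    also have "\<dots> = 2 * L1_norm f" by (subst nn_integral_multc) (auto simp: nn_integral_geometric)
    finally have T: "decomposition_cost (real m - m) ?g ?\<rho> \<le> 2 * L1_norm f" .
    have lim: "(\<lambda>K. L1_norm (\<lambda>x. f x - (\<Sum>i<K. smear (?\<rho> i) (?g i) x))) \<longlonglongrightarrow> 0"
    proof (rule tendsto_sandwich[OF _ _ tendsto_const])
      have "(\<lambda>K. ennreal ((1/2) ^ K)) \<longlonglongrightarrow> ennreal 0"
        by (intro tendsto_ennrealI LIMSEQ_realpow_zero) auto
      then show "(\<lambda>K. ennreal ((1/2) ^ K) * L1_norm f) \<longlonglongrightarrow> 0"
        using ennreal_tendsto_cmult[of "L1_norm f"] fin by (force simp: mult.commute)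
      show "\<forall>\<^sub>F K in sequentially. L1_norm (\<lambda>x. f x - (\<Sum>i<K. smear (?\<rho> i) (?g i) x)) \<le> ennreal ((1/2) ^ K) * L1_norm f"
        unfolding remainder_eq using L1_norm_remainder[OF f] by simp
    qed simp
    have ev: "\<forall>i :: nat. \<forall>\<^sub>F K in sequentially. i \<in> {..<K}"
      by (auto intro: eventually_gt_at_top)
    have "smear_decomposition 1 ?g ?\<rho> f"
      unfolding smear_decomposition_def
      using integrable_remainder[OF f] pos f ev lim by (intro conjI exI[of _ "\<lambda>K. {..<K}"]) auto
    moreover have "decomposition_cost (real m - m) ?g ?\<rho> < \<infinity>"
      by (rule le_less_trans[OF T]) (use fin in \<open>simp add: ennreal_mult_less_top\<close>)
    ultimately obtain F where F: "F \<in> half_sobolev_space (m + 1) (real m)"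
      "\<And>f'. integrable lebesgue f' \<Longrightarrow> (AE x in lebesgue. f x = f' x) \<Longrightarrow> has_trace F f'"
      "half_sobolev_norm (m + 1) (real m) F \<le> ennreal C * decomposition_cost (real m - m) ?g ?\<rho>"
      using ext unfolding admits_extension_def by blast
    show "\<exists>F \<in> half_sobolev_space (m + 1) (real m). has_trace F f0 \<and>
       half_sobolev_norm (m + 1) (real m) F \<le> ennreal (C * 2) * L1_norm f0"
    proof (intro bexI[OF _ F(1)] conjI)
      show "has_trace F f0" by (rule F(2)[OF i0]) (use ae in eventually_elim, simp)
      have "half_sobolev_norm (m + 1) (real m) F \<le> ennreal C * (2 * L1_norm f)"
        by (rule order_trans[OF F(3)]) (intro mult_left_mono T zero_le)
      also have "\<dots> = ennreal (C * 2) * L1_norm f0"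
        using C by (simp add: L ennreal_mult mult.assoc)
      finally show "half_sobolev_norm (m + 1) (real m) F \<le> ennreal (C * 2) * L1_norm f0" .
    qed
  qed (use C in simp)
qed

section \<open>Finite differences and the subcritical case\<close>

lemma sum_binomial_Suc:
  fixes X :: "nat \<Rightarrow> real"
  shows "(\<Sum>j\<le>Suc q. real (Suc q choose j) * X j) = (\<Sum>j\<le>q. real (q choose j) * (X j + X (Suc j)))"
proof -
  have "(\<Sum>j\<le>Suc q. real (Suc q choose j) * X j)
      = X 0 + (\<Sum>j\<le>q. real (q choose j) * X (Suc j) + real (q choose Suc j) * X (Suc j))"
    by (simp add: sum.atMost_Suc_shift distrib_right del: sum.atMost_Suc)
  also have "\<dots> = (X 0 + (\<Sum>j\<le>q. real (q choose Suc j) * X (Suc j))) + (\<Sum>j\<le>q. real (q choose j) * X (Suc j))"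
    by (simp add: sum.distrib)
  also have "X 0 + (\<Sum>j\<le>q. real (q choose Suc j) * X (Suc j)) = (\<Sum>j\<le>Suc q. real (q choose j) * X j)"
    by (simp add: sum.atMost_Suc_shift del: sum.atMost_Suc)
  also have "\<dots> = (\<Sum>j\<le>q. real (q choose j) * X j)" by simp
  finally show ?thesis by (simp add: sum.distrib distrib_left)
qed

lemma fdiff_funpow:
  "(fdiff h ^^ q) f x = (\<Sum>j\<le>q. real (q choose j) * ((-1) ^ (q + j) * f (x + real j *\<^sub>R h)))"
proof (induction q arbitrary: x)
  case (Suc q)
  have "(fdiff h ^^ Suc q) f x = (fdiff h ^^ q) f (x + h) - (fdiff h ^^ q) f x"
    by (simp add: fdiff_def)
  also have "\<dots> = (\<Sum>j\<le>q. real (q choose j) * ((-1) ^ (Suc q + j) * f (x + real j *\<^sub>R h)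
      + (-1) ^ (Suc q + Suc j) * f (x + real (Suc j) *\<^sub>R h)))"
    unfolding Suc.IH
    by (simp add: sum_subtractf[symmetric] algebra_simps scaleR_add_left)
  also have "\<dots> = (\<Sum>j\<le>Suc q. real (Suc q choose j) * ((-1) ^ (Suc q + j) * f (x + real j *\<^sub>R h)))"
    by (rule sum_binomial_Suc[symmetric])
  finally show ?case .
qed simp

text \<open>The coefficient of f (x + (j + 1) h) in f - (-1)^q \<Delta>_h^q f. The index is shifted
  by one because the zeroth binomial term is f itself, which cancels. The values for j >= q are 0,
  which is used when j later runs over all of nat.\<close>

definition approx_coeff :: "nat \<Rightarrow> nat \<Rightarrow> real" where
  "approx_coeff q j = (-1) ^ j * real (q choose Suc j)"

definition approx :: "nat \<Rightarrow> real \<Rightarrow> ('a::euclidean_space \<Rightarrow> real) \<Rightarrow> 'a \<Rightarrow> real" where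
  "approx q r f x = (\<Sum>j<q. approx_coeff q j * smear (real (Suc j) * r) f x)"

lemma fdiff_funpow_approx:
  "(-1) ^ q * (fdiff h ^^ q) f x = f x - (\<Sum>j<q. approx_coeff q j * f (x + real (Suc j) *\<^sub>R h))"
proof -
  have "(-1) ^ q * (fdiff h ^^ q) f x = (\<Sum>j\<le>q. real (q choose j) * ((-1) ^ j * f (x + real j *\<^sub>R h)))"
    unfolding fdiff_funpow sum_distrib_left
    by (intro sum.cong refl) (simp add: power_add flip: power_mult_distrib)
  also have "{..q} = insert 0 (Suc ` {..<q})"
    by (simp add: lessThan_Suc_eq_insert_0[symmetric] lessThan_Suc_atMost)
  also have "(\<Sum>j\<in>insert 0 (Suc ` {..<q}). real (q choose j) * ((-1) ^ j * f (x + real j *\<^sub>R h)))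
      = f x + (\<Sum>j<q. real (q choose Suc j) * ((-1) ^ Suc j * f (x + real (Suc j) *\<^sub>R h)))"
    by (subst sum.insert) (auto simp: sum.reindex)
  also have "\<dots> = f x - (\<Sum>j<q. approx_coeff q j * f (x + real (Suc j) *\<^sub>R h))"
    by (simp add: approx_coeff_def mult_ac flip: sum_negf)
  finally show ?thesis .
qed

lemma approx_measurable [measurable]:
  assumes [measurable]: "f \<in> borel_measurable borel"
  shows "approx q r f \<in> borel_measurable borel"
  unfolding approx_def[abs_def] by measurable

lemma integrable_approx:
  fixes f :: "'a::euclidean_space \<Rightarrow> real"
  assumes "integrable lborel f" shows "integrable lborel (approx q r f)"
  unfolding approx_def[abs_def]
  by (intro Bochner_Integration.integrable_sum integrable_mult_right integrable_smear assms)

lemma L1_norm_sum_le: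
  fixes f :: "'b \<Rightarrow> 'a::euclidean_space \<Rightarrow> real"
  assumes "\<And>i. i \<in> A \<Longrightarrow> f i \<in> borel_measurable borel"
  shows "L1_norm (\<lambda>x. \<Sum>i\<in>A. f i x) \<le> (\<Sum>i\<in>A. L1_norm (f i))"
  using assms
proof (induction A rule: infinite_finite_induct)
  case (insert i A)
  have "L1_norm (\<lambda>x. f i x + (\<Sum>i\<in>A. f i x)) \<le> L1_norm (f i) + L1_norm (\<lambda>x. \<Sum>i\<in>A. f i x)"
    using insert.prems by (intro L1_norm_add_le borel_measurable_sum) auto
  also have "\<dots> \<le> L1_norm (f i) + (\<Sum>i\<in>A. L1_norm (f i))"
    using insert by (intro add_left_mono) auto
  finally show ?case using insert by simp
qed (simp_all add: L1_norm_def)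

definition approx_bound :: "nat \<Rightarrow> real" where
  "approx_bound q = (\<Sum>j<q. \<bar>approx_coeff q j\<bar>)"

lemma L1_norm_approx_le:
  fixes f :: "'a::euclidean_space \<Rightarrow> real"
  assumes [measurable]: "f \<in> borel_measurable borel"
  shows "L1_norm (approx q r f) \<le> ennreal (approx_bound q) * L1_norm f"
proof -
  have "L1_norm (approx q r f) \<le> (\<Sum>j<q. L1_norm (\<lambda>x. approx_coeff q j * smear (real (Suc j) * r) f x))"
    unfolding approx_def[abs_def] by (rule L1_norm_sum_le) measurable
  also have "\<dots> \<le> (\<Sum>j<q. ennreal \<bar>approx_coeff q j\<bar> * L1_norm f)"
    by (intro sum_mono) (simp add: L1_norm_cmult L1_norm_smear_le mult_left_mono)
  also have "\<dots> = ennreal (approx_bound q) * L1_norm f"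
    by (simp add: approx_bound_def sum_distrib_right flip: sum_ennreal)
  finally show ?thesis .
qed

definition approx_error :: "nat \<Rightarrow> ('a::euclidean_space \<Rightarrow> real) \<Rightarrow> real \<Rightarrow> ennreal" where
  "approx_error q f r = (\<integral>\<^sup>+y. ennreal (mollifier y) * L1_norm ((fdiff (r *\<^sub>R y) ^^ q) f) \<partial>lborel)"

text \<open>The error is exactly the \<open>mollifier\<close> average of (-1)^q \<Delta>_(r y)^q f:
  the mollifier has integral 1, and averaging f (x + (j + 1) r y) gives \<open>smear\<close> at
  scale (j + 1) r.\<close>

lemma L1_norm_approx_error_le:
  fixes f :: "'a::euclidean_space \<Rightarrow> real"
  assumes f: "integrable lborel f" and r: "r > 0"
  shows "L1_norm (\<lambda>x. f x - approx q r f x) \<le> approx_error q f r"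
proof -
  have [measurable]: "f \<in> borel_measurable borel" using f by auto
  have eq: "f x - approx q r f x = (\<integral>y. mollifier y * ((-1) ^ q * (fdiff (r *\<^sub>R y) ^^ q) f x) \<partial>lborel)" for x
  proof -
    have i: "integrable lborel (\<lambda>y. mollifier y * f (x + (real (Suc j) * r) *\<^sub>R y))" for j
      using r by (intro integrable_smear_integrand f) auto
    have "(\<integral>y. mollifier y * ((-1) ^ q * (fdiff (r *\<^sub>R y) ^^ q) f x) \<partial>lborel)
        = (\<integral>y. mollifier y * f x - (\<Sum>j<q. approx_coeff q j * (mollifier y * f (x + (real (Suc j) * r) *\<^sub>R y))) \<partial>lborel)"
      by (rule Bochner_Integration.integral_cong)
        (simp_all only: fdiff_funpow_approx, simp add: right_diff_distrib sum_distrib_left mult_ac)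
    also have "\<dots> = f x - (\<Sum>j<q. approx_coeff q j * smear (real (Suc j) * r) f x)"
      using i integrable_mollifier[of "{#} :: 'a multiset"]
      by (subst Bochner_Integration.integral_diff) (simp_all only: smear_def Bochner_Integration.integral_sum
          integrable_mult_right integral_mult_right Bochner_Integration.integrable_sum, simp_all add: integral_mollifier)
    finally show ?thesis by (simp add: approx_def)
  qed
  have "L1_norm (\<lambda>x. f x - approx q r f x) \<le>
      (\<integral>\<^sup>+y. ennreal (mollifier y) * L1_norm (\<lambda>x. (-1) ^ q * (fdiff (r *\<^sub>R y) ^^ q) f x) \<partial>lborel)"
    unfolding eq by (rule L1_norm_average_le) (simp add: fdiff_funpow)
  also have "\<dots> = approx_error q f r"
    by (simp add: approx_error_def L1_norm_def abs_mult power_abs)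
  finally show ?thesis .
qed

text \<open>Fubini applies at every x, not only almost everywhere: one mollifier is bounded by
  \<open>M\<close>, the integral of the translated and dilated |f| does not depend on its centre,
  and the other mollifier has integral 1.\<close>

lemma smear_commute:
  fixes f :: "'a::euclidean_space \<Rightarrow> real"
  assumes f: "integrable lborel f" and r: "r \<noteq> 0" "s \<noteq> 0"
  shows "smear r (smear s f) x = smear s (smear r f) x"
proof -
  have [measurable]: "f \<in> borel_measurable borel" using f by auto
  let ?k = "\<lambda>(y :: 'a) z. mollifier y * (mollifier z * f (x + r *\<^sub>R y + s *\<^sub>R z))"
  obtain M where M: "M \<ge> 0" "\<And>z :: 'a. \<bar>mollifier z\<bar> \<le> M" using mollifier_family_bounded by blast
  have int: "integrable (lborel \<Otimes>\<^sub>M lborel) (\<lambda>(y, z). ?k y z)"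
  proof (rule integrableI_bounded)
    have "(\<integral>\<^sup>+p. ennreal (norm (case p of (y, z) \<Rightarrow> ?k y z)) \<partial>(lborel \<Otimes>\<^sub>M lborel))
        = (\<integral>\<^sup>+y. \<integral>\<^sup>+z. ennreal \<bar>?k y z\<bar> \<partial>lborel \<partial>lborel)"
      by (subst lborel.nn_integral_fst[symmetric]) (auto simp: split_beta')
    also have "\<dots> \<le> (\<integral>\<^sup>+y. \<integral>\<^sup>+z. ennreal (mollifier (y :: 'a)) * (ennreal M * ennreal \<bar>f ((x + r *\<^sub>R y) + s *\<^sub>R z)\<bar>) \<partial>lborel \<partial>lborel)"
    proof (intro nn_integral_mono)
      fix y z :: 'a
      have "\<bar>?k y z\<bar> \<le> mollifier y * (M * \<bar>f (x + r *\<^sub>R y + s *\<^sub>R z)\<bar>)"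
        using M(2)[of z] by (simp add: abs_mult mollifier_nonneg mult_left_mono mult_right_mono)
      then show "ennreal \<bar>?k y z\<bar> \<le> ennreal (mollifier y) * (ennreal M * ennreal \<bar>f (x + r *\<^sub>R y + s *\<^sub>R z)\<bar>)"
        using M(1) by (simp add: ennreal_mult[symmetric] mollifier_nonneg ennreal_leI)
    qed
    also have "\<dots> = (\<integral>\<^sup>+y. ennreal (mollifier (y :: 'a)) * (ennreal M * (\<integral>\<^sup>+z. ennreal \<bar>f ((x + r *\<^sub>R y) + s *\<^sub>R z)\<bar> \<partial>lborel)) \<partial>lborel)"
      by (simp add: nn_integral_cmult)
    also have "\<dots> = (\<integral>\<^sup>+y. ennreal (mollifier (y :: 'a)) * (ennreal M * (\<integral>\<^sup>+z. ennreal \<bar>f (0 + s *\<^sub>R z)\<bar> \<partial>lborel)) \<partial>lborel)"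
    proof -
      have "(\<integral>\<^sup>+z. ennreal \<bar>f (t + s *\<^sub>R z)\<bar> \<partial>lborel) = (\<integral>\<^sup>+z. ennreal \<bar>f (0 + s *\<^sub>R z)\<bar> \<partial>lborel)" for t
      proof -
        have "ennreal (\<bar>s\<bar> ^ DIM('a)) * (\<integral>\<^sup>+z. ennreal \<bar>f (t + s *\<^sub>R z)\<bar> \<partial>lborel)
            = ennreal (\<bar>s\<bar> ^ DIM('a)) * (\<integral>\<^sup>+z. ennreal \<bar>f (0 + s *\<^sub>R z)\<bar> \<partial>lborel)"
          using nn_integral_lborel_affine[of "\<lambda>x. ennreal \<bar>f x\<bar>" s t]
            nn_integral_lborel_affine[of "\<lambda>x. ennreal \<bar>f x\<bar>" s 0] r by simp
        then show ?thesis using r by (subst (asm) ennreal_mult_cancel_left) auto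
      qed
      then show ?thesis by metis
    qed
    also have "\<dots> = ennreal M * (\<integral>\<^sup>+z. ennreal \<bar>f (0 + s *\<^sub>R z)\<bar> \<partial>lborel)"
      by (simp add: nn_integral_multc nn_integral_mollifier)
    also have "\<dots> < \<infinity>"
      using integrable_lborel_affine[OF f r(2), of 0]
      by (simp add: integrable_iff_bounded ennreal_mult_less_top)
    finally show "(\<integral>\<^sup>+p. ennreal (norm (case p of (y, z) \<Rightarrow> ?k y z)) \<partial>(lborel \<Otimes>\<^sub>M lborel)) < \<infinity>" .
  qed measurable
  have "smear r (smear s f) x = (\<integral>y. \<integral>z. ?k y z \<partial>lborel \<partial>lborel)"
    by (simp add: smear_def)
  also have "\<dots> = (\<integral>z. \<integral>y. ?k y z \<partial>lborel \<partial>lborel)"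
    by (rule lborel_pair.Fubini_integral[symmetric]) (rule int)
  also have "\<dots> = smear s (smear r f) x"
    by (simp add: smear_def mult_ac add_ac)
  finally show ?thesis .
qed

lemma smear_sum:
  fixes g :: "nat \<Rightarrow> 'a::euclidean_space \<Rightarrow> real"
  assumes "\<And>i. integrable lborel (g i)" "r \<noteq> 0"
  shows "smear r (\<lambda>x. \<Sum>i<q. c i * g i x) x = (\<Sum>i<q. c i * smear r (g i) x)"
proof -
  have "smear r (\<lambda>x. \<Sum>i<q. c i * g i x) x = (\<integral>y. (\<Sum>i<q. c i * (mollifier y * g i (x + r *\<^sub>R y))) \<partial>lborel)"
    unfolding smear_def by (rule Bochner_Integration.integral_cong) (simp_all add: sum_distrib_left mult_ac)
  also have "\<dots> = (\<Sum>i<q. c i * smear r (g i) x)"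
    using integrable_smear_integrand[OF assms]
    by (subst Bochner_Integration.integral_sum) (simp_all add: smear_def)
  finally show ?thesis .
qed

lemma approx_commute:
  fixes f :: "'a::euclidean_space \<Rightarrow> real"
  assumes f: "integrable lborel f" and rs: "r > 0" "s > 0"
  shows "approx q r (approx q s f) x = approx q s (approx q r f) x"
proof -
  have eq: "approx q r (approx q s f) x = (\<Sum>i<q. \<Sum>j<q. approx_coeff q i * approx_coeff q j *
      smear (real (Suc i) * r) (smear (real (Suc j) * s) f) x)" if "r > 0" "s > 0" for r s
  proof -
    have "smear (real (Suc i) * r) (approx q s f) x =
        (\<Sum>j<q. approx_coeff q j * smear (real (Suc i) * r) (smear (real (Suc j) * s) f) x)" for i
      unfolding approx_def[of q s, abs_def] using that
      by (intro smear_sum integrable_smear f) auto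
    then show ?thesis by (simp add: approx_def[of q r] sum_distrib_left mult.assoc)
  qed
  have "approx q r (approx q s f) x = (\<Sum>j<q. \<Sum>i<q. approx_coeff q i * approx_coeff q j *
      smear (real (Suc i) * r) (smear (real (Suc j) * s) f) x)"
    unfolding eq[OF rs] by (rule sum.swap)
  also have "\<dots> = approx q s (approx q r f) x"
    unfolding eq[OF rs(2,1)] using rs
    by (intro sum.cong refl) (simp add: smear_commute[OF f] mult_ac)
  finally show ?thesis .
qed

lemma approx_diff:
  fixes f :: "'a::euclidean_space \<Rightarrow> real"
  assumes "integrable lborel f" "integrable lborel g" "r > 0"
  shows "approx q r (\<lambda>x. f x - g x) x = approx q r f x - approx q r g x"
  using assms by (simp add: approx_def smear_diff right_diff_distrib sum_subtractf)

text \<open>Writing \<open>T\<^sub>k = approx q (2 powr (- k))\<close>, the telescoping series of the products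
  \<open>T\<^sub>k T\<^sub>k\<^sub>+\<^sub>1 f\<close> has terms \<open>T\<^sub>k (T\<^sub>k\<^sub>+\<^sub>1 - T\<^sub>k\<^sub>-\<^sub>1) f\<close>, which are mollifications of small functions.\<close>

definition piece :: "nat \<Rightarrow> ('a::euclidean_space \<Rightarrow> real) \<Rightarrow> nat \<Rightarrow> 'a \<Rightarrow> real" where
  "piece q f k = (case k of 0 \<Rightarrow> approx q (1/2) f
     | Suc i \<Rightarrow> (\<lambda>x. approx q ((1/2) ^ (Suc (Suc i))) f x - approx q ((1/2) ^ i) f x))"

lemma integrable_piece: "integrable lborel f \<Longrightarrow> integrable lborel (piece q f k)"
  by (cases k) (auto simp: piece_def intro!: integrable_approx Bochner_Integration.integrable_diff)

text \<open>The subtracted part of term K + 1 is T_(K+1) T_K f, which by commutation is the partial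
  sum T_K T_(K+1) f reached before. The piece at 0 starts the telescope at T_0 T_1 f.\<close>

lemma sum_pieces:
  fixes f :: "'a::euclidean_space \<Rightarrow> real"
  assumes f: "integrable lborel f"
  shows "(\<Sum>k\<le>K. approx q ((1/2) ^ k) (piece q f k) x) = approx q ((1/2) ^ K) (approx q ((1/2) ^ Suc K) f) x"
proof (induction K)
  case 0
  then show ?case by (simp add: piece_def)
next
  case (Suc K)
  have "approx q ((1/2) ^ Suc K) (piece q f (Suc K)) x =
      approx q ((1/2) ^ Suc K) (approx q ((1/2) ^ Suc (Suc K)) f) x
      - approx q ((1/2) ^ Suc K) (approx q ((1/2) ^ K) f) x"
    unfolding piece_def nat.case by (rule approx_diff) (auto intro: integrable_approx f)
  also have "approx q ((1/2) ^ Suc K) (approx q ((1/2) ^ K) f) x = approx q ((1/2) ^ K) (approx q ((1/2) ^ Suc K) f) x"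
    by (rule approx_commute[OF f]) auto
  finally show ?case by (simp only: sum.atMost_Suc Suc.IH)
qed

text \<open>For fixed z at most one summand is nonzero. For that k, 2^k |z| <= n on the support, so
  the power of 2^k is bounded by a multiple of the same power of 1/|z|.\<close>

lemma sum_dyadic_mollifier_le:
  fixes s :: real
  assumes s: "s > 0"
  obtains C where "C > 0" "\<And>z :: 'a::euclidean_space.
    (\<integral>\<^sup>+k. ennreal ((2 ^ k) powr (DIM('a) + s) * mollifier ((2 ^ k) *\<^sub>R z)) \<partial>count_space UNIV)
      \<le> ennreal (C * norm z powr - (DIM('a) + s))"
proof -
  let ?n = "real DIM('a)"
  obtain M where M: "M \<ge> 0" "\<And>z :: 'a. \<bar>mollifier z\<bar> \<le> M" using mollifier_family_bounded by blast
  have "(\<integral>\<^sup>+k. ennreal ((2 ^ k) powr (?n + s) * mollifier ((2 ^ k) *\<^sub>R z)) \<partial>count_space UNIV)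
      \<le> ennreal ((M + 1) * ?n powr (?n + s) * norm z powr - (?n + s))" for z :: 'a
  proof (cases "\<exists>k. mollifier ((2 ^ k) *\<^sub>R z) \<noteq> 0")
    case False
    then show ?thesis by simp
  next
    case True
    then obtain k where k: "mollifier ((2 ^ k) *\<^sub>R z) \<noteq> 0" by blast
    obtain b :: 'a where b: "b \<in> Basis" using nonempty_Basis by blast
    \<comment> \<open>One coordinate decides: 2^k z_b lies in (1/2, 1), and doubling it already
      leaves that interval.\<close>
    have uniq: "j = k" if j: "mollifier ((2 ^ j) *\<^sub>R z) \<noteq> 0" for j
    proof -
      have 1: "1/2 < 2 ^ k * (z \<bullet> b)" "2 ^ k * (z \<bullet> b) < 1" using mollifier_nonzero[OF k b] by auto
      have 2: "1/2 < 2 ^ j * (z \<bullet> b)" "2 ^ j * (z \<bullet> b) < 1" using mollifier_nonzero[OF j b] by auto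
      have zb: "0 < z \<bullet> b"
      proof (rule ccontr)
        assume "\<not> 0 < z \<bullet> b"
        then have "2 ^ k * (z \<bullet> b) \<le> 0" by (intro mult_nonneg_nonpos) auto
        then show False using 1(1) by linarith
      qed
      have False if "i < l" "1/2 < 2 ^ i * (z \<bullet> b)" "2 ^ l * (z \<bullet> b) < 1" for i l :: nat
      proof -
        have "(2::real) ^ Suc i \<le> 2 ^ l" using that(1) by (intro power_increasing) auto
        then have "2 ^ Suc i * (z \<bullet> b) \<le> 2 ^ l * (z \<bullet> b)" using zb by (intro mult_right_mono) auto
        then show False using that by simp
      qed
      then show ?thesis using 1 2 by (metis linorder_neqE_nat)
    qed
    have z: "z \<noteq> 0" using mollifier_nonzero[OF k b] by auto
    have "2 ^ k * norm z \<le> ?n" using mollifier_nonzero_norm_less[OF k] by simp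
    then have "2 ^ k \<le> ?n / norm z" using z by (simp add: field_simps)
    then have "(2 ^ k) powr (?n + s) \<le> (?n / norm z) powr (?n + s)" using s by (intro powr_mono2) auto
    also have "\<dots> = ?n powr (?n + s) * norm z powr - (?n + s)"
      unfolding powr_minus by (subst powr_divide) (simp_all add: divide_inverse)
    finally have le: "(2 ^ k) powr (?n + s) * mollifier ((2 ^ k) *\<^sub>R z) \<le>
        (?n powr (?n + s) * norm z powr - (?n + s)) * (M + 1)"
      using M(2)[of "(2 ^ k) *\<^sub>R z"] by (intro mult_mono) (auto simp: mollifier_nonneg)
    have "(\<integral>\<^sup>+k. ennreal ((2 ^ k) powr (?n + s) * mollifier ((2 ^ k) *\<^sub>R z)) \<partial>count_space UNIV)
        = (\<Sum>k\<in>{k}. ennreal ((2 ^ k) powr (?n + s) * mollifier ((2 ^ k) *\<^sub>R z)))"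
    proof (rule nn_integral_count_space')
      fix j assume "j \<notin> {k}"
      then have "mollifier ((2 ^ j) *\<^sub>R z) = 0" using uniq[of j] by auto
      then show "ennreal ((2 ^ j) powr (?n + s) * mollifier ((2 ^ j) *\<^sub>R z)) = 0" by simp
    qed auto
    also have "\<dots> \<le> ennreal ((M + 1) * ?n powr (?n + s) * norm z powr - (?n + s))"
      using le by (simp add: ennreal_leI mult_ac)
    finally show ?thesis .
  qed
  moreover have "(M + 1) * ?n powr (?n + s) > 0" using M by simp
  ultimately show thesis using that by blast
qed

text \<open>The Besov integral with the order \<open>q\<close> of the difference decoupled from the
  smoothness \<open>s\<close>, since for s > 1 the order used below differs from that in the
  seminorm.\<close>

definition difference_energy :: "nat \<Rightarrow> real \<Rightarrow> ('a::euclidean_space \<Rightarrow> real) \<Rightarrow> ennreal" where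
  "difference_energy q s f = (\<integral>\<^sup>+h. L1_norm ((fdiff h ^^ q) f) / ennreal (norm h powr (real DIM('a) + s)) \<partial>lborel)"

lemma difference_norm_measurable [measurable]:
  fixes f :: "'a::euclidean_space \<Rightarrow> real"
  assumes [measurable]: "f \<in> borel_measurable borel"
  shows "(\<lambda>h. L1_norm ((fdiff h ^^ q) f)) \<in> borel_measurable borel"
proof -
  have "(\<lambda>h. L1_norm ((fdiff h ^^ q) f)) \<in> borel_measurable lborel"
    unfolding L1_norm_lborel fdiff_funpow by measurable
  then show ?thesis by simp
qed

text \<open>Substituting h = 2^(-k) y turns each error into an integral over h with a dilated
  mollifier. Exchanging sum and integral leaves the dyadic sum, which is dominated by the Besov
  kernel |h|^(-n-s).\<close>

lemma sum_approx_error_le: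
  fixes s :: real
  assumes s: "s > 0"
  obtains C where "C > 0" "\<And>f :: 'a::euclidean_space \<Rightarrow> real. f \<in> borel_measurable borel \<Longrightarrow>
    (\<integral>\<^sup>+k. ennreal ((2 ^ k) powr s) * approx_error q f ((1/2) ^ k) \<partial>count_space UNIV)
      \<le> ennreal C * difference_energy q s f"
proof -
  let ?n = "real DIM('a)"
  obtain C where C: "C > 0" "\<And>z :: 'a.
    (\<integral>\<^sup>+k. ennreal ((2 ^ k) powr (?n + s) * mollifier ((2 ^ k) *\<^sub>R z)) \<partial>count_space UNIV)
      \<le> ennreal (C * norm z powr - (?n + s))"
    using sum_dyadic_mollifier_le[OF s] by blast
  interpret I: sigma_finite_measure "count_space (UNIV :: nat set)"
    by (rule sigma_finite_measure_count_space_countable) simp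
  interpret P: pair_sigma_finite "count_space (UNIV :: nat set)" "lborel :: 'a measure" ..
  have "(\<integral>\<^sup>+k. ennreal ((2 ^ k) powr s) * approx_error q f ((1/2) ^ k) \<partial>count_space UNIV)
      \<le> ennreal C * difference_energy q s f" if [measurable]: "f \<in> borel_measurable borel" for f :: "'a \<Rightarrow> real"
  proof -
    let ?w = "\<lambda>h. L1_norm ((fdiff h ^^ q) f)"
    have scale: "approx_error q f ((1/2) ^ k) =
        (\<integral>\<^sup>+z. ennreal ((2 ^ k) powr ?n * mollifier ((2 ^ k) *\<^sub>R z)) * ?w z \<partial>lborel)" for k
    proof -
      have "approx_error q f ((1/2) ^ k) = ennreal (\<bar>2 ^ k\<bar> ^ DIM('a)) *
          (\<integral>\<^sup>+z. ennreal (mollifier (0 + (2 ^ k) *\<^sub>R z)) * ?w ((1/2) ^ k *\<^sub>R (0 + (2 ^ k) *\<^sub>R z)) \<partial>lborel)"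
        unfolding approx_error_def by (rule nn_integral_lborel_affine) auto
      also have "\<dots> = (\<integral>\<^sup>+z. ennreal ((2 ^ k) ^ DIM('a)) * (ennreal (mollifier ((2 ^ k) *\<^sub>R z)) * ?w z) \<partial>lborel)"
        by (subst nn_integral_cmult) (auto simp flip: power_mult_distrib)
      also have "\<dots> = (\<integral>\<^sup>+z. ennreal ((2 ^ k) powr ?n * mollifier ((2 ^ k) *\<^sub>R z)) * ?w z \<partial>lborel)"
        by (simp add: powr_realpow ennreal_mult mollifier_nonneg mult.assoc)
      finally show ?thesis .
    qed
    have "(\<integral>\<^sup>+k. ennreal ((2 ^ k) powr s) * approx_error q f ((1/2) ^ k) \<partial>count_space UNIV)
        = (\<integral>\<^sup>+k. \<integral>\<^sup>+z. ennreal ((2 ^ k) powr (?n + s) * mollifier ((2 ^ k) *\<^sub>R z)) * ?w z \<partial>lborel \<partial>count_space UNIV)"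
    proof (rule nn_integral_cong)
      fix k :: nat
      have "ennreal ((2 ^ k) powr s) * approx_error q f ((1/2) ^ k)
        = (\<integral>\<^sup>+z. ennreal ((2 ^ k) powr s) * (ennreal ((2 ^ k) powr ?n * mollifier ((2 ^ k) *\<^sub>R z)) * ?w z) \<partial>lborel)"
        unfolding scale by (rule nn_integral_cmult[symmetric]) measurable
      also have "\<dots> = (\<integral>\<^sup>+z. ennreal ((2 ^ k) powr (?n + s) * mollifier ((2 ^ k) *\<^sub>R z)) * ?w z \<partial>lborel)"
        by (simp add: powr_add ennreal_mult mollifier_nonneg mult_ac)
      finally show "ennreal ((2 ^ k) powr s) * approx_error q f ((1/2) ^ k) =
          (\<integral>\<^sup>+z. ennreal ((2 ^ k) powr (?n + s) * mollifier ((2 ^ k) *\<^sub>R z)) * ?w z \<partial>lborel)" .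
    qed
    also have "\<dots> = (\<integral>\<^sup>+z. \<integral>\<^sup>+k. ennreal ((2 ^ k) powr (?n + s) * mollifier ((2 ^ k) *\<^sub>R z)) * ?w z \<partial>count_space UNIV \<partial>lborel)"
      by (rule P.Fubini'[symmetric]) (rule measurable_pair_measure_countable1, auto)
    also have "\<dots> = (\<integral>\<^sup>+z. (\<integral>\<^sup>+k. ennreal ((2 ^ k) powr (?n + s) * mollifier ((2 ^ k) *\<^sub>R z)) \<partial>count_space UNIV) * ?w z \<partial>lborel)"
      by (simp add: nn_integral_multc)
    also have "\<dots> \<le> (\<integral>\<^sup>+z. ennreal C * (?w z / ennreal (norm z powr (?n + s))) \<partial>lborel)"
    proof (rule nn_integral_mono)
      fix z :: 'a
      show "(\<integral>\<^sup>+k. ennreal ((2 ^ k) powr (?n + s) * mollifier ((2 ^ k) *\<^sub>R z)) \<partial>count_space UNIV) * ?w z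
          \<le> ennreal C * (?w z / ennreal (norm z powr (?n + s)))"
      proof (cases "z = 0")
        case True
        obtain b :: 'a where b: "b \<in> Basis" using nonempty_Basis by blast
        \<comment> \<open>The Besov kernel is singular at the origin, but there the mollifier
          vanishes at every scale.\<close>
        have "mollifier (0 :: 'a) = 0" using mollifier_nonzero(1)[of 0 b] b by fastforce
        then show ?thesis using True by simp
      next
        case False
        have "(\<integral>\<^sup>+k. ennreal ((2 ^ k) powr (?n + s) * mollifier ((2 ^ k) *\<^sub>R z)) \<partial>count_space UNIV) * ?w z
            \<le> ennreal (C * norm z powr - (?n + s)) * ?w z"
          by (intro mult_right_mono C) simp
        also have "ennreal (C * norm z powr - (?n + s)) = ennreal C * inverse (ennreal (norm z powr (?n + s)))"
          unfolding powr_minus using False C(1) by (simp add: ennreal_mult inverse_ennreal)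
        finally show ?thesis by (simp add: divide_ennreal_def mult_ac)
      qed
    qed
    also have "\<dots> = ennreal C * difference_energy q s f"
      unfolding difference_energy_def by (rule nn_integral_cmult) measurable
    finally show ?thesis .
  qed
  then show thesis using that C by blast
qed

section \<open>Summation of the pieces and the resulting extension\<close>

lemma smear_cmult: "smear r (\<lambda>x. c * f x) x = c * smear r f x"
  by (simp add: smear_def mult.left_commute[of _ c])

lemma ennreal_summable_imp_tendsto_0:
  fixes e :: "nat \<Rightarrow> ennreal"
  assumes "(\<integral>\<^sup>+k. e k \<partial>count_space UNIV) < \<infinity>"
  shows "e \<longlonglongrightarrow> 0"
proof -
  have fin: "(\<Sum>k. e k) \<noteq> top" using assms by (simp add: nn_integral_count_space_nat)
  have "e k \<noteq> top" for k
  proof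
    assume "e k = top"
    moreover have "e k \<le> (\<Sum>k. e k)" using sum_le_suminf[of e "{k}"] by simp
    ultimately show False using fin by (simp add: top_unique)
  qed
  then have e: "e k = ennreal (enn2real (e k))" for k by (simp add: less_top)
  then have "(\<Sum>k. ennreal (enn2real (e k))) \<noteq> top" using fin by simp
  then have "summable (\<lambda>k. enn2real (e k))" by (intro summable_suminf_not_top) auto
  then have "(\<lambda>k. ennreal (enn2real (e k))) \<longlonglongrightarrow> ennreal 0"
    by (intro tendsto_ennrealI summable_LIMSEQ_zero)
  then show ?thesis using e by simp
qed

lemma nn_integral_shift_le:
  fixes e :: "nat \<Rightarrow> ennreal"
  shows "(\<integral>\<^sup>+k. e (Suc k) \<partial>count_space UNIV) \<le> (\<integral>\<^sup>+k. e k \<partial>count_space UNIV)"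
proof -
  have "(\<integral>\<^sup>+k. e (Suc k) \<partial>count_space UNIV) = (\<integral>\<^sup>+k. e k \<partial>count_space (range Suc))"
    by (rule nn_integral_bij_count_space) (simp add: bij_betw_def)
  also have "\<dots> = (\<integral>\<^sup>+k. e k * indicator (range Suc) k \<partial>count_space UNIV)"
    by (rule nn_integral_count_space_indicator) simp
  also have "\<dots> \<le> (\<integral>\<^sup>+k. e k \<partial>count_space UNIV)"
    by (intro nn_integral_mono) (simp add: indicator_def)
  finally show ?thesis .
qed

lemma nn_integral_unshift:
  fixes e :: "nat \<Rightarrow> ennreal"
  shows "(\<integral>\<^sup>+k. (case k of 0 \<Rightarrow> 0 | Suc i \<Rightarrow> e i) \<partial>count_space UNIV) = (\<integral>\<^sup>+k. e k \<partial>count_space UNIV)"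
proof -
  let ?e = "\<lambda>k. case k of 0 \<Rightarrow> 0 | Suc i \<Rightarrow> e i"
  have "(\<integral>\<^sup>+k. e k \<partial>count_space UNIV) = (\<integral>\<^sup>+k. ?e (Suc k) \<partial>count_space UNIV)" by simp
  also have "\<dots> = (\<integral>\<^sup>+k. ?e k \<partial>count_space (range Suc))"
    by (rule nn_integral_bij_count_space) (simp add: bij_betw_def)
  also have "\<dots> = (\<integral>\<^sup>+k. ?e k \<partial>count_space UNIV)"
    by (rule nn_integral_count_space_eq) (auto split: nat.splits)
  finally show ?thesis by simp
qed

text \<open>For k >= 1 the piece is compared with f on both sides, giving the errors at k + 1 and k
  - 1. Shifting the weight 2^(k s) to these indices costs the factors 1 and 2^s; the piece at k = 0
  costs only the norm of f.\<close>

lemma sum_pieces_le: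
  fixes f :: "'a::euclidean_space \<Rightarrow> real" and s :: real and q :: nat
  assumes f: "integrable lborel f" and s: "s > 0"
  defines "E \<equiv> (\<integral>\<^sup>+k. ennreal ((2 ^ k) powr s) * approx_error q f ((1/2) ^ k) \<partial>count_space UNIV)"
  shows "(\<integral>\<^sup>+k. ennreal ((2 ^ k) powr s) * L1_norm (piece q f k) \<partial>count_space UNIV)
    \<le> ennreal (approx_bound q) * L1_norm f + ennreal (2 powr s + 1) * E"
proof -
  have [measurable]: "f \<in> borel_measurable borel" using f by auto
  let ?e = "\<lambda>k. ennreal ((2 ^ k) powr s) * approx_error q f ((1/2) ^ k)"
  let ?b = "\<lambda>k :: nat. ennreal (approx_bound q) * L1_norm f * indicator {0} k
      + (ennreal (2 powr s) * (case k of 0 \<Rightarrow> 0 | Suc i \<Rightarrow> ?e i) + ?e (Suc k))"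
  have "(\<integral>\<^sup>+k. ennreal ((2 ^ k) powr s) * L1_norm (piece q f k) \<partial>count_space UNIV) \<le> (\<integral>\<^sup>+k. ?b k \<partial>count_space UNIV)"
  proof (rule nn_integral_mono)
    fix k :: nat
    show "ennreal ((2 ^ k) powr s) * L1_norm (piece q f k) \<le> ?b k"
    proof (cases k)
      case 0
      then have "ennreal ((2 ^ k) powr s) * L1_norm (piece q f k) \<le> ennreal (approx_bound q) * L1_norm f"
        by (simp add: piece_def L1_norm_approx_le)
      also have "\<dots> \<le> ?b k" using 0 by simp
      finally show ?thesis .
    next
      case (Suc i)
      have "L1_norm (piece q f k) \<le> L1_norm (\<lambda>x. approx q ((1/2) ^ Suc (Suc i)) f x - f x)
          + L1_norm (\<lambda>x. f x - approx q ((1/2) ^ i) f x)"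
        unfolding Suc piece_def nat.case by (rule L1_norm_triangle) measurable
      also have "\<dots> \<le> approx_error q f ((1/2) ^ Suc (Suc i)) + approx_error q f ((1/2) ^ i)"
        by (intro add_mono L1_norm_approx_error_le[OF f])
          (simp_all only: L1_norm_minus_commute[of "approx q _ f" f] zero_less_power zero_less_divide_1_iff
            zero_less_numeral L1_norm_approx_error_le[OF f])
      finally have "ennreal ((2 ^ k) powr s) * L1_norm (piece q f k) \<le>
          ennreal ((2 ^ k) powr s) * (approx_error q f ((1/2) ^ Suc k) + approx_error q f ((1/2) ^ i))"
        unfolding Suc by (rule mult_left_mono) simp
      also have "\<dots> = ennreal ((2 ^ k) powr s) * approx_error q f ((1/2) ^ Suc k)
          + ennreal ((2 ^ k) powr s) * approx_error q f ((1/2) ^ i)"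
        by (rule distrib_left)
      also have "\<dots> \<le> ?e (Suc k) + ennreal (2 powr s) * ?e i"
      proof (intro add_mono mult_right_mono ennreal_leI)
        show "(2 ^ k) powr s \<le> (2 ^ Suc k) powr s" using s by (intro powr_mono2) auto
        have "(2 ^ k) powr s = 2 powr s * (2 ^ i) powr s" by (simp add: Suc powr_mult)
        then show "ennreal ((2 ^ k) powr s) * approx_error q f ((1/2) ^ i) \<le> ennreal (2 powr s) * ?e i"
          by (simp add: ennreal_mult mult.assoc)
      qed simp
      also have "\<dots> = ?b k" by (simp add: Suc add.commute)
      finally show ?thesis .
    qed
  qed
  also have "\<dots> = ennreal (approx_bound q) * L1_norm f
      + (ennreal (2 powr s) * (\<integral>\<^sup>+k. (case k of 0 \<Rightarrow> 0 | Suc i \<Rightarrow> ?e i) \<partial>count_space UNIV)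
         + (\<integral>\<^sup>+k. ?e (Suc k) \<partial>count_space UNIV))"
    by (simp add: nn_integral_add nn_integral_cmult del: power_Suc)
  also have "\<dots> \<le> ennreal (approx_bound q) * L1_norm f + (ennreal (2 powr s) * E + E)"
    unfolding nn_integral_unshift E_def by (intro add_left_mono nn_integral_shift_le)
  also have "\<dots> = ennreal (approx_bound q) * L1_norm f + ennreal (2 powr s + 1) * E"
    by (simp add: ennreal_plus distrib_right)
  finally show ?thesis .
qed

text \<open>Each \<open>T\<^sub>k\<close> is a combination of q mollifications at the scales (j + 1)
  2^(-k), so the pieces form a decomposition indexed by pairs (k, j), whose cost is bounded through
  the dyadic error sum.\<close>

lemma extension_from_differences:
  fixes m q :: nat and a :: real
  assumes a: "-1 < a" "a < m"
  shows "\<exists>C>0. \<forall>f :: 'a::euclidean_space \<Rightarrow> real.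
    integrable lborel f \<longrightarrow> difference_energy q (m - a) f < \<infinity> \<longrightarrow>
    admits_extension m a f (ennreal C * (L1_norm f + difference_energy q (m - a) f))"
proof -
  define s where "s = m - a"
  have s: "s > 0" "a - m = - s" using a by (auto simp: s_def)
  \<comment> \<open>A scale is at most (q + 1) 2^(-k), the capped indices j >= q included.\<close>
  define R where "R = real q + 1"
  obtain C1 where C1: "C1 > 0" and ext: "\<And>(g :: nat \<times> nat \<Rightarrow> 'a \<Rightarrow> real) \<rho> f.
      smear_decomposition R g \<rho> f \<Longrightarrow> decomposition_cost (a - m) g \<rho> < \<infinity> \<Longrightarrow>
      admits_extension m a f (ennreal C1 * decomposition_cost (a - m) g \<rho>)"
    using extension_from_decomposition[of a m R, where 'i="nat \<times> nat" and 'a='a] a by (auto simp: R_def)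
  obtain C2 where C2: "C2 > 0" "\<And>f :: 'a \<Rightarrow> real. f \<in> borel_measurable borel \<Longrightarrow>
    (\<integral>\<^sup>+k. ennreal ((2 ^ k) powr s) * approx_error q f ((1/2) ^ k) \<partial>count_space UNIV)
      \<le> ennreal C2 * difference_energy q s f"
    using sum_approx_error_le[OF s(1)] by blast
  define W where "W = approx_bound q"
  have W: "W \<ge> 0" by (simp add: W_def approx_bound_def sum_nonneg)
  \<comment> \<open>The outer \<open>W\<close> comes from the coefficients of the operator applied
    to each piece, the inner one from the first piece; 1 is added for positivity.\<close>
  define C where "C = C1 * (W * (W + (2 powr s + 1) * C2)) + 1"
  have "0 \<le> C1 * (W * (W + (2 powr s + 1) * C2))" using C1 C2(1) W by simp
  then have C: "C > 0" "C1 * (W * (W + (2 powr s + 1) * C2)) \<le> C" by (simp_all add: C_def)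
  show ?thesis
  proof (intro exI[of _ C] conjI allI impI C)
    fix f :: "'a \<Rightarrow> real" assume f: "integrable lborel f" and en: "difference_energy q (m - a) f < \<infinity>"
    have [measurable]: "f \<in> borel_measurable borel" using f by auto
    let ?D = "difference_energy q s f"
    let ?e = "\<lambda>k. ennreal ((2 ^ k) powr s) * approx_error q f ((1/2) ^ k)"
    let ?E = "\<integral>\<^sup>+k. ?e k \<partial>count_space UNIV"
    have D: "?D < \<infinity>" using en by (simp add: s_def)
    have L: "L1_norm f < \<infinity>" using f by (simp add: integrable_lborel_iff_L1_norm)
    have E: "?E \<le> ennreal C2 * ?D" by (rule C2(2)) measurable
    have Efin: "?E < \<infinity>" by (rule le_less_trans[OF E]) (use D in \<open>simp add: ennreal_mult_less_top\<close>)
    define g where "g i = (\<lambda>x. approx_coeff q (snd i) * piece q f (fst i) x)" for i :: "nat \<times> nat"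
    \<comment> \<open>For j >= q the coefficient in \<open>g\<close> is 0; capping j at q keeps the
      scales of these dummy terms bounded.\<close>
    define \<rho> where "\<rho> i = (real (min (snd i) q) + 1) * (1/2) ^ fst i" for i :: "nat \<times> nat"
    \<comment> \<open>The indices j >= q are included so that the sets exhaust all pairs; their
      terms vanish.\<close>
    define J where "J K = {..K} \<times> {..<q} \<union> {..K} \<times> {q..K}" for K :: nat
    have gi: "integrable lborel (g i)" for i
      unfolding g_def by (intro integrable_mult_right integrable_piece f)
    have \<rho>: "0 < \<rho> i \<and> \<rho> i \<le> R" for i
    proof
      show "0 < \<rho> i" by (simp add: \<rho>_def add_nonneg_pos)
      have "(real (min (snd i) q) + 1) * (1/2) ^ fst i \<le> (real q + 1) * 1"
        by (intro mult_mono) (auto simp: power_le_one)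
      then show "\<rho> i \<le> R" by (simp add: \<rho>_def R_def)
    qed
    let ?T = "decomposition_cost (a - m) g \<rho>"
    have T: "?T \<le> ennreal W * (ennreal W * L1_norm f + ennreal (2 powr s + 1) * (ennreal C2 * ?D))"
    proof -
      have "?T \<le> (\<integral>\<^sup>+i. ennreal ((2 ^ fst i) powr s) * L1_norm (piece q f (fst i)) * ennreal \<bar>approx_coeff q (snd i)\<bar> \<partial>count_space UNIV)"
        unfolding decomposition_cost_def
      proof (rule nn_integral_mono)
        fix i :: "nat \<times> nat"
        \<comment> \<open>The scale is at least 2^(-k) and the exponent is negative, so replacing it
          by 2^(-k) gives an upper bound.\<close>
        have "\<rho> i powr (a - m) \<le> ((1/2) ^ fst i) powr (a - m)"
          unfolding s(2) using s(1) by (intro powr_mono2') (auto simp: \<rho>_def)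
        also have "\<dots> = (2 ^ fst i) powr s"
          unfolding s(2) by (simp add: powr_minus powr_divide power_one_over)
        finally have "ennreal (\<rho> i powr (a - m)) \<le> ennreal ((2 ^ fst i) powr s)" by (rule ennreal_leI)
        moreover have "piece q f (fst i) \<in> borel_measurable borel"
          using integrable_piece[OF f, of q "fst i"] by auto
        then have "L1_norm (g i) = ennreal \<bar>approx_coeff q (snd i)\<bar> * L1_norm (piece q f (fst i))"
          unfolding g_def by (rule L1_norm_cmult)
        ultimately show "ennreal (\<rho> i powr (a - m)) * L1_norm (g i) \<le>
            ennreal ((2 ^ fst i) powr s) * L1_norm (piece q f (fst i)) * ennreal \<bar>approx_coeff q (snd i)\<bar>"
          by (simp add: mult.assoc mult.commute[of "ennreal \<bar>_\<bar>"] mult_right_mono)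
      qed
      also have "\<dots> = (\<integral>\<^sup>+k. \<integral>\<^sup>+j. ennreal ((2 ^ k) powr s) * L1_norm (piece q f k) * ennreal \<bar>approx_coeff q j\<bar> \<partial>count_space UNIV \<partial>count_space UNIV)"
        by (subst nn_integral_fst_count_space[symmetric]) simp
      also have "\<dots> = (\<integral>\<^sup>+k. ennreal ((2 ^ k) powr s) * L1_norm (piece q f k) \<partial>count_space UNIV) *
          (\<integral>\<^sup>+j. ennreal \<bar>approx_coeff q j\<bar> \<partial>count_space UNIV)"
        by (simp add: nn_integral_cmult nn_integral_multc)
      also have "(\<integral>\<^sup>+j. ennreal \<bar>approx_coeff q j\<bar> \<partial>count_space UNIV) = (\<Sum>j<q. ennreal \<bar>approx_coeff q j\<bar>)"
        by (rule nn_integral_count_space') (auto simp: approx_coeff_def)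
      also have "\<dots> = ennreal W" by (simp add: W_def approx_bound_def)
      also have "(\<integral>\<^sup>+k. ennreal ((2 ^ k) powr s) * L1_norm (piece q f k) \<partial>count_space UNIV)
          \<le> ennreal W * L1_norm f + ennreal (2 powr s + 1) * ?E"
        unfolding W_def by (rule sum_pieces_le[OF f s(1)])
      also have "\<dots> \<le> ennreal W * L1_norm f + ennreal (2 powr s + 1) * (ennreal C2 * ?D)"
        by (intro add_left_mono mult_left_mono E) simp
      finally show ?thesis by (simp add: mult.commute mult_right_mono)
    qed
    have Tfin: "?T < \<infinity>"
      by (rule le_less_trans[OF T]) (use D L in \<open>simp add: ennreal_mult_less_top ennreal_add_less_top\<close>)
    have Jf: "finite (J K)" for K by (simp add: J_def)
    have Je: "\<forall>\<^sub>F K in sequentially. i \<in> J K" for i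
    proof -
      have "\<forall>\<^sub>F K in sequentially. fst i \<le> K \<and> snd i \<le> K"
        by (intro eventually_conj eventually_ge_at_top)
      then show ?thesis by eventually_elim (cases i, auto simp: J_def)
    qed
    have partial: "(\<Sum>i\<in>J K. smear (\<rho> i) (g i) x) = approx q ((1/2) ^ K) (approx q ((1/2) ^ Suc K) f) x" for K x
    proof -
      have "(\<Sum>i\<in>J K. smear (\<rho> i) (g i) x) = (\<Sum>i\<in>{..K} \<times> {..<q}. smear (\<rho> i) (g i) x)"
        by (rule sum.mono_neutral_right) (auto simp: J_def g_def smear_cmult approx_coeff_def)
      also have "\<dots> = (\<Sum>k\<le>K. \<Sum>j<q. smear (\<rho> (k, j)) (g (k, j)) x)"
        by (simp add: sum.cartesian_product)
      also have "\<dots> = (\<Sum>k\<le>K. approx q ((1/2) ^ k) (piece q f k) x)"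
        unfolding approx_def by (intro sum.cong refl) (auto simp: \<rho>_def g_def smear_cmult min_def add.commute)
      finally show ?thesis by (simp only: sum_pieces[OF f])
    qed
    \<comment> \<open>The weights 2^(k s) are at least 1, so finiteness of the weighted sum forces
      the errors themselves to 0.\<close>
    have err0: "(\<lambda>K. approx_error q f ((1/2) ^ K)) \<longlonglongrightarrow> 0"
    proof (rule tendsto_sandwich[OF _ _ tendsto_const])
      show "?e \<longlonglongrightarrow> 0" by (rule ennreal_summable_imp_tendsto_0[OF Efin])
      have "approx_error q f ((1/2) ^ K) \<le> ?e K" for K
      proof -
        have "1 \<le> (2 ^ K :: real) powr s" using s(1) by (intro ge_one_powr_ge_zero) auto
        then have "1 * approx_error q f ((1/2) ^ K) \<le> ?e K" by (intro mult_right_mono) auto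
        then show ?thesis by simp
      qed
      then show "\<forall>\<^sub>F K in sequentially. approx_error q f ((1/2) ^ K) \<le> ?e K" by simp
    qed simp
    have lim: "(\<lambda>K. L1_norm (\<lambda>x. f x - (\<Sum>i\<in>J K. smear (\<rho> i) (g i) x))) \<longlonglongrightarrow> 0"
      unfolding partial
    proof (rule tendsto_sandwich[OF _ _ tendsto_const])
      have "(\<lambda>K. approx_error q f ((1/2) ^ K) + ennreal W * approx_error q f ((1/2) ^ Suc K)) \<longlonglongrightarrow> 0 + ennreal W * 0"
        by (intro tendsto_add err0 ennreal_tendsto_cmult LIMSEQ_Suc[OF err0]) simp
      then show "(\<lambda>K. approx_error q f ((1/2) ^ K) + ennreal W * approx_error q f ((1/2) ^ Suc K)) \<longlonglongrightarrow> 0"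
        by simp
      have "L1_norm (\<lambda>x. f x - approx q ((1/2) ^ K) (approx q ((1/2) ^ Suc K) f) x)
          \<le> approx_error q f ((1/2) ^ K) + ennreal W * approx_error q f ((1/2) ^ Suc K)" for K
      proof -
        \<comment> \<open>The error is split as (f - T_K f) + T_K (f - T_(K+1) f), and T_K is
          bounded by \<open>W\<close> on L1.\<close>
        have "L1_norm (\<lambda>x. f x - approx q ((1/2) ^ K) (approx q ((1/2) ^ Suc K) f) x) \<le>
            L1_norm (\<lambda>x. f x - approx q ((1/2) ^ K) f x)
            + L1_norm (\<lambda>x. approx q ((1/2) ^ K) f x - approx q ((1/2) ^ K) (approx q ((1/2) ^ Suc K) f) x)"
          by (rule L1_norm_triangle) measurable
        also have "(\<lambda>x. approx q ((1/2) ^ K) f x - approx q ((1/2) ^ K) (approx q ((1/2) ^ Suc K) f) x)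
            = approx q ((1/2) ^ K) (\<lambda>x. f x - approx q ((1/2) ^ Suc K) f x)"
          by (rule HOL.ext, rule approx_diff[symmetric]) (auto intro: f integrable_approx)
        also have "L1_norm \<dots> \<le> ennreal W * L1_norm (\<lambda>x. f x - approx q ((1/2) ^ Suc K) f x)"
          unfolding W_def by (rule L1_norm_approx_le) measurable
        also have "\<dots> \<le> ennreal W * approx_error q f ((1/2) ^ Suc K)"
          by (intro mult_left_mono L1_norm_approx_error_le f) auto
        also have "L1_norm (\<lambda>x. f x - approx q ((1/2) ^ K) f x) \<le> approx_error q f ((1/2) ^ K)"
          by (intro L1_norm_approx_error_le f) auto
        finally show ?thesis by (simp add: add_mono)
      qed
      then show "\<forall>\<^sub>F K in sequentially. L1_norm (\<lambda>x. f x - approx q ((1/2) ^ K) (approx q ((1/2) ^ Suc K) f) x)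
          \<le> approx_error q f ((1/2) ^ K) + ennreal W * approx_error q f ((1/2) ^ Suc K)" by simp
    qed simp
    have "smear_decomposition R g \<rho> f"
      unfolding smear_decomposition_def using gi \<rho> f Jf Je lim by blast
    from ext[OF this Tfin]
    obtain F where F: "F \<in> half_sobolev_space (m + 1) a"
      "\<forall>f'. integrable lebesgue f' \<longrightarrow> (AE x in lebesgue. f x = f' x) \<longrightarrow> has_trace F f'"
      "half_sobolev_norm (m + 1) a F \<le> ennreal C1 * ?T"
      unfolding admits_extension_def by blast
    show "admits_extension m a f (ennreal C * (L1_norm f + difference_energy q (m - a) f))"
      unfolding admits_extension_def
    proof (intro bexI[OF _ F(1)] conjI F(2))
      let ?U = "L1_norm f + ?D"
      have "ennreal C1 * ?T \<le> ennreal C1 * (ennreal W * (ennreal W * ?U + ennreal (2 powr s + 1) * (ennreal C2 * ?U)))"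
        by (rule mult_left_mono[OF order_trans[OF T]])
          (intro mult_left_mono add_mono order_refl zero_le, auto)
      also have "\<dots> = ennreal (C1 * (W * (W + (2 powr s + 1) * C2))) * ?U"
        using C1 C2(1) W by (simp add: ennreal_mult ennreal_plus algebra_simps)
      also have "\<dots> \<le> ennreal C * ?U" by (intro mult_right_mono ennreal_leI C) simp
      finally show "half_sobolev_norm (m + 1) a F \<le> ennreal C * (L1_norm f + difference_energy q (m - a) f)"
        using order_trans[OF F(3)] by (simp add: s_def)
    qed
  qed
qed

section \<open>Differences of weakly differentiable functions\<close>

lemma frechet_derivative_shift:
  fixes f :: "'a::euclidean_space \<Rightarrow> real"
  shows "frechet_derivative (\<lambda>x. f (x + c)) (at x) = frechet_derivative f (at (x + c))"
proof -
  have "((\<lambda>x. f (x + c)) has_derivative D) (at x) \<longleftrightarrow> (f has_derivative D) (at (x + c))" for D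
  proof
    assume "((\<lambda>x. f (x + c)) has_derivative D) (at x)"
    then have 1: "((\<lambda>x. f (x + c)) has_derivative D) (at ((x + c) - c))" by simp
    have "((\<lambda>x. x - c) has_derivative (\<lambda>h. h)) (at (x + c))" by (auto intro!: derivative_eq_intros)
    from has_derivative_compose[OF this 1] show "(f has_derivative D) (at (x + c))" by simp
  next
    assume 1: "(f has_derivative D) (at (x + c))"
    have "((\<lambda>x. x + c) has_derivative (\<lambda>h. h)) (at x)" by (auto intro!: derivative_eq_intros)
    from has_derivative_compose[OF this 1] show "((\<lambda>x. f (x + c)) has_derivative D) (at x)" by simp
  qed
  then show ?thesis by (simp add: frechet_derivative_def)
qed

lemma partial_deriv_shift:
  fixes f :: "'a::euclidean_space \<Rightarrow> real"
  shows "partial_deriv b (\<lambda>x. f (x - c)) x = partial_deriv b f (x - c)"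
  using frechet_derivative_shift[of f "- c" x] by (simp add: partial_deriv_def)

lemma iter_partial_shift:
  "iter_partial w (\<lambda>x. f (x + c)) = (\<lambda>x. iter_partial w f (x + (c :: 'a::euclidean_space)))"
proof (induction w)
  case (Cons b w)
  have "iter_partial (b # w) (\<lambda>x. f (x + c)) = partial_deriv b (\<lambda>x. iter_partial w f (x + c))"
    using Cons.IH by (simp add: iter_partial_def)
  also have "\<dots> = (\<lambda>x. iter_partial (b # w) f (x + c))"
    by (simp add: partial_deriv_def[abs_def] frechet_derivative_shift iter_partial_def)
  finally show ?case .
qed (simp add: iter_partial_def)

lemma test_function_shift:
  fixes \<psi> :: "'a::euclidean_space \<Rightarrow> real"
  assumes \<psi>: "\<psi> \<in> test_functions UNIV"
  shows "(\<lambda>x. \<psi> (x + c)) \<in> test_functions UNIV"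
proof -
  obtain K where K: "smooth \<psi>" "compact K" "\<And>x. x \<notin> K \<Longrightarrow> \<psi> x = 0"
    using test_functionD[OF \<psi>] by metis
  show ?thesis
  proof (rule test_functionI)
    show "smooth (\<lambda>x. \<psi> (x + c))"
      unfolding smooth_def iter_partial_shift
    proof (intro allI ballI)
      fix k and w :: "'a list" assume "w \<in> words k"
      then have "iter_partial w \<psi> differentiable (at x)" for x
        using smooth_iter_partial(1)[OF K(1), of w x] by (auto simp: words_def)
      then have "(\<lambda>x. iter_partial w \<psi> (x + c)) differentiable (at x)" for x
        by (rule differentiable_compose) (auto intro!: derivative_intros)
      then show "(\<lambda>x. iter_partial w \<psi> (x + c)) differentiable_on UNIV"
        by (simp add: differentiable_on_def)
    qed
    show "compact ((\<lambda>x. x - c) ` K)"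
      by (intro compact_continuous_image K continuous_intros)
    show "\<psi> (x + c) = 0" if "x \<notin> (\<lambda>x. x - c) ` K" for x
    proof (rule K(3), rule)
      assume "x + c \<in> K"
      then have "(x + c) - c \<in> (\<lambda>x. x - c) ` K" by blast
      then show False using that by simp
    qed
  qed auto
qed

lemma test_function_partial_deriv:
  fixes \<psi> :: "'a::euclidean_space \<Rightarrow> real"
  assumes \<psi>: "\<psi> \<in> test_functions \<Omega>" and b: "b \<in> Basis"
  shows "partial_deriv b \<psi> \<in> test_functions \<Omega>"
proof -
  obtain K where K: "smooth \<psi>" "compact K" "K \<subseteq> \<Omega>" "\<And>w x. x \<notin> K \<Longrightarrow> iter_partial w \<psi> x = 0"
    using test_functionD[OF \<psi>] by metis
  have eq: "iter_partial w (partial_deriv b \<psi>) = iter_partial (w @ [b]) \<psi>" for w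
    by (simp add: iter_partial_def)
  show ?thesis
  proof (rule test_functionI[OF _ K(2,3)])
    show "smooth (partial_deriv b \<psi>)"
      unfolding smooth_def eq
    proof (intro allI ballI)
      fix k and w :: "'a list" assume "w \<in> words k"
      then have "w @ [b] \<in> words (Suc k)" using b by (auto simp: words_def)
      then show "iter_partial (w @ [b]) \<psi> differentiable_on UNIV" using K(1) unfolding smooth_def by blast
    qed
    show "partial_deriv b \<psi> x = 0" if "x \<notin> K" for x
      using K(4)[OF that, of "[b]"] by (simp add: iter_partial_def)
  qed
qed

lemma test_function_bounded:
  fixes \<psi> :: "'a::euclidean_space \<Rightarrow> real"
  assumes \<psi>: "\<psi> \<in> test_functions \<Omega>"
  obtains M where "M \<ge> 0" "\<And>x. \<bar>\<psi> x\<bar> \<le> M"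
proof -
  obtain K where K: "smooth \<psi>" "compact K" "\<And>x. x \<notin> K \<Longrightarrow> \<psi> x = 0"
    using test_functionD[OF \<psi>] by metis
  have "continuous_on UNIV \<psi>" using smooth_iter_partial(2)[OF K(1), of "[]"] by (simp add: iter_partial_def)
  from bounded_continuous_compact_support[OF this K(2,3)] that show thesis by blast
qed

lemma test_function_continuous:
  assumes \<psi>: "\<psi> \<in> test_functions \<Omega>"
  shows "continuous_on UNIV \<psi>" "\<psi> \<in> borel_measurable borel" "\<psi> differentiable (at x)"
proof -
  have "smooth \<psi>" using \<psi> by (simp add: test_functions_def)
  from smooth_iter_partial[OF this, of "[]"]
  show "continuous_on UNIV \<psi>" "\<psi> differentiable (at x)" by (simp_all add: iter_partial_def)
  then show "\<psi> \<in> borel_measurable borel" by (intro borel_measurable_continuous_onI)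
qed

text \<open>A global first-order notion for integrable Borel functions, so that Fubini and
  translation invariance of \<open>lborel\<close> apply directly.\<close>

definition weak_partial :: "'a::euclidean_space \<Rightarrow> ('a \<Rightarrow> real) \<Rightarrow> ('a \<Rightarrow> real) \<Rightarrow> bool" where
  "weak_partial b u g \<longleftrightarrow> integrable lborel u \<and> integrable lborel g \<and>
     (\<forall>\<psi>\<in>test_functions UNIV. (\<integral>x. u x * partial_deriv b \<psi> x \<partial>lborel) = - (\<integral>x. g x * \<psi> x \<partial>lborel))"

lemma integrable_mult_bounded:
  fixes u \<zeta> :: "'a::euclidean_space \<Rightarrow> real"
  assumes u: "integrable lborel u" and \<zeta>: "\<zeta> \<in> borel_measurable borel" "\<And>x. \<bar>\<zeta> x\<bar> \<le> M"
  shows "integrable lborel (\<lambda>x. u x * \<zeta> x)"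
proof (rule Bochner_Integration.integrable_bound)
  show "integrable lborel (\<lambda>x. M * u x)" using u by simp
  show "(\<lambda>x. u x * \<zeta> x) \<in> borel_measurable lborel"
    using borel_measurable_integrable[OF u] \<zeta>(1) by simp
  show "AE x in lborel. norm (u x * \<zeta> x) \<le> norm (M * u x)"
  proof (rule AE_I2)
    fix x
    have "\<bar>\<zeta> x\<bar> \<le> \<bar>M\<bar>" using \<zeta>(2)[of x] by linarith
    then have "\<bar>u x\<bar> * \<bar>\<zeta> x\<bar> \<le> \<bar>u x\<bar> * \<bar>M\<bar>" by (rule mult_left_mono) simp
    then show "norm (u x * \<zeta> x) \<le> norm (M * u x)" by (simp add: abs_mult mult.commute)
  qed
qed

lemma integrable_mult_test:
  fixes u :: "'a::euclidean_space \<Rightarrow> real"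
  assumes "integrable lborel u" "\<psi> \<in> test_functions UNIV"
  shows "integrable lborel (\<lambda>x. u x * \<psi> x)"
  using test_function_bounded[OF assms(2)] integrable_mult_bounded[OF assms(1) test_function_continuous(2)[OF assms(2)]]
  by metis

lemma integral_shift_mult:
  fixes u \<zeta> :: "'a::euclidean_space \<Rightarrow> real"
  assumes [measurable]: "u \<in> borel_measurable borel" "\<zeta> \<in> borel_measurable borel"
  shows "(\<integral>x. u (x + h) * \<zeta> x \<partial>lborel) = (\<integral>x. u x * \<zeta> (x - h) \<partial>lborel)"
  using lborel_integral_shift[of "\<lambda>x. u x * \<zeta> (x - h)" h] by simp

text \<open>A translation can be moved onto the test function, which remains one, and it commutes
  with differentiation.\<close>

lemma weak_partial_fdiff:
  assumes wp: "weak_partial b u g" and b: "b \<in> Basis"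
  shows "weak_partial b (fdiff h u) (fdiff h g)"
  unfolding weak_partial_def
proof (intro conjI ballI)
  have u: "integrable lborel u" "integrable lborel g" using wp by (auto simp: weak_partial_def)
  note us = integrable_lborel_shift[OF u(1), of h] integrable_lborel_shift[OF u(2), of h]
  show "integrable lborel (fdiff h u)" "integrable lborel (fdiff h g)"
    using u us by (simp_all add: fdiff_def[abs_def])
  fix \<psi> :: "'a \<Rightarrow> real" assume \<psi>: "\<psi> \<in> test_functions UNIV"
  have \<psi>b: "partial_deriv b \<psi> \<in> test_functions UNIV" by (rule test_function_partial_deriv[OF \<psi> b])
  have \<psi>h: "(\<lambda>x. \<psi> (x + - h)) \<in> test_functions UNIV" by (rule test_function_shift[OF \<psi>])
  have id: "(\<integral>x. u x * partial_deriv b \<psi> x \<partial>lborel) = - (\<integral>x. g x * \<psi> x \<partial>lborel)"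
    if "\<psi> \<in> test_functions UNIV" for \<psi>
    using wp that by (auto simp: weak_partial_def)
  have m: "u \<in> borel_measurable borel" "g \<in> borel_measurable borel" "\<psi> \<in> borel_measurable borel"
    "partial_deriv b \<psi> \<in> borel_measurable borel"
    using borel_measurable_integrable[OF u(1)] borel_measurable_integrable[OF u(2)]
      test_function_continuous(2)[OF \<psi>] test_function_continuous(2)[OF \<psi>b] by simp_all
  have "(\<integral>x. fdiff h u x * partial_deriv b \<psi> x \<partial>lborel)
      = (\<integral>x. u (x + h) * partial_deriv b \<psi> x \<partial>lborel) - (\<integral>x. u x * partial_deriv b \<psi> x \<partial>lborel)"
    using integrable_mult_test[OF us(1) \<psi>b] integrable_mult_test[OF u(1) \<psi>b]
    by (simp add: fdiff_def left_diff_distrib)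
  also have "(\<integral>x. u (x + h) * partial_deriv b \<psi> x \<partial>lborel) = (\<integral>x. u x * partial_deriv b \<psi> (x - h) \<partial>lborel)"
    by (rule integral_shift_mult) (rule m)+
  also have "\<dots> = - (\<integral>x. g x * \<psi> (x - h) \<partial>lborel)"
    using id[OF \<psi>h] by (simp add: partial_deriv_shift)
  also have "(\<integral>x. g x * \<psi> (x - h) \<partial>lborel) = (\<integral>x. g (x + h) * \<psi> x \<partial>lborel)"
    by (rule integral_shift_mult[symmetric]) (rule m)+
  also have "(\<integral>x. u x * partial_deriv b \<psi> x \<partial>lborel) = - (\<integral>x. g x * \<psi> x \<partial>lborel)" by (rule id[OF \<psi>])
  also have "- (\<integral>x. g (x + h) * \<psi> x \<partial>lborel) - - (\<integral>x. g x * \<psi> x \<partial>lborel) = - (\<integral>x. fdiff h g x * \<psi> x \<partial>lborel)"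
    using integrable_mult_test[OF us(2) \<psi>] integrable_mult_test[OF u(2) \<psi>]
    by (simp add: fdiff_def left_diff_distrib)
  finally show "(\<integral>x. fdiff h u x * partial_deriv b \<psi> x \<partial>lborel) = - (\<integral>x. fdiff h g x * \<psi> x \<partial>lborel)" .
qed

lemma weak_partial_fdiff_funpow:
  assumes "weak_partial b u g" "b \<in> Basis"
  shows "weak_partial b ((fdiff h ^^ p) u) ((fdiff h ^^ p) g)"
  by (induction p) (auto intro: weak_partial_fdiff assms)

section \<open>First differences as integrals along segments\<close>

definition segment_mean :: "'a::euclidean_space \<Rightarrow> ('a \<Rightarrow> real) \<Rightarrow> 'a \<Rightarrow> real" where
  "segment_mean h k x = (\<integral>s. indicator {0..1} s * k (x + s *\<^sub>R h) \<partial>lborel)"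

lemma segment_mean_measurable [measurable]:
  assumes [measurable]: "k \<in> borel_measurable borel"
  shows "segment_mean h k \<in> borel_measurable borel"
proof -
  have "(\<lambda>x. \<integral>s. indicator {0..1} s * k (x + s *\<^sub>R h) \<partial>lborel) \<in> borel_measurable lborel" by measurable
  then show ?thesis by (simp add: segment_mean_def[abs_def])
qed

lemma L1_norm_segment_mean_le:
  fixes k :: "'a::euclidean_space \<Rightarrow> real"
  assumes [measurable]: "k \<in> borel_measurable borel"
  shows "L1_norm (segment_mean h k) \<le> L1_norm k"
proof -
  have "L1_norm (segment_mean h k) \<le> (\<integral>\<^sup>+x. \<integral>\<^sup>+s. ennreal \<bar>indicator {0..1} s * k (x + s *\<^sub>R h)\<bar> \<partial>lborel \<partial>lborel)"
    unfolding L1_norm_lborel segment_mean_def by (intro nn_integral_mono ennreal_abs_integral_le)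
  also have "\<dots> = (\<integral>\<^sup>+s. \<integral>\<^sup>+x. ennreal \<bar>indicator {0..1} s * k (x + s *\<^sub>R h)\<bar> \<partial>lborel \<partial>lborel)"
    by (rule lborel_pair.Fubini') measurable
  also have "\<dots> = (\<integral>\<^sup>+s. indicator {0..1} s * L1_norm (\<lambda>x. k (x + s *\<^sub>R h)) \<partial>lborel)"
    by (intro nn_integral_cong) (auto simp: indicator_def L1_norm_lborel)
  also have "\<dots> = L1_norm k"
    by (simp add: L1_norm_shift nn_integral_multc)
  finally show ?thesis .
qed

lemma segment_Fubini:
  fixes p :: "real \<Rightarrow> 'a::euclidean_space \<Rightarrow> real"
  assumes [measurable]: "case_prod p \<in> borel_measurable (lborel \<Otimes>\<^sub>M lborel)"
    and B: "\<And>s. L1_norm (p s) \<le> B" "B < \<infinity>"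
  shows "(\<integral>x. \<integral>s. indicator {0..1} s * p s x \<partial>lborel \<partial>lborel) = (\<integral>s. indicator {0..1} s * (\<integral>x. p s x \<partial>lborel) \<partial>lborel)"
    and "integrable lborel (\<lambda>x. \<integral>s. indicator {0..1} s * p s x \<partial>lborel)"
    and "integrable lborel (\<lambda>s. indicator {0..1} s * (\<integral>x. p s x \<partial>lborel))"
proof -
  have int: "integrable (lborel \<Otimes>\<^sub>M lborel) (\<lambda>(s, x). indicator {0..1} s * p s x)"
  proof (rule integrableI_bounded)
    have "(\<integral>\<^sup>+z. ennreal (norm (case z of (s, x) \<Rightarrow> indicator {0..1} s * p s x)) \<partial>(lborel \<Otimes>\<^sub>M lborel))
        = (\<integral>\<^sup>+s. \<integral>\<^sup>+x. ennreal \<bar>indicator {0..1} s * p s x\<bar> \<partial>lborel \<partial>lborel)"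
      by (subst lborel.nn_integral_fst[symmetric]) (auto simp: split_beta')
    also have "\<dots> = (\<integral>\<^sup>+s. indicator {0..1} s * L1_norm (p s) \<partial>lborel)"
      by (intro nn_integral_cong) (auto simp: indicator_def L1_norm_lborel)
    also have "\<dots> \<le> (\<integral>\<^sup>+s. indicator {0..1 :: real} s * B \<partial>lborel)"
      by (intro nn_integral_mono mult_left_mono B) simp
    also have "\<dots> = B" by (simp add: nn_integral_multc)
    finally show "(\<integral>\<^sup>+z. ennreal (norm (case z of (s, x) \<Rightarrow> indicator {0..1} s * p s x)) \<partial>(lborel \<Otimes>\<^sub>M lborel)) < \<infinity>"
      using B(2) by (rule le_less_trans)
  qed measurable
  show "(\<integral>x. \<integral>s. indicator {0..1} s * p s x \<partial>lborel \<partial>lborel) = (\<integral>s. indicator {0..1} s * (\<integral>x. p s x \<partial>lborel) \<partial>lborel)"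
    using lborel_pair.Fubini_integral[OF int] by simp
  show "integrable lborel (\<lambda>x. \<integral>s. indicator {0..1} s * p s x \<partial>lborel)"
    using lborel_pair.integrable_snd[OF int] .
  show "integrable lborel (\<lambda>s. indicator {0..1} s * (\<integral>x. p s x \<partial>lborel))"
    using lborel_pair.integrable_fst'[OF int] by simp
qed

lemma L1_norm_mult_bounded:
  fixes k \<zeta> :: "'a::euclidean_space \<Rightarrow> real"
  assumes [measurable]: "k \<in> borel_measurable borel" and M: "\<And>x. \<bar>\<zeta> x\<bar> \<le> M"
  shows "L1_norm (\<lambda>x. k x * \<zeta> x) \<le> ennreal M * L1_norm k"
proof -
  have "M \<ge> 0" using M[of undefined] by linarith
  have "L1_norm (\<lambda>x. k x * \<zeta> x) \<le> (\<integral>\<^sup>+x. ennreal M * ennreal \<bar>k x\<bar> \<partial>lborel)"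
    unfolding L1_norm_lborel
  proof (rule nn_integral_mono)
    fix x
    have "\<bar>k x * \<zeta> x\<bar> \<le> M * \<bar>k x\<bar>"
      using mult_left_mono[OF M[of x], of "\<bar>k x\<bar>"] by (simp add: abs_mult mult.commute)
    then show "ennreal \<bar>k x * \<zeta> x\<bar> \<le> ennreal M * ennreal \<bar>k x\<bar>"
      using \<open>M \<ge> 0\<close> by (simp add: ennreal_mult[symmetric] ennreal_leI)
  qed
  also have "\<dots> = ennreal M * L1_norm k" by (simp add: nn_integral_cmult L1_norm_lborel)
  finally show ?thesis .
qed

text \<open>The fundamental theorem of calculus on the segment from x to x - h. The shift is
  backward because, in duality, a forward difference of u becomes a backward difference of the test
  function.\<close>

lemma test_function_line_integral:
  fixes \<psi> :: "'a::euclidean_space \<Rightarrow> real"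
  assumes \<psi>: "\<psi> \<in> test_functions UNIV"
  shows "\<psi> (x - h) - \<psi> x = - (\<Sum>b\<in>Basis. (h \<bullet> b) * (\<integral>s. indicator {0..1} s * partial_deriv b \<psi> (x - s *\<^sub>R h) \<partial>lborel))"
proof -
  have pt: "partial_deriv b \<psi> \<in> test_functions UNIV" if "b \<in> Basis" for b
    using test_function_partial_deriv[OF \<psi> that] .
  have cont: "continuous_on {0..1} (\<lambda>s. partial_deriv b \<psi> (x - s *\<^sub>R h))" if "b \<in> Basis" for b
    by (intro continuous_on_compose2[OF test_function_continuous(1)[OF pt[OF that]]] continuous_intros) auto
  have expand: "frechet_derivative \<psi> (at z) (- h) = (\<Sum>b\<in>Basis. - (h \<bullet> b) * partial_deriv b \<psi> z)" for z
  proof -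
    have lin: "linear (frechet_derivative \<psi> (at z))"
      using test_function_continuous(3)[OF \<psi>] by (rule linear_frechet_derivative)
    have "frechet_derivative \<psi> (at z) (- h) = frechet_derivative \<psi> (at z) (\<Sum>b\<in>Basis. (- h \<bullet> b) *\<^sub>R b)"
      by (simp only: euclidean_representation)
    also have "\<dots> = (\<Sum>b\<in>Basis. (- h \<bullet> b) * partial_deriv b \<psi> z)"
      by (simp add: linear_sum[OF lin] linear_cmul[OF lin] partial_deriv_def del: inner_minus_left)
    finally show ?thesis by simp
  qed
  have "(\<integral>s. (\<Sum>b\<in>Basis. - (h \<bullet> b) * partial_deriv b \<psi> (x - s *\<^sub>R h)) * indicator {0..1} s \<partial>lborel)
      = \<psi> (x + 1 *\<^sub>R (- h)) - \<psi> (x + 0 *\<^sub>R (- h))"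
  proof (rule integral_FTC_Icc_real)
    fix s :: real
    have "((\<lambda>s. \<psi> (x + s *\<^sub>R (- h))) has_real_derivative frechet_derivative \<psi> (at (x + s *\<^sub>R (- h))) (- h)) (at s)"
      by (rule has_real_derivative_line) (rule test_function_continuous(3)[OF \<psi>])
    then show "((\<lambda>s. \<psi> (x + s *\<^sub>R (- h))) has_real_derivative
        (\<Sum>b\<in>Basis. - (h \<bullet> b) * partial_deriv b \<psi> (x - s *\<^sub>R h))) (at s)"
      unfolding expand by simp
    show "isCont (\<lambda>s. \<Sum>b\<in>Basis. - (h \<bullet> b) * partial_deriv b \<psi> (x - s *\<^sub>R h)) s"
    proof -
      have "continuous_on UNIV (\<lambda>s. \<Sum>b\<in>Basis. - (h \<bullet> b) * partial_deriv b \<psi> (x - s *\<^sub>R h))"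
        by (intro continuous_intros continuous_on_compose2[OF test_function_continuous(1)[OF pt]]) auto
      then show ?thesis by (simp add: continuous_on_eq_continuous_at)
    qed
  qed simp
  moreover have "(\<integral>s. (\<Sum>b\<in>Basis. - (h \<bullet> b) * partial_deriv b \<psi> (x - s *\<^sub>R h)) * indicator {0..1} s \<partial>lborel)
      = (\<Sum>b\<in>Basis. - (h \<bullet> b) * (\<integral>s. indicator {0..1} s * partial_deriv b \<psi> (x - s *\<^sub>R h) \<partial>lborel))"
  proof -
    have i: "integrable lborel (\<lambda>s. indicator {0..1} s * partial_deriv b \<psi> (x - s *\<^sub>R h))" if "b \<in> Basis" for b
      using borel_integrable_compact[OF compact_Icc cont[OF that]] by simp
    have "(\<integral>s. (\<Sum>b\<in>Basis. - (h \<bullet> b) * partial_deriv b \<psi> (x - s *\<^sub>R h)) * indicator {0..1} s \<partial>lborel)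
       = (\<integral>s. (\<Sum>b\<in>Basis. - (h \<bullet> b) * (indicator {0..1} s * partial_deriv b \<psi> (x - s *\<^sub>R h))) \<partial>lborel)"
      by (rule Bochner_Integration.integral_cong) (simp_all add: sum_distrib_left sum_distrib_right mult_ac sum_negf)
    also have "\<dots> = (\<Sum>b\<in>Basis. \<integral>s. - (h \<bullet> b) * (indicator {0..1} s * partial_deriv b \<psi> (x - s *\<^sub>R h)) \<partial>lborel)"
      by (rule Bochner_Integration.integral_sum) (intro integrable_mult_right i)
    finally show ?thesis by simp
  qed
  ultimately show ?thesis by (simp add: sum_negf)
qed

text \<open>By duality with test functions, the difference agrees almost everywhere with the
  integral of the directional derivative along the segment. Averaging along a segment does not
  increase the L1 norm, and each coefficient of h is at most |h|.\<close>

lemma L1_norm_fdiff_le: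
  fixes u :: "'a::euclidean_space \<Rightarrow> real"
  assumes wp: "\<And>b. b \<in> Basis \<Longrightarrow> weak_partial b u (g b)"
  shows "L1_norm (fdiff h u) \<le> ennreal (norm h) * (\<Sum>b\<in>Basis. L1_norm (g b))"
proof -
  obtain b0 :: 'a where "b0 \<in> Basis" using nonempty_Basis by blast
  then have u: "integrable lborel u" using wp by (auto simp: weak_partial_def)
  have g: "integrable lborel (g b)" if "b \<in> Basis" for b using wp[OF that] by (simp add: weak_partial_def)
  have um[measurable]: "u \<in> borel_measurable borel" using u by auto
  have gm: "g b \<in> borel_measurable borel" if "b \<in> Basis" for b using borel_measurable_integrable[OF g[OF that]] by simp
  have ufin: "L1_norm u < \<infinity>" and gfin: "b \<in> Basis \<Longrightarrow> L1_norm (g b) < \<infinity>" for b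
    using u g by (auto simp: integrable_lborel_iff_L1_norm)
  \<comment> \<open>The candidate for u (x + h) - u x: the derivative in direction h averaged over
    the segment from x to x + h.\<close>
  define v where "v x = (\<Sum>b\<in>Basis. (h \<bullet> b) * segment_mean h (g b) x)" for x
  have sm: "segment_mean h (g b) \<in> borel_measurable borel" if "b \<in> Basis" for b
    using gm[OF that] by measurable
  have sfin: "integrable lborel (segment_mean h (g b))" if "b \<in> Basis" for b
    using sm[OF that] le_less_trans[OF L1_norm_segment_mean_le[OF gm[OF that]] gfin[OF that]]
    by (simp add: integrable_lborel_iff_L1_norm)
  have v: "integrable lborel v"
    unfolding v_def[abs_def] by (intro Bochner_Integration.integrable_sum integrable_mult_right sfin)
  have d: "integrable lborel (fdiff h u)"
    using integrable_lborel_shift[OF u, of h] u by (simp add: fdiff_def[abs_def])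
  have dv: "integrable lborel (\<lambda>x. fdiff h u x - v x)" using d v by simp
  have "AE x in lebesgue. x \<in> UNIV \<longrightarrow> fdiff h u x - v x = 0"
  proof (rule fundamental_lemma[OF open_UNIV])
    show "locally_integrable UNIV (\<lambda>x. fdiff h u x - v x)"
      unfolding locally_integrable_def set_integrable_def
    proof (intro allI impI)
      fix K :: "'a set" assume "compact K \<and> K \<subseteq> UNIV"
      then have "K \<in> sets lebesgue" by (simp add: compact_imp_closed borel_closed)
      moreover have "integrable lebesgue (\<lambda>x. fdiff h u x - v x)"
        using integrable_completion[of "\<lambda>x. fdiff h u x - v x" lborel] dv borel_measurable_integrable[OF dv] by simp
      ultimately show "integrable lebesgue (\<lambda>x. indicator K x *\<^sub>R (fdiff h u x - v x))"
        by (rule integrable_mult_indicator)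
    qed
    fix \<psi> :: "'a \<Rightarrow> real" assume \<psi>: "\<psi> \<in> test_functions UNIV"
    note \<psi>m[measurable] = test_function_continuous(2)[OF \<psi>]
    obtain M where M: "M \<ge> 0" "\<And>x. \<bar>\<psi> x\<bar> \<le> M" using test_function_bounded[OF \<psi>] by blast
    \<comment> \<open>For fixed s the weak derivative is tested against \<psi> translated by s h;
      Fubini in (s, x) collects these identities.\<close>
    have key: "(\<integral>x. u x * (\<integral>s. indicator {0..1} s * partial_deriv b \<psi> (x - s *\<^sub>R h) \<partial>lborel) \<partial>lborel)
        = - (\<integral>x. segment_mean h (g b) x * \<psi> x \<partial>lborel)
      \<and> integrable lborel (\<lambda>x. u x * (\<integral>s. indicator {0..1} s * partial_deriv b \<psi> (x - s *\<^sub>R h) \<partial>lborel))"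
      if b: "b \<in> Basis" for b
    proof -
      have pt: "partial_deriv b \<psi> \<in> test_functions UNIV" by (rule test_function_partial_deriv[OF \<psi> b])
      note pm[measurable] = test_function_continuous(2)[OF pt]
      note gmb[measurable] = gm[OF b]
      obtain M' where M': "M' \<ge> 0" "\<And>x. \<bar>partial_deriv b \<psi> x\<bar> \<le> M'" using test_function_bounded[OF pt] by blast
      let ?p = "\<lambda>s x. u x * partial_deriv b \<psi> (x - s *\<^sub>R h)"
      have p1: "case_prod ?p \<in> borel_measurable (lborel \<Otimes>\<^sub>M lborel)" by measurable
      have p2: "L1_norm (?p s) \<le> ennreal M' * L1_norm u" for s
        by (rule L1_norm_mult_bounded) (auto simp: M')
      have p3: "ennreal M' * L1_norm u < \<infinity>" using ufin by (simp add: ennreal_mult_less_top)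
      let ?r = "\<lambda>s x. g b (x + s *\<^sub>R h) * \<psi> x"
      have r1: "case_prod ?r \<in> borel_measurable (lborel \<Otimes>\<^sub>M lborel)" by measurable
      have r2: "L1_norm (?r s) \<le> ennreal M * L1_norm (g b)" for s
        using L1_norm_mult_bounded[of "\<lambda>x. g b (x + s *\<^sub>R h)" \<psi> M] M by (simp add: L1_norm_shift)
      have r3: "ennreal M * L1_norm (g b) < \<infinity>" using gfin[OF b] by (simp add: ennreal_mult_less_top)
      have shift: "(\<integral>x. ?p s x \<partial>lborel) = - (\<integral>x. ?r s x \<partial>lborel)" for s
      proof -
        have t: "(\<lambda>x. \<psi> (x + - (s *\<^sub>R h))) \<in> test_functions UNIV" by (rule test_function_shift[OF \<psi>])
        have "(\<integral>x. ?p s x \<partial>lborel) = (\<integral>x. u x * partial_deriv b (\<lambda>x. \<psi> (x + - (s *\<^sub>R h))) x \<partial>lborel)"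
          by (simp add: partial_deriv_shift)
        also have "\<dots> = - (\<integral>x. g b x * \<psi> (x - s *\<^sub>R h) \<partial>lborel)"
          using wp[OF b] t by (auto simp: weak_partial_def)
        also have "(\<integral>x. g b x * \<psi> (x - s *\<^sub>R h) \<partial>lborel) = (\<integral>x. ?r s x \<partial>lborel)"
          by (rule integral_shift_mult[symmetric]) measurable
        finally show ?thesis .
      qed
      have "(\<integral>x. u x * (\<integral>s. indicator {0..1} s * partial_deriv b \<psi> (x - s *\<^sub>R h) \<partial>lborel) \<partial>lborel)
          = (\<integral>x. \<integral>s. indicator {0..1} s * ?p s x \<partial>lborel \<partial>lborel)"
        by (simp add: mult.left_commute[of _ "u _"])
      also have "\<dots> = (\<integral>s. indicator {0..1} s * (\<integral>x. ?p s x \<partial>lborel) \<partial>lborel)"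
        by (rule segment_Fubini(1)[OF p1 p2 p3])
      also have "\<dots> = - (\<integral>s. indicator {0..1} s * (\<integral>x. ?r s x \<partial>lborel) \<partial>lborel)"
        by (simp add: shift)
      also have "(\<integral>s. indicator {0..1} s * (\<integral>x. ?r s x \<partial>lborel) \<partial>lborel) = (\<integral>x. \<integral>s. indicator {0..1} s * ?r s x \<partial>lborel \<partial>lborel)"
        by (rule segment_Fubini(1)[OF r1 r2 r3, symmetric])
      also have "\<dots> = (\<integral>x. segment_mean h (g b) x * \<psi> x \<partial>lborel)"
        by (simp add: segment_mean_def mult.assoc[symmetric])
      finally show ?thesis
        using segment_Fubini(2)[OF p1 p2 p3] by (simp add: mult.left_commute[of _ "u _"])
    qed
    have "(\<integral>x. fdiff h u x * \<psi> x \<partial>lborel) = (\<integral>x. u x * (\<psi> (x - h) - \<psi> x) \<partial>lborel)"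
    proof -
      have i: "integrable lborel (\<lambda>x. u (x + h) * \<psi> x)" "integrable lborel (\<lambda>x. u x * \<psi> x)"
        using integrable_mult_test[OF integrable_lborel_shift[OF u] \<psi>] integrable_mult_test[OF u \<psi>] by auto
      have j: "integrable lborel (\<lambda>x. u x * \<psi> (x - h))"
        using integrable_mult_test[OF u test_function_shift[OF \<psi>, of "- h"]] by simp
      have "(\<integral>x. fdiff h u x * \<psi> x \<partial>lborel) = (\<integral>x. u (x + h) * \<psi> x \<partial>lborel) - (\<integral>x. u x * \<psi> x \<partial>lborel)"
        using i by (simp add: fdiff_def left_diff_distrib)
      also have "(\<integral>x. u (x + h) * \<psi> x \<partial>lborel) = (\<integral>x. u x * \<psi> (x - h) \<partial>lborel)"
        by (rule integral_shift_mult) measurable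
      finally show ?thesis using i j by (simp add: right_diff_distrib)
    qed
    also have "\<dots> = (\<integral>x. (\<Sum>b\<in>Basis. - (h \<bullet> b) * (u x * (\<integral>s. indicator {0..1} s * partial_deriv b \<psi> (x - s *\<^sub>R h) \<partial>lborel))) \<partial>lborel)"
      unfolding test_function_line_integral[OF \<psi>]
      by (rule Bochner_Integration.integral_cong) (simp_all add: sum_distrib_left sum_negf mult_ac)
    also have "\<dots> = (\<Sum>b\<in>Basis. - (h \<bullet> b) * (\<integral>x. u x * (\<integral>s. indicator {0..1} s * partial_deriv b \<psi> (x - s *\<^sub>R h) \<partial>lborel) \<partial>lborel))"
      using key by (subst Bochner_Integration.integral_sum) auto
    also have "\<dots> = (\<Sum>b\<in>Basis. (h \<bullet> b) * (\<integral>x. segment_mean h (g b) x * \<psi> x \<partial>lborel))"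
      using key by (intro sum.cong refl) auto
    also have "\<dots> = (\<integral>x. (\<Sum>b\<in>Basis. (h \<bullet> b) * (segment_mean h (g b) x * \<psi> x)) \<partial>lborel)"
      using integrable_mult_test[OF sfin \<psi>] by (subst Bochner_Integration.integral_sum) auto
    also have "\<dots> = (\<integral>x. v x * \<psi> x \<partial>lborel)"
      by (simp add: v_def sum_distrib_right mult.assoc)
    finally have "(\<integral>x. (fdiff h u x - v x) * \<psi> x \<partial>lborel) = 0"
      using integrable_mult_test[OF d \<psi>] integrable_mult_test[OF v \<psi>] by (simp add: left_diff_distrib)
    moreover have "(LINT x:UNIV|lebesgue. (fdiff h u x - v x) * \<psi> x) = (\<integral>x. (fdiff h u x - v x) * \<psi> x \<partial>lborel)"
      by (rule set_lebesgue_integral_test) (use borel_measurable_integrable[OF dv] \<psi>m in auto)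
    ultimately show "(LINT x:UNIV|lebesgue. (fdiff h u x - v x) * \<psi> x) = 0" by simp
  qed
  then have "AE x in lebesgue. ennreal \<bar>fdiff h u x\<bar> = ennreal \<bar>v x\<bar>" by eventually_elim simp
  then have "L1_norm (fdiff h u) = L1_norm v" unfolding L1_norm_def by (rule nn_integral_cong_AE)
  also have "\<dots> \<le> (\<Sum>b\<in>Basis. L1_norm (\<lambda>x. (h \<bullet> b) * segment_mean h (g b) x))"
    unfolding v_def[abs_def] by (rule L1_norm_sum_le) (use sm in auto)
  also have "\<dots> \<le> (\<Sum>b\<in>Basis. ennreal (norm h) * L1_norm (g b))"
  proof (rule sum_mono)
    fix b :: 'a assume b: "b \<in> Basis"
    have "\<bar>h \<bullet> b\<bar> \<le> norm h" using b by (rule Basis_le_norm)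
    then show "L1_norm (\<lambda>x. (h \<bullet> b) * segment_mean h (g b) x) \<le> ennreal (norm h) * L1_norm (g b)"
      unfolding L1_norm_cmult[OF sm[OF b]]
      by (intro mult_mono ennreal_leI L1_norm_segment_mean_le gm b) auto
  qed
  finally show ?thesis by (simp add: sum_distrib_left)
qed

lemma words_Suc: "words (Suc k) = (\<lambda>(b, w). b # w) ` (Basis \<times> words k)"
proof -
  have "w \<in> (\<lambda>(b, w). b # w) ` (Basis \<times> words k)" if "w \<in> words (Suc k)" for w :: "'a list"
    using that by (cases w) (auto simp: words_def)
  then show ?thesis by (auto simp: words_def)
qed

text \<open>One difference is applied to the whole family first, so the induction hypothesis
  concerns the functions \<open>fdiff h (G w)\<close>; the remaining single difference costs one
  more derivative and a factor |h|.\<close>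

lemma L1_norm_fdiff_funpow_le:
  fixes G :: "'a::euclidean_space list \<Rightarrow> 'a \<Rightarrow> real"
  assumes "\<And>w b. set w \<subseteq> Basis \<Longrightarrow> length w < l \<Longrightarrow> b \<in> Basis \<Longrightarrow> weak_partial b (G w) (G (b # w))"
  shows "L1_norm ((fdiff h ^^ l) (G [])) \<le> ennreal (norm h ^ l) * (\<Sum>w\<in>words l. L1_norm (G w))"
  using assms
proof (induction l arbitrary: G)
  case 0
  have "words 0 = {[] :: 'a list}" by (auto simp: words_def)
  then show ?case by simp
next
  case (Suc l)
  have "L1_norm ((fdiff h ^^ Suc l) (G [])) = L1_norm ((fdiff h ^^ l) (fdiff h (G [])))"
    by (simp only: funpow_Suc_right comp_def)
  also have "\<dots> \<le> ennreal (norm h ^ l) * (\<Sum>w\<in>words l. L1_norm (fdiff h (G w)))"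
    by (rule Suc.IH[of "\<lambda>w. fdiff h (G w)"], rule weak_partial_fdiff[OF Suc.prems]) auto
  also have "\<dots> \<le> ennreal (norm h ^ l) * (\<Sum>w\<in>words l. ennreal (norm h) * (\<Sum>b\<in>Basis. L1_norm (G (b # w))))"
    by (intro mult_left_mono sum_mono L1_norm_fdiff_le) (auto intro: Suc.prems simp: words_def)
  also have "\<dots> = ennreal (norm h ^ Suc l) * (\<Sum>w\<in>words l. \<Sum>b\<in>Basis. L1_norm (G (b # w)))"
    by (simp add: ennreal_mult mult_ac sum_distrib_left[symmetric])
  also have "(\<Sum>w\<in>words l. \<Sum>b\<in>Basis. L1_norm (G (b # w))) = (\<Sum>w\<in>words (Suc l). L1_norm (G w))"
  proof -
    have "(\<Sum>w\<in>words (Suc l). L1_norm (G w)) = (\<Sum>(b, w)\<in>Basis \<times> words l. L1_norm (G (b # w)))"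
      unfolding words_Suc by (subst sum.reindex) (auto simp: inj_on_def split_beta')
    also have "\<dots> = (\<Sum>b\<in>Basis. \<Sum>w\<in>words l. L1_norm (G (b # w)))"
      by (rule sum.cartesian_product[symmetric])
    also have "\<dots> = (\<Sum>w\<in>words l. \<Sum>b\<in>Basis. L1_norm (G (b # w)))" by (rule sum.swap)
    finally show ?thesis by simp
  qed
  finally show ?case .
qed

section \<open>Besov functions\<close>

lemma AE_lborel_shift:
  fixes c :: "'a::euclidean_space"
  assumes "AE x in lborel. P x" shows "AE x in lborel. P (x + c)"
proof -
  obtain N where N: "{x \<in> space lborel. \<not> P x} \<subseteq> N" "emeasure lborel N = 0" "N \<in> sets lborel"
    using AE_E[OF assms] .
  have [measurable]: "N \<in> sets borel" using N by simp
  have "(\<integral>\<^sup>+x. indicator N (c + 1 *\<^sub>R x) \<partial>lborel) = 0"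
    using nn_integral_lborel_affine[of "indicator N" 1 c] N by simp
  then have "AE x in lborel. indicator N (c + x) = (0 :: ennreal)"
    by (subst (asm) nn_integral_0_iff_AE) auto
  then show ?thesis
    by eventually_elim (use N(1) in \<open>auto simp: indicator_def add.commute split: if_splits\<close>)
qed

text \<open>A difference of order q involves only q + 1 translates, each of which preserves null
  sets.\<close>

lemma L1_norm_fdiff_cong_AE:
  fixes f g :: "'a::euclidean_space \<Rightarrow> real"
  assumes "AE x in lebesgue. f x = g x"
  shows "L1_norm ((fdiff h ^^ q) f) = L1_norm ((fdiff h ^^ q) g)"
proof (rule L1_norm_cong_AE)
  have ae: "AE x in lborel. f x = g x" using assms by (simp add: AE_completion_iff)
  have "AE x in lborel. \<forall>j\<in>{..q}. f (x + real j *\<^sub>R h) = g (x + real j *\<^sub>R h)"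
    unfolding AE_ball_countable[OF countable_finite[OF finite_atMost]]
    by (intro ballI AE_lborel_shift[OF ae])
  then show "AE x in lborel. (fdiff h ^^ q) f x = (fdiff h ^^ q) g x"
    unfolding fdiff_funpow by eventually_elim simp
qed

lemma besov_seminorm_low_eq:
  fixes f g :: "'a::euclidean_space \<Rightarrow> real"
  assumes "AE x in lebesgue. f x = g x"
  shows "besov_seminorm_low s f = difference_energy (nat \<lfloor>s\<rfloor> + 1) s g"
  unfolding besov_seminorm_low_def difference_energy_def L1_norm_fdiff_cong_AE[OF assms] nn_integral_completion ..

lemma integrable_lebesgue_borel_version:
  fixes f :: "'a::euclidean_space \<Rightarrow> real"
  assumes f: "integrable lebesgue f"
  obtains g where "integrable lborel g" "AE x in lebesgue. f x = g x"
proof -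
  obtain g where g: "g \<in> borel_measurable borel" "AE x in lebesgue. f x = g x"
    using borel_version[OF borel_measurable_integrable[OF f]] .
  have gl: "g \<in> borel_measurable lebesgue" using g(1) by (simp add: measurable_completion)
  have "integrable lebesgue g"
    using integrable_cong_AE_imp[OF f gl] g(2) by (auto elim: eventually_mono)
  then have "integrable lborel g" using g(1) by (simp add: integrable_completion)
  then show thesis using that g(2) by blast
qed

lemma locally_integrable_UNIV_measurable:
  fixes u :: "'a::euclidean_space \<Rightarrow> real"
  assumes "locally_integrable UNIV u" shows "u \<in> borel_measurable lebesgue"
proof (rule borel_measurable_LIMSEQ_real)
  show "(\<lambda>x. indicator (cball 0 (real n)) x *\<^sub>R u x) \<in> borel_measurable lebesgue" for n
    using assms by (auto simp: locally_integrable_def set_integrable_def intro!: borel_measurable_integrable)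
  fix x :: 'a
  obtain m where m: "norm x \<le> real m" using real_arch_simple by blast
  have "\<forall>\<^sub>F n in sequentially. indicator (cball 0 (real n)) x *\<^sub>R u x = u x"
    using eventually_ge_at_top[of m] by eventually_elim (use m in \<open>auto simp: indicator_def\<close>)
  then show "(\<lambda>n. indicator (cball 0 (real n)) x *\<^sub>R u x) \<longlonglongrightarrow> u x" by (rule tendsto_eventually)
qed

lemma integrable_lebesgue_iff_L1_norm:
  fixes f :: "'a::euclidean_space \<Rightarrow> real"
  shows "integrable lebesgue f \<longleftrightarrow> f \<in> borel_measurable lebesgue \<and> L1_norm f < \<infinity>"
  by (simp add: integrable_iff_bounded L1_norm_def)

lemma L1_norm_weak_deriv_le:
  fixes f :: "'a::euclidean_space \<Rightarrow> real"
  assumes w: "w \<in> words j" "1 \<le> j" "j \<le> k"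
  shows "L1_norm (weak_deriv UNIV (mset w) f) \<le> sobolev_norm UNIV (\<lambda>x. 1) k f"
proof -
  have "\<bar>weak_deriv UNIV (mset w) f x\<bar> \<le> grad_norm UNIV j f x" for x
  proof -
    have "(weak_deriv UNIV (mset w) f x)\<^sup>2 \<le> (\<Sum>w\<in>words j. (weak_deriv UNIV (mset w) f x)\<^sup>2)"
      by (rule member_le_sum[OF w(1)]) (auto intro: finite_words)
    then show ?thesis unfolding grad_norm_def by (intro real_le_rsqrt) simp
  qed
  then have "L1_norm (weak_deriv UNIV (mset w) f) \<le> (\<integral>\<^sup>+x\<in>UNIV. ennreal (1 * grad_norm UNIV j f x) \<partial>lebesgue)"
    unfolding L1_norm_def by (intro nn_integral_mono) (simp add: ennreal_leI)
  also have "\<dots> \<le> (\<Sum>j=1..k. \<integral>\<^sup>+x\<in>UNIV. ennreal (1 * grad_norm UNIV j f x) \<partial>lebesgue)"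
    using sum_mono2[of "{1..k}" "{j}" "\<lambda>j. \<integral>\<^sup>+x\<in>UNIV. ennreal (1 * grad_norm UNIV j f x) \<partial>lebesgue"] w by simp
  also have "\<dots> \<le> sobolev_norm UNIV (\<lambda>x. 1) k f"
    unfolding sobolev_norm_def by simp
  finally show ?thesis .
qed

lemma L1_norm_le_sobolev_norm: "L1_norm f \<le> sobolev_norm UNIV (\<lambda>x. 1) k f"
  by (simp add: L1_norm_def sobolev_norm_def)

lemma has_weak_deriv_empty: "locally_integrable \<Omega> u \<Longrightarrow> has_weak_deriv \<Omega> {#} u u"
  by (simp add: has_weak_deriv_def iter_partial_def)

text \<open>The derivative along \<open>w\<close> is tested against \<partial>_b \<psi> and the
  derivative along \<open>b # w\<close> against \<psi>. Both express the same integral of f, and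
  cancelling the sign leaves the first-order identity.\<close>

lemma has_weak_deriv_Cons_imp_weak_partial:
  fixes f :: "'a::euclidean_space \<Rightarrow> real"
  assumes w: "set w \<subseteq> Basis" "b \<in> Basis"
    and u: "has_weak_deriv UNIV (mset w) f u" "AE x in lebesgue. u x = u' x" "integrable lborel u'"
    and g: "has_weak_deriv UNIV (mset (b # w)) f g" "AE x in lebesgue. g x = g' x" "integrable lborel g'"
  shows "weak_partial b u' g'"
  unfolding weak_partial_def
proof (intro conjI ballI u(3) g(3))
  fix \<psi> :: "'a \<Rightarrow> real" assume \<psi>: "\<psi> \<in> test_functions UNIV"
  have \<psi>b: "partial_deriv b \<psi> \<in> test_functions UNIV" by (rule test_function_partial_deriv[OF \<psi> w(2)])
  have transfer: "(LINT x:UNIV|lebesgue. v x * \<zeta> x) = (\<integral>x. v' x * \<zeta> x \<partial>lborel)"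
    if v: "locally_integrable UNIV v" "AE x in lebesgue. v x = v' x" "integrable lborel v'"
      and \<zeta>: "\<zeta> \<in> test_functions UNIV" for v v' \<zeta> :: "'a \<Rightarrow> real"
  proof -
    have \<zeta>m: "\<zeta> \<in> borel_measurable borel" by (rule test_function_continuous(2)[OF \<zeta>])
    have v'm: "v' \<in> borel_measurable borel" using borel_measurable_integrable[OF v(3)] by simp
    have "(LINT x:UNIV|lebesgue. v x * \<zeta> x) = (\<integral>x. v' x * \<zeta> x \<partial>lebesgue)"
      unfolding set_lebesgue_integral_def
    proof (rule integral_cong_AE)
      have \<zeta>l: "\<zeta> \<in> borel_measurable lebesgue" "v' \<in> borel_measurable lebesgue"
        using \<zeta>m v'm by (simp_all add: measurable_completion)
      show "(\<lambda>x. indicator UNIV x *\<^sub>R (v x * \<zeta> x)) \<in> borel_measurable lebesgue"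
        using borel_measurable_times[OF locally_integrable_UNIV_measurable[OF v(1)] \<zeta>l(1)] by simp
      show "(\<lambda>x. v' x * \<zeta> x) \<in> borel_measurable lebesgue" by (rule borel_measurable_times[OF \<zeta>l(2,1)])
      show "AE x in lebesgue. indicator UNIV x *\<^sub>R (v x * \<zeta> x) = v' x * \<zeta> x"
        using v(2) by eventually_elim simp
    qed
    also have "\<dots> = (\<integral>x. v' x * \<zeta> x \<partial>lborel)"
      by (rule integral_completion) (use \<zeta>m v'm in simp)
    finally show ?thesis .
  qed
  have loc: "locally_integrable UNIV u" "locally_integrable UNIV g"
    using u(1) g(1) by (auto simp: has_weak_deriv_def)
  have "(LINT x:UNIV|lebesgue. f x * iter_partial w (partial_deriv b \<psi>) x)
      = (-1) ^ length w * (LINT x:UNIV|lebesgue. u x * partial_deriv b \<psi> x)"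
    using u(1) \<psi>b by (auto simp: has_weak_deriv_def)
  moreover have "(LINT x:UNIV|lebesgue. f x * iter_partial (w @ [b]) \<psi> x)
      = (-1) ^ Suc (length w) * (LINT x:UNIV|lebesgue. g x * \<psi> x)"
  proof -
    \<comment> \<open>The new derivative is applied to \<psi> first, hence at the end of the word;
      \<open>has_weak_deriv\<close> admits every ordering of the multiset.\<close>
    have "mset (w @ [b]) = mset (b # w)" by simp
    then show ?thesis using g(1) \<psi> unfolding has_weak_deriv_def by (metis size_mset length_Cons)
  qed
  moreover have "iter_partial (w @ [b]) \<psi> = iter_partial w (partial_deriv b \<psi>)"
    by (simp add: iter_partial_def)
  ultimately have "(-1) ^ length w * (LINT x:UNIV|lebesgue. u x * partial_deriv b \<psi> x)
      = (-1) ^ length w * - (LINT x:UNIV|lebesgue. g x * \<psi> x)"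
    by simp
  then have "(LINT x:UNIV|lebesgue. u x * partial_deriv b \<psi> x) = - (LINT x:UNIV|lebesgue. g x * \<psi> x)"
    unfolding mult_cancel_left by simp
  then show "(\<integral>x. u' x * partial_deriv b \<psi> x \<partial>lborel) = - (\<integral>x. g' x * \<psi> x \<partial>lborel)"
    by (simp only: transfer[OF loc(1) u(2,3) \<psi>b] transfer[OF loc(2) g(2,3) \<psi>])
qed

section \<open>Besov norms bounded below by difference energies\<close>

lemma besov_order:
  assumes "1 < s"
  shows "1 \<le> besov_order s" "real (besov_order s) < s" "s \<le> real (besov_order s) + 1"
proof -
  let ?A = "{j. 1 \<le> j \<and> real j < s}"
  have "?A \<subseteq> {..nat \<lceil>s\<rceil>}" by (auto simp: le_nat_iff) linarith
  then have fin: "finite ?A" by (rule finite_subset) simp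
  moreover have "1 \<in> ?A" using assms by simp
  ultimately have "Max ?A \<in> ?A" by (intro Max_in) auto
  then show "1 \<le> besov_order s" "real (besov_order s) < s" by (auto simp: besov_order_def)
  show "s \<le> real (besov_order s) + 1"
  proof (rule ccontr)
    assume "\<not> ?thesis"
    then have "Suc (besov_order s) \<in> ?A" by simp
    then have "Suc (besov_order s) \<le> Max ?A" using fin by (intro Max_ge)
    then show False by (simp add: besov_order_def)
  qed
qed

text \<open>For s > 1, \<open>besov_order s\<close> differences are exchanged for derivatives, and
  the others are those of the seminorm of index s - \<open>besov_order s\<close>, which lies in (0,
  1].\<close>

definition besov_differences :: "real \<Rightarrow> nat" where
  "besov_differences s = (if s \<le> 1 then nat \<lfloor>s\<rfloor> + 1 else besov_order s + (nat \<lfloor>s - besov_order s\<rfloor> + 1))"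

text \<open>For fixed h the first l differences cost a factor |h|^l and l derivatives. That factor
  turns the kernel exponent n + s into n + (s - l).\<close>

lemma difference_energy_le_derivatives:
  fixes G :: "'a::euclidean_space list \<Rightarrow> 'a \<Rightarrow> real"
  assumes wp: "\<And>w b. set w \<subseteq> Basis \<Longrightarrow> length w < l \<Longrightarrow> b \<in> Basis \<Longrightarrow> weak_partial b (G w) (G (b # w))"
    and Gm: "\<And>w. w \<in> words l \<Longrightarrow> G w \<in> borel_measurable borel"
  shows "difference_energy (l + p) s (G []) \<le> (\<Sum>w\<in>words l. difference_energy p (s - l) (G w))"
proof -
  let ?n = "real DIM('a)"
  have "difference_energy (l + p) s (G []) \<le>
      (\<integral>\<^sup>+h. (\<Sum>w\<in>words l. L1_norm ((fdiff h ^^ p) (G w)) / ennreal (norm h powr (?n + (s - l)))) \<partial>lborel)"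
    unfolding difference_energy_def
  \<comment> \<open>The origin is a null set; away from it |h| > 0 and its powers can be
    cancelled.\<close>
  proof (rule nn_integral_mono_AE, rule AE_mp[OF AE_lborel_singleton[of 0]], intro AE_I2 impI)
    fix h :: 'a assume h: "h \<noteq> 0"
    let ?S = "\<Sum>w\<in>words l. L1_norm ((fdiff h ^^ p) (G w))"
    have le: "L1_norm ((fdiff h ^^ (l + p)) (G [])) \<le> ennreal (norm h ^ l) * ?S"
      unfolding funpow_add comp_def
      by (rule L1_norm_fdiff_funpow_le[of l "\<lambda>w. (fdiff h ^^ p) (G w)"])
        (auto intro: weak_partial_fdiff_funpow wp)
    show "L1_norm ((fdiff h ^^ (l + p)) (G [])) / ennreal (norm h powr (?n + s))
        \<le> (\<Sum>w\<in>words l. L1_norm ((fdiff h ^^ p) (G w)) / ennreal (norm h powr (?n + (s - l))))"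
    proof -
      have "L1_norm ((fdiff h ^^ (l + p)) (G [])) / ennreal (norm h powr (?n + s))
          \<le> (ennreal (norm h ^ l) * ?S) / ennreal (norm h powr (?n + s))"
        by (rule divide_right_mono_ennreal[OF le])
      also have "\<dots> = ?S * (ennreal (norm h ^ l) * inverse (ennreal (norm h powr (?n + s))))"
        by (simp add: divide_ennreal_def mult_ac)
      also have "ennreal (norm h ^ l) * inverse (ennreal (norm h powr (?n + s))) = inverse (ennreal (norm h powr (?n + (s - l))))"
      proof -
        have "norm h powr (?n + s) = norm h ^ l * norm h powr (?n + (s - l))"
          using h by (simp add: powr_realpow[symmetric] powr_add[symmetric])
        then have "norm h ^ l * inverse (norm h powr (?n + s)) = inverse (norm h powr (?n + (s - l)))"
          using h by simp
        then show ?thesis using h by (simp add: inverse_ennreal ennreal_mult[symmetric])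
      qed
      finally show ?thesis by (simp add: divide_ennreal_def sum_distrib_right)
    qed
  qed
  also have "\<dots> = (\<Sum>w\<in>words l. difference_energy p (s - l) (G w))"
    unfolding difference_energy_def
  proof (rule nn_integral_sum)
    fix w :: "'a list" assume "w \<in> words l"
    note Gm[OF this, measurable]
    show "(\<lambda>h. L1_norm ((fdiff h ^^ p) (G w)) / ennreal (norm h powr (?n + (s - l)))) \<in> borel_measurable lborel"
      by measurable
  qed
  finally show ?thesis .
qed

text \<open>The Tonelli arguments run over \<open>lborel\<close>, so f and all its derivatives are
  replaced simultaneously by Borel representatives. The difference energy of the representative is
  then compared with the seminorm of the derivatives of f.\<close>

lemma besov_borel_version:
  fixes f :: "'a::euclidean_space \<Rightarrow> real"
  assumes f: "f \<in> besov_space s"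
  obtains g where "integrable lebesgue f" "integrable lborel g" "AE x in lebesgue. f x = g x"
    "L1_norm g + difference_energy (besov_differences s) s g
      \<le> of_nat (1 + card (words (besov_order s) :: 'a list set)) * besov_norm s f"
    "besov_norm s f < \<infinity>"
proof (cases "s \<le> 1")
  case True
  then have fi: "integrable lebesgue f"
    using f by (simp add: besov_space_def besov_base_def L1_space_def)
  obtain g where g: "integrable lborel g" "AE x in lebesgue. f x = g x"
    using integrable_lebesgue_borel_version[OF fi] .
  have L: "L1_norm g = L1_norm f"
    unfolding L1_norm_def by (rule nn_integral_cong_AE) (use g(2) in eventually_elim, simp)
  have eq: "besov_norm s f = L1_norm g + difference_energy (besov_differences s) s g"
    using True by (simp add: besov_norm_def besov_base_norm_def besov_seminorm_def L besov_differences_def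
        besov_seminorm_low_eq[OF g(2)])
  have "besov_norm s f < \<infinity>"
    using f fi True by (simp add: besov_norm_def besov_space_def besov_base_norm_def integrable_lebesgue_iff_L1_norm)
  \<comment> \<open>For s <= 1 the set defining \<open>besov_order s\<close> is empty, so the count
    of words is unspecified; the factor is at least 1 in any case.\<close>
  moreover have "besov_norm s f \<le> of_nat (1 + card (words (besov_order s) :: 'a list set)) * besov_norm s f"
    by (simp add: distrib_right)
  ultimately show thesis using that[OF fi g] eq by simp
next
  case False
  let ?l = "besov_order s" and ?W = "words (besov_order s) :: 'a list set"
  let ?p = "nat \<lfloor>s - besov_order s\<rfloor> + 1"
  have l: "1 \<le> ?l" "real ?l < s" using besov_order[of s] False by auto
  have sob: "f \<in> sobolev_space UNIV (\<lambda>x. 1) ?l" and semi: "besov_seminorm s f < \<infinity>"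
    using f False by (auto simp: besov_space_def besov_base_def)
  \<comment> \<open>The empty word is assigned f itself instead of the representative chosen by
    \<open>weak_deriv\<close>, so that the chain of derivatives starts at f.\<close>
  define H where "H w = (if w = [] then f else weak_deriv UNIV (mset w) f)" for w
  have ex: "\<exists>g. has_weak_deriv UNIV \<alpha> f g" if "\<alpha> \<in> multi_indices j" "j \<le> ?l" for \<alpha> j
    using sob that by (auto simp: sobolev_space_def sobolev_loc_def)
  have e: "({#} :: 'a multiset) \<in> multi_indices 0" by (simp add: multi_indices_def)
  have floc: "locally_integrable UNIV f" using ex[OF e] by (auto simp: has_weak_deriv_def)
  have H: "has_weak_deriv UNIV (mset w) f (H w)" if "w \<in> words j" "j \<le> ?l" for w j
    using ex[OF mset_words[OF that(1)] that(2)] has_weak_deriv_empty[OF floc]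
    by (auto simp: H_def intro: weak_deriv_works)
  have sfin: "sobolev_norm UNIV (\<lambda>x. 1) ?l f < \<infinity>" using sob by (simp add: sobolev_space_def)
  have Hi: "integrable lebesgue (H w)" if w: "w \<in> words j" "j \<le> ?l" for w j
  proof -
    have "locally_integrable UNIV (H w)" using H[OF w] by (simp add: has_weak_deriv_def)
    moreover have "L1_norm (H w) < \<infinity>"
    proof (cases "w = []")
      case True
      then show ?thesis using le_less_trans[OF L1_norm_le_sobolev_norm sfin] by (simp add: H_def)
    next
      case False
      then have "1 \<le> j" using w by (cases w) (auto simp: words_def)
      then show ?thesis
        using le_less_trans[OF L1_norm_weak_deriv_le[OF w(1) _ w(2)] sfin] False by (simp add: H_def)
    qed
    ultimately show ?thesis
      using locally_integrable_UNIV_measurable by (simp add: integrable_lebesgue_iff_L1_norm)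
  qed
  \<comment> \<open>Borel representatives for all words of length up to the Besov order;
    neighbouring words must be related by \<open>weak_partial\<close>, so a single choice function
    \<open>G\<close> is extracted.\<close>
  have "\<forall>w. \<exists>g. set w \<subseteq> Basis \<and> length w \<le> ?l \<longrightarrow> integrable lborel g \<and> (AE x in lebesgue. H w x = g x)"
  proof
    fix w
    show "\<exists>g. set w \<subseteq> Basis \<and> length w \<le> ?l \<longrightarrow> integrable lborel g \<and> (AE x in lebesgue. H w x = g x)"
    proof (cases "set w \<subseteq> Basis \<and> length w \<le> ?l")
      case True
      then have "integrable lebesgue (H w)" using Hi[of w "length w"] by (simp add: words_def)
      from integrable_lebesgue_borel_version[OF this] show ?thesis by metis
    qed blast
  qed
  then obtain G where G: "\<And>w. set w \<subseteq> Basis \<Longrightarrow> length w \<le> ?l \<Longrightarrow> integrable lborel (G w)"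
    "\<And>w. set w \<subseteq> Basis \<Longrightarrow> length w \<le> ?l \<Longrightarrow> AE x in lebesgue. H w x = G w x"
    by metis
  have "difference_energy (besov_differences s) s (G []) \<le> (\<Sum>w\<in>?W. difference_energy ?p (s - ?l) (G w))"
  proof -
    have "weak_partial b (G w) (G (b # w))" if w: "set w \<subseteq> Basis" "length w < ?l" "b \<in> Basis" for w b
    proof (rule has_weak_deriv_Cons_imp_weak_partial[OF w(1,3)])
      show "has_weak_deriv UNIV (mset w) f (H w)" using H[of w "length w"] w by (simp add: words_def)
      show "has_weak_deriv UNIV (mset (b # w)) f (H (b # w))" using H[of "b # w" "length (b # w)"] w by (simp add: words_def)
    qed (use G[of w] G[of "b # w"] w in auto)
    moreover have "G w \<in> borel_measurable borel" if "w \<in> ?W" for w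
      using borel_measurable_integrable[OF G(1)[of w]] that by (simp add: words_def)
    ultimately show ?thesis
      using difference_energy_le_derivatives[of ?l G ?p s] False by (simp add: besov_differences_def)
  qed
  \<comment> \<open>Several words may enumerate one multi-index; each energy is therefore bounded by
    the whole seminorm, and the number of words enters the constant.\<close>
  also have "\<dots> \<le> (\<Sum>w\<in>?W. besov_seminorm s f)"
  proof (rule sum_mono)
    fix w assume w: "w \<in> ?W"
    have "H w = weak_deriv UNIV (mset w) f" using w l(1) by (auto simp: H_def words_def)
    moreover have "AE x in lebesgue. H w x = G w x" using G(2)[of w] w by (simp add: words_def)
    ultimately have "difference_energy ?p (s - ?l) (G w) = besov_seminorm_low (s - ?l) (weak_deriv UNIV (mset w) f)"
      using besov_seminorm_low_eq[of "H w" "G w" "s - ?l"] by simp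
    also have "\<dots> \<le> (\<Sum>\<alpha>\<in>multi_indices ?l. besov_seminorm_low (s - ?l) (weak_deriv UNIV \<alpha> f))"
      using sum_mono2[OF finite_multi_indices, of "{mset w}" ?l "\<lambda>\<alpha>. besov_seminorm_low (s - ?l) (weak_deriv UNIV \<alpha> f)"]
        mset_words[OF w] by simp
    finally show "difference_energy ?p (s - ?l) (G w) \<le> besov_seminorm s f"
      using False by (simp add: besov_seminorm_def)
  qed
  also have "\<dots> = of_nat (card ?W) * besov_seminorm s f" by simp
  finally have en: "difference_energy (besov_differences s) s (G []) \<le> of_nat (card ?W) * besov_seminorm s f" .
  have G0: "integrable lborel (G [])" "AE x in lebesgue. f x = G [] x"
    using G[of "[]"] by (auto simp: H_def)
  have "L1_norm (G []) = L1_norm f"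
    unfolding L1_norm_def by (rule nn_integral_cong_AE) (use G0(2) in eventually_elim, simp)
  also have "\<dots> \<le> besov_norm s f"
    using False L1_norm_le_sobolev_norm[of f ?l] by (simp add: besov_norm_def besov_base_norm_def add_increasing2)
  finally have "L1_norm (G []) + difference_energy (besov_differences s) s (G [])
      \<le> besov_norm s f + of_nat (card ?W) * besov_norm s f"
    by (intro add_mono order_trans[OF en] mult_left_mono) (auto simp: besov_norm_def)
  also have "\<dots> = of_nat (1 + card ?W) * besov_norm s f" by (simp add: distrib_right)
  finally have le: "L1_norm (G []) + difference_energy (besov_differences s) s (G [])
      \<le> of_nat (1 + card ?W) * besov_norm s f" .
  have "integrable lebesgue f" using Hi[of "[]" 0] by (simp add: H_def words_def)
  moreover have "besov_norm s f < \<infinity>"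
    using sfin semi False by (simp add: besov_norm_def besov_base_norm_def)
  ultimately show thesis using that[OF _ G0 le] by blast
qed

text \<open>The extension is constructed for a Borel representative of f; since
  \<open>admits_extension\<close> asserts the trace for every integrable function equal to it almost
  everywhere, the trace is f itself.\<close>

lemma extension_subcritical:
  fixes m :: nat and a :: real
  assumes a: "-1 < a" "a < m"
  shows "\<exists>C>0. \<forall>f :: 'a::euclidean_space \<Rightarrow> real. f \<in> besov_space (m - a) \<longrightarrow>
    (\<exists>F \<in> half_sobolev_space (m + 1) a. has_trace F f \<and>
       half_sobolev_norm (m + 1) a F \<le> ennreal C * besov_norm (m - a) f)"
proof -
  let ?s = "m - a"
  let ?q = "besov_differences ?s"
  let ?k = "1 + card (words (besov_order ?s) :: 'a list set)"
  obtain C where C: "C > 0" and ext: "\<And>f :: 'a \<Rightarrow> real. integrable lborel f \<Longrightarrow> difference_energy ?q ?s f < \<infinity> \<Longrightarrow>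
    admits_extension m a f (ennreal C * (L1_norm f + difference_energy ?q ?s f))"
    using extension_from_differences[OF a, where 'a='a] by blast
  show ?thesis
  proof (intro exI[of _ "C * ?k"] conjI allI impI)
    fix f :: "'a \<Rightarrow> real" assume f: "f \<in> besov_space ?s"
    obtain g where fi: "integrable lebesgue f" and g: "integrable lborel g" "AE x in lebesgue. f x = g x"
      and le: "L1_norm g + difference_energy ?q ?s g \<le> of_nat ?k * besov_norm ?s f"
      and fin: "besov_norm ?s f < \<infinity>"
      using besov_borel_version[OF f] .
    have "L1_norm g + difference_energy ?q ?s g < \<infinity>"
      by (rule le_less_trans[OF le]) (use fin in \<open>auto simp: ennreal_mult_less_top of_nat_less_top\<close>)
    then obtain F where F: "F \<in> half_sobolev_space (m + 1) a"
      "\<forall>f'. integrable lebesgue f' \<longrightarrow> (AE x in lebesgue. g x = f' x) \<longrightarrow> has_trace F f'"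
      "half_sobolev_norm (m + 1) a F \<le> ennreal C * (L1_norm g + difference_energy ?q ?s g)"
      using ext[OF g(1)] by (auto simp: ennreal_add_less_top admits_extension_def)
    show "\<exists>F \<in> half_sobolev_space (m + 1) a. has_trace F f \<and>
       half_sobolev_norm (m + 1) a F \<le> ennreal (C * ?k) * besov_norm ?s f"
    proof (intro bexI[OF _ F(1)] conjI)
      show "has_trace F f"
        by (rule F(2)[rule_format, OF fi]) (use g(2) in eventually_elim, simp)
      have "half_sobolev_norm (m + 1) a F \<le> ennreal C * (of_nat ?k * besov_norm ?s f)"
        by (rule order_trans[OF F(3)]) (rule mult_left_mono[OF le], simp)
      also have "\<dots> = ennreal (C * ?k) * besov_norm ?s f"
        using C by (simp add: ennreal_mult ennreal_of_nat_eq_real_of_nat mult.assoc del: of_nat_Suc of_nat_add)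
      finally show "half_sobolev_norm (m + 1) a F \<le> ennreal (C * ?k) * besov_norm ?s f" .
    qed
  qed (use C in simp)
qed

theorem theorem1p3:
  fixes m :: nat and a :: real
  assumes "-1 < a" and "a \<le> real m"
  shows "(a < real m \<longrightarrow>
           (\<exists>C>0. \<forall>f :: real^'n \<Rightarrow> real. f \<in> besov_space (real m - a) \<longrightarrow>
              (\<exists>F \<in> half_sobolev_space (m + 1) a. has_trace F f \<and>
                 half_sobolev_norm (m + 1) a F \<le> ennreal C * besov_norm (real m - a) f))) \<and>
         (a = real m \<longrightarrow>
           (\<exists>C>0. \<forall>f :: real^'n \<Rightarrow> real. f \<in> L1_space \<longrightarrow>
              (\<exists>F \<in> half_sobolev_space (m + 1) (real m). has_trace F f \<and>
                 half_sobolev_norm (m + 1) (real m) F \<le> ennreal C * L1_norm f)))"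
  using extension_subcritical[OF assms(1)] extension_critical by blast

end
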